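(* Let $a>0$. The spectrum of $\hat H_f=-\frac12(e-f-h)$ in the $\mathfrak{osp}(1|2)$ representation space $V=\ell^2(\mathbb{Z}_+)$ with parameter $a$ equals $\mathbb{R}^+=[0,\infty)$ with multiplicity two.
   Context: Representation space: $V=\ell^2(\mathbb{Z}_+)$ is the Hilbert space of square-summable complex sequences with orthonormal standard basis $e_0,e_1,e_2,\dots$. For $a>0$ the positive discrete series representation of $\mathfrak{osp}(1|2)$ is given by operators $b^\pm$ acting on basis vectors by $$b^+e_{2n}=\sqrt{2(n+a)}\,e_{2n+1},\quad b^-e_{2n}=\sqrt{2n}\,e_{2n-1},\quad b^+e_{2n+1}=\sqrt{2(n+1)}\,e_{2n+2},\quad b^-e_{2n+1}=\sqrt{2(n+a)}\,e_{2n}$$ (with $b^-e_0=0$). The operators $h,e,f$ (not to be confused with basis vectors) are $$h=\tfrac12(b^+b^-+b^-b^+),\qquad e=\tfrac12(b^+)^2,\qquad f=-\tfrac12(b^-)^2.$$ With $\hat p=\frac{i(b^+-b^-)}{\sqrt2}$, one has $\hat H_f=\frac12\hat p^2=-\frac14\left((b^+)^2+(b^-)^2-(b^+b^-+b^-b^+)\right)=-\frac12(e-f-h)$, the free-particle Hamiltonian. $\hat H_f$ is first defined on the span of the $e_n$ (finite linear combinations); the operator in $V$ is its closure, which is self-adjoint, and "spectrum" refers to it. "Spectrum $S$ with multiplicity two" means uniform spectral multiplicity two: $V=V_0\oplus V_1$, with $V_0,V_1$ the closed spans of the $e_{2n}$ and of the $e_{2n+1}$, the operator preserves $V_0$ and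 $V_1$, and on each it has simple spectrum equal to $S$. *)

theory Defs
  imports "HOL-Analysis.Analysis"
begin

section \<open>The Hilbert space of square-summable complex sequences\<close>

typedef ell2 = "{x :: nat \<Rightarrow> complex. summable (\<lambda>n. (cmod (x n))\<^sup>2)}"
  morphisms coord Abs_ell2
  by (rule exI[of _ "\<lambda>_. 0"]) simp

setup_lifting type_definition_ell2

lemma summable_coord: "summable (\<lambda>n. (cmod (coord x n))\<^sup>2)"
  using coord[of x] by simp

lemma summable_cmod_mult:
  fixes x y :: "nat \<Rightarrow> complex"
  assumes "summable (\<lambda>n. (cmod (x n))\<^sup>2)" "summable (\<lambda>n. (cmod (y n))\<^sup>2)"
  shows "summable (\<lambda>n. cmod (x n) * cmod (y n))"
proof (rule summable_comparison_test')
  show "summable (\<lambda>n. (cmod (x n))\<^sup>2 + (cmod (y n))\<^sup>2)"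
    using assms by (rule summable_add)
  show "norm (cmod (x n) * cmod (y n)) \<le> (cmod (x n))\<^sup>2 + (cmod (y n))\<^sup>2" for n
  proof -
    have "0 \<le> cmod (x n) * cmod (y n)" by simp
    moreover have "2 * (cmod (x n) * cmod (y n)) \<le> (cmod (x n))\<^sup>2 + (cmod (y n))\<^sup>2"
      using sum_squares_bound[of "cmod (x n)" "cmod (y n)"] by (simp add: mult.assoc)
    ultimately show ?thesis unfolding real_norm_def by linarith
  qed
qed

instantiation ell2 :: real_vector
begin

lift_definition zero_ell2 :: ell2 is "\<lambda>_. 0" by simp

lift_definition plus_ell2 :: "ell2 \<Rightarrow> ell2 \<Rightarrow> ell2" is "\<lambda>x y n. x n + y n"
proof -
  fix x y :: "nat \<Rightarrow> complex"
  assume a: "summable (\<lambda>n. (cmod (x n))\<^sup>2)" "summable (\<lambda>n. (cmod (y n))\<^sup>2)"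
  show "summable (\<lambda>n. (cmod (x n + y n))\<^sup>2)"
  proof (rule summable_comparison_test')
    show "summable (\<lambda>n. (cmod (x n))\<^sup>2 + 2 * (cmod (x n) * cmod (y n)) + (cmod (y n))\<^sup>2)"
      using a by (intro summable_add summable_mult summable_cmod_mult)
    show "norm ((cmod (x n + y n))\<^sup>2)
        \<le> (cmod (x n))\<^sup>2 + 2 * (cmod (x n) * cmod (y n)) + (cmod (y n))\<^sup>2" for n
      using power_mono[OF norm_triangle_ineq[of "x n" "y n"], of 2]
      by (simp add: power2_sum algebra_simps)
  qed
qed

lift_definition uminus_ell2 :: "ell2 \<Rightarrow> ell2" is "\<lambda>x n. - x n" by simp

definition minus_ell2 :: "ell2 \<Rightarrow> ell2 \<Rightarrow> ell2" where
  "minus_ell2 x y = x + (- y)"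

lift_definition scaleR_ell2 :: "real \<Rightarrow> ell2 \<Rightarrow> ell2" is "\<lambda>r x n. complex_of_real r * x n"
  by (simp add: norm_mult power_mult_distrib summable_mult)

instance
proof
  fix x y z :: ell2 and r s :: real
  show "x + y + z = x + (y + z)" by transfer (simp add: add.assoc)
  show "x + y = y + x" by transfer (simp add: add.commute)
  show "0 + x = x" by transfer simp
  show "- x + x = 0" by transfer simp
  show "x - y = x + - y" by (simp only: minus_ell2_def)
  show "r *\<^sub>R (x + y) = r *\<^sub>R x + r *\<^sub>R y" by transfer (simp add: distrib_left)
  show "(r + s) *\<^sub>R x = r *\<^sub>R x + s *\<^sub>R x" by transfer (simp add: distrib_right)
  show "r *\<^sub>R s *\<^sub>R x = (r * s) *\<^sub>R x" by transfer (simp add: mult.assoc)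
  show "1 *\<^sub>R x = x" by transfer simp
qed

end

lift_definition scaleC :: "complex \<Rightarrow> ell2 \<Rightarrow> ell2"  (infixr "*\<^sub>C" 75)
  is "\<lambda>c x n. c * x n"
  by (simp add: norm_mult power_mult_distrib summable_mult)

lemma vector_space_scaleC: "vector_space scaleC"
  by standard (transfer, simp add: algebra_simps)+

definition cinner :: "ell2 \<Rightarrow> ell2 \<Rightarrow> complex" where
  "cinner x y = (\<Sum>n. cnj (coord x n) * coord y n)"

lemma summable_cinner: "summable (\<lambda>n. cnj (coord x n) * coord y n)"
  by (rule summable_norm_cancel)
    (simp add: norm_mult summable_cmod_mult summable_coord)

instantiation ell2 :: real_inner
begin

definition inner_ell2 :: "ell2 \<Rightarrow> ell2 \<Rightarrow> real" where
  "inner_ell2 x y = Re (cinner x y)"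

definition norm_ell2 :: "ell2 \<Rightarrow> real" where
  "norm_ell2 x = sqrt (inner x x)"

definition sgn_ell2 :: "ell2 \<Rightarrow> ell2" where
  "sgn_ell2 x = x /\<^sub>R norm x"

definition dist_ell2 :: "ell2 \<Rightarrow> ell2 \<Rightarrow> real" where
  "dist_ell2 x y = norm (x - y)"

definition uniformity_ell2 :: "(ell2 \<times> ell2) filter" where
  "uniformity_ell2 = (INF e\<in>{0 <..}. principal {(x, y). dist x y < e})"

definition open_ell2 :: "ell2 set \<Rightarrow> bool" where
  "open_ell2 U \<longleftrightarrow> (\<forall>x\<in>U. eventually (\<lambda>(x', y). x' = x \<longrightarrow> y \<in> U) uniformity)"

lemma inner_ell2_suminf: "inner x y = (\<Sum>n. Re (cnj (coord x n) * coord y n))"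
  unfolding inner_ell2_def cinner_def
    by (rule bounded_linear.suminf[OF bounded_linear_Re summable_cinner])

lemma summable_inner_ell2: "summable (\<lambda>n. Re (cnj (coord x n) * coord y n))"
  by (rule bounded_linear.summable[OF bounded_linear_Re summable_cinner])

lemma inner_ell2_self: "inner x x = (\<Sum>n. (cmod (coord x n))\<^sup>2)"
  unfolding inner_ell2_suminf by (simp only: cmod_power2, simp add: power2_eq_square)

instance
proof
  fix x y z :: ell2 and r :: real
  show "inner x y = inner y x"
    unfolding inner_ell2_suminf by (simp add: mult.commute)
  show "inner (x + y) z = inner x z + inner y z"
    unfolding inner_ell2_suminf
    by (subst suminf_add[OF summable_inner_ell2 summable_inner_ell2])
      (simp add: plus_ell2.rep_eq algebra_simps)
  show "inner (r *\<^sub>R x) y = r * inner x y"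
    unfolding inner_ell2_suminf
    by (subst suminf_mult[OF summable_inner_ell2, symmetric])
      (simp add: scaleR_ell2.rep_eq algebra_simps)
  show "0 \<le> inner x x"
    unfolding inner_ell2_self by (rule suminf_nonneg[OF summable_coord]) simp
  show "inner x x = 0 \<longleftrightarrow> x = 0"
    unfolding inner_ell2_self
    by (subst suminf_eq_zero_iff[OF summable_coord])
      (auto simp: coord_inject[symmetric] zero_ell2.rep_eq fun_eq_iff)
qed (simp_all add: norm_ell2_def sgn_ell2_def dist_ell2_def uniformity_ell2_def open_ell2_def)

end

lift_definition basis :: "nat \<Rightarrow> ell2" is "\<lambda>k n. if n = k then 1 else 0"
proof -
  fix k :: nat
  show "summable (\<lambda>n. (cmod (if n = k then 1 else 0))\<^sup>2)"
    by (rule summable_finite[of "{k}"]) auto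
qed

definition cspan :: "ell2 set \<Rightarrow> ell2 set" where
  "cspan = module.span scaleC"

section \<open>Unbounded operators\<close>

text \<open>
  An operator is given by its graph. The set \<open>K\<close> below is a closed subspace of \<open>ell2\<close>,
  regarded as a Hilbert space in its own right; the graph of an operator in \<open>K\<close> is a
  subset of \<open>K \<times> K\<close>. The closure of an operator is the topological closure of its graph.
\<close>

type_synonym oper = "(ell2 \<times> ell2) set"

definition adjoint_in :: "ell2 set \<Rightarrow> oper \<Rightarrow> oper" where
  "adjoint_in K A = {(y, z) \<in> K \<times> K. \<forall>(x, w)\<in>A. cinner w y = cinner x z}"

definition self_adjoint_in :: "ell2 set \<Rightarrow> oper \<Rightarrow> bool" where
  "self_adjoint_in K A \<longleftrightarrow>
     A \<subseteq> K \<times> K \<and> single_valued A \<and> K \<subseteq> closure (Domain A) \<and> adjoint_in K A = A"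

definition shift :: "oper \<Rightarrow> complex \<Rightarrow> oper" where
  "shift A z = (\<lambda>(x, y). (x, y - z *\<^sub>C x)) ` A"

definition resolvent_set_in :: "ell2 set \<Rightarrow> oper \<Rightarrow> complex set" where
  "resolvent_set_in K A =
     {z. single_valued ((shift A z)\<inverse>) \<and> Range (shift A z) = K \<and>
         (\<exists>C. \<forall>(x, y)\<in>shift A z. norm x \<le> C * norm y)}"

definition spectrum_in :: "ell2 set \<Rightarrow> oper \<Rightarrow> complex set" where
  "spectrum_in K A = - resolvent_set_in K A"

definition restriction :: "oper \<Rightarrow> ell2 set \<Rightarrow> oper" where
  "restriction A W = {(x, y) \<in> A. x \<in> W}"

definition orth_compl :: "ell2 set \<Rightarrow> ell2 set" where
  "orth_compl W = {x. \<forall>w\<in>W. cinner w x = 0}"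

text \<open>
  For an unbounded operator, preserving a closed subspace \<open>W\<close> means \<open>P A \<subseteq> A P\<close> for the
  orthogonal projection \<open>P\<close> onto \<open>W\<close>; below, \<open>(u, v)\<close> is \<open>(P x, P y)\<close>.
  Taking \<open>x \<in> W\<close> gives \<open>A x \<in> W\<close>.
\<close>

definition preserves :: "oper \<Rightarrow> ell2 set \<Rightarrow> bool" where
  "preserves A W \<longleftrightarrow>
     (\<forall>(x, y)\<in>A. \<exists>(u, v)\<in>A. u \<in> W \<and> v \<in> W \<and> x - u \<in> orth_compl W \<and> y - v \<in> orth_compl W)"

definition orth_direct_sum :: "ell2 set \<Rightarrow> ell2 set \<Rightarrow> bool" where
  "orth_direct_sum W W' \<longleftrightarrow>
     (\<forall>x\<in>W. \<forall>y\<in>W'. cinner x y = 0) \<and> (\<forall>v. \<exists>x\<in>W. \<exists>y\<in>W'. v = x + y)"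

section \<open>Spectral measures and simple spectrum\<close>

text \<open>Symmetric and everywhere defined on \<open>K\<close>; linearity on \<open>K\<close> is a consequence.\<close>

definition orth_projection_in :: "ell2 set \<Rightarrow> (ell2 \<Rightarrow> ell2) \<Rightarrow> bool" where
  "orth_projection_in K P \<longleftrightarrow>
     (\<forall>x\<in>K. P x \<in> K \<and> P (P x) = P x) \<and> (\<forall>x\<in>K. \<forall>y\<in>K. cinner (P x) y = cinner x (P y))"

definition projection_valued_measure_in :: "ell2 set \<Rightarrow> (real set \<Rightarrow> ell2 \<Rightarrow> ell2) \<Rightarrow> bool" where
  "projection_valued_measure_in K E \<longleftrightarrow>
     (\<forall>B\<in>sets borel. orth_projection_in K (E B)) \<and>
     (\<forall>x\<in>K. E UNIV x = x) \<and>
     (\<forall>B\<in>sets borel. \<forall>C\<in>sets borel. \<forall>x\<in>K. E (B \<inter> C) x = E B (E C x)) \<and>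
     (\<forall>B :: nat \<Rightarrow> real set. range B \<subseteq> sets borel \<longrightarrow> disjoint_family B \<longrightarrow>
        (\<forall>x\<in>K. (\<lambda>n. E (B n) x) sums E (\<Union>n. B n) x))"

text \<open>The measure \<open>B \<mapsto> \<langle>x, E(B) x\<rangle> = \<parallel>E(B) x\<parallel>\<^sup>2\<close>.\<close>

definition scalar_measure :: "(real set \<Rightarrow> ell2 \<Rightarrow> ell2) \<Rightarrow> ell2 \<Rightarrow> real measure" where
  "scalar_measure E x = measure_of UNIV (sets borel) (\<lambda>B. ennreal ((norm (E B x))\<^sup>2))"

text \<open>
  \<open>E\<close> is the spectral measure of \<open>A\<close>, that is \<open>A = \<integral> t dE(t)\<close> with its natural domain. By
  polarization the quadratic form on the domain determines \<open>A\<close>.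
\<close>

definition spectral_measure_in :: "ell2 set \<Rightarrow> oper \<Rightarrow> (real set \<Rightarrow> ell2 \<Rightarrow> ell2) \<Rightarrow> bool" where
  "spectral_measure_in K A E \<longleftrightarrow>
     projection_valued_measure_in K E \<and>
     Domain A = {x \<in> K. integrable (scalar_measure E x) (\<lambda>t. t\<^sup>2)} \<and>
     (\<forall>(x, y)\<in>A. cinner x y = complex_of_real (LINT t|scalar_measure E x. t))"

text \<open>A self-adjoint operator has simple spectrum iff it admits a generating (cyclic) vector.\<close>

definition simple_spectrum_in :: "ell2 set \<Rightarrow> oper \<Rightarrow> bool" where
  "simple_spectrum_in K A \<longleftrightarrow>
     self_adjoint_in K A \<and>
     (\<exists>E. spectral_measure_in K A E \<and>
       (\<exists>g\<in>K. closure (cspan {E B g |B. B \<in> sets borel}) = K))"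

section \<open>The representation\<close>

definition finite_combinations :: "ell2 set" where
  "finite_combinations = cspan (range basis)"

text \<open>Linear extension from the basis; only meaningful on finite linear combinations.\<close>

definition lin_ext :: "(nat \<Rightarrow> ell2) \<Rightarrow> ell2 \<Rightarrow> ell2" where
  "lin_ext g x = (\<Sum>k | coord x k \<noteq> 0. coord x k *\<^sub>C g k)"

text \<open>Below, \<open>n\<close> is \<open>k div 2\<close>; for \<open>k = 0\<close> the coefficient in \<open>b_minus\<close> vanishes.\<close>

definition b_plus :: "real \<Rightarrow> ell2 \<Rightarrow> ell2" where
  "b_plus a = lin_ext (\<lambda>k. let n = real (k div 2) in
     if even k then complex_of_real (sqrt (2 * (n + a))) *\<^sub>C basis (k + 1)
     else complex_of_real (sqrt (2 * (n + 1))) *\<^sub>C basis (k + 1))"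

definition b_minus :: "real \<Rightarrow> ell2 \<Rightarrow> ell2" where
  "b_minus a = lin_ext (\<lambda>k. let n = real (k div 2) in
     if even k then complex_of_real (sqrt (2 * n)) *\<^sub>C basis (k - 1)
     else complex_of_real (sqrt (2 * (n + a))) *\<^sub>C basis (k - 1))"

definition op_h :: "real \<Rightarrow> ell2 \<Rightarrow> ell2" where
  "op_h a x = (1/2) *\<^sub>C (b_plus a (b_minus a x) + b_minus a (b_plus a x))"

definition op_e :: "real \<Rightarrow> ell2 \<Rightarrow> ell2" where
  "op_e a x = (1/2) *\<^sub>C b_plus a (b_plus a x)"

definition op_f :: "real \<Rightarrow> ell2 \<Rightarrow> ell2" where
  "op_f a x = (- 1/2) *\<^sub>C b_minus a (b_minus a x)"

definition free_hamiltonian :: "real \<Rightarrow> oper" where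
  "free_hamiltonian a =
     closure ((\<lambda>x. (x, (- 1/2) *\<^sub>C (op_e a x - op_f a x - op_h a x))) ` finite_combinations)"

definition V_even :: "ell2 set" where
  "V_even = closure (cspan (range (\<lambda>n. basis (2 * n))))"

definition V_odd :: "ell2 set" where
  "V_odd = closure (cspan (range (\<lambda>n. basis (2 * n + 1))))"

end

theory Submission imports Defs begin

text \<open>
  On the span of the basis vectors of parity \<open>s\<close> the Hamiltonian is a Jacobi matrix, namely the one
  of the three-term recurrence of the normalized Laguerre polynomials with respect to the gamma
  measure of shape \<open>a + s\<close> on the half-line. Taking Fourier coefficients with respect to these
  polynomials is therefore a unitary map onto the corresponding parity subspace that turns
  multiplication by the variable \<open>t\<close> into the Hamiltonian. Multiplication by \<open>t\<close> on its maximal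
  domain is self-adjoint, its spectral projections are multiplications by indicator functions,
  the constant function 1 is cyclic, and its spectrum is the support of the measure, the
  closed half-line. Exponential moments make polynomials dense, both in the $L^2$ space itself, so that
  the Laguerre polynomials form an orthonormal basis, and in the graph norm, so that the closure from
  finite combinations is the maximal operator.
\<close>

section \<open>Square-integrable functions\<close>

text \<open>The shape \<open>a + s\<close> is forced by the matrix: two ladder steps keep the
  parity, and the resulting diagonal entries \<open>n + (a + s) / 2\<close> and off-diagonal entries
  \<open>- sqrt ((n + 1) * (n + a + s)) / 2\<close> are those of Laguerre polynomials of index
  \<open>a + s - 1\<close> in the variable \<open>2 * t\<close>. The two parity parts thus live over
  different measures, but both measures have the whole half-line as support. Two obstacles shape the
  proof. Elements of L2 are kept as functions, not as classes, so the unitary map is injective only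
  up to null sets and the distance is only a pseudometric; squared distances with a weakened
  triangle inequality are used throughout. Moreover, the Hamiltonian is given as a closure, while
  the spectral analysis concerns the maximal multiplication operator; that the two agree is the
  essential self-adjointness of the Jacobi matrices. It comes from density of polynomials for a
  second, weighted measure, which is why density is proved for every finite measure on the half-line
  with an exponential moment.\<close>

definition sq_integrable :: "'w measure \<Rightarrow> ('w \<Rightarrow> complex) set" where
  "sq_integrable M = {f \<in> borel_measurable M. integrable M (\<lambda>t. (cmod (f t))\<^sup>2)}"

text \<open>The square of the $L^2$ distance.\<close>

definition sq_dist :: "'w measure \<Rightarrow> ('w \<Rightarrow> complex) \<Rightarrow> ('w \<Rightarrow> complex) \<Rightarrow> real" where
  "sq_dist M f g = (LINT t|M. (cmod (f t - g t))\<^sup>2)"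

lemma cmod_add_sq_le: "(cmod (x + y))\<^sup>2 \<le> 2 * (cmod x)\<^sup>2 + 2 * (cmod y)\<^sup>2"
proof -
  have "(cmod (x + y))\<^sup>2 \<le> (cmod x + cmod y)\<^sup>2"
    by (intro power_mono norm_triangle_ineq) simp
  also have "\<dots> \<le> 2 * (cmod x)\<^sup>2 + 2 * (cmod y)\<^sup>2"
    using sum_squares_bound[of "cmod x" "cmod y"] by (simp add: power2_sum)
  finally show ?thesis .
qed

lemma borel_measurable_cnj [measurable (raw)]:
  "f \<in> borel_measurable M \<Longrightarrow> (\<lambda>t. cnj (f t)) \<in> borel_measurable M"
  by (rule borel_measurable_continuous_on[OF continuous_on_cnj[OF continuous_on_id]])

lemma sq_integrable_measurable [measurable_dest]: "f \<in> sq_integrable M \<Longrightarrow> f \<in> borel_measurable M"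
  by (simp add: sq_integrable_def)

lemma sq_integrable_integrable: "f \<in> sq_integrable M \<Longrightarrow> integrable M (\<lambda>t. (cmod (f t))\<^sup>2)"
  by (simp add: sq_integrable_def)

lemma sq_integrable_bound:
  assumes "f \<in> borel_measurable M" "integrable M (\<lambda>t. (w t)\<^sup>2)" "AE t in M. cmod (f t) \<le> w t"
  shows "f \<in> sq_integrable M"
proof -
  have "integrable M (\<lambda>t. (cmod (f t))\<^sup>2)"
  proof (rule Bochner_Integration.integrable_bound[OF assms(2)])
    show "AE t in M. norm ((cmod (f t))\<^sup>2) \<le> norm ((w t)\<^sup>2)"
      using assms(3) by eventually_elim (simp add: power_mono)
  qed (use assms(1) in measurable)
  with assms(1) show ?thesis by (simp add: sq_integrable_def)
qed

lemma sq_integrable_cong_AE: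
  assumes "f \<in> sq_integrable M" "g \<in> borel_measurable M" "AE t in M. f t = g t"
  shows "g \<in> sq_integrable M"
  using assms(3) by (intro sq_integrable_bound[OF assms(2) sq_integrable_integrable[OF assms(1)]]) auto

lemma sq_integrable_zero [simp]: "(\<lambda>_. 0) \<in> sq_integrable M"
  by (simp add: sq_integrable_def)

lemma sq_integrable_add:
  assumes f: "f \<in> sq_integrable M" and g: "g \<in> sq_integrable M"
  shows "(\<lambda>t. f t + g t) \<in> sq_integrable M"
proof -
  note [measurable] = sq_integrable_measurable[OF f] sq_integrable_measurable[OF g]
  have "integrable M (\<lambda>t. (cmod (f t + g t))\<^sup>2)"
  proof (rule Bochner_Integration.integrable_bound)
    show "integrable M (\<lambda>t. 2 * (cmod (f t))\<^sup>2 + 2 * (cmod (g t))\<^sup>2)"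
      using f g by (simp add: sq_integrable_def)
    show "AE t in M. norm ((cmod (f t + g t))\<^sup>2) \<le> norm (2 * (cmod (f t))\<^sup>2 + 2 * (cmod (g t))\<^sup>2)"
      using cmod_add_sq_le by (intro always_eventually) auto
  qed measurable
  then show ?thesis by (simp add: sq_integrable_def)
qed

lemma sq_integrable_cmult: "f \<in> sq_integrable M \<Longrightarrow> (\<lambda>t. c * f t) \<in> sq_integrable M"
  by (auto simp: sq_integrable_def norm_mult power_mult_distrib)

lemma sq_integrable_diff:
  assumes "f \<in> sq_integrable M" "g \<in> sq_integrable M"
  shows "(\<lambda>t. f t - g t) \<in> sq_integrable M"
  using sq_integrable_add[OF assms(1) sq_integrable_cmult[OF assms(2), of "-1"]] by simp

lemma sq_integrable_sum:
  "(\<And>i. i \<in> I \<Longrightarrow> f i \<in> sq_integrable M) \<Longrightarrow> (\<lambda>t. \<Sum>i\<in>I. f i t) \<in> sq_integrable M"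
  by (induction I rule: infinite_finite_induct) (auto intro: sq_integrable_add)

lemma sq_integrable_mult_bounded:
  assumes "f \<in> sq_integrable M" "g \<in> borel_measurable M" "AE t in M. cmod (g t) \<le> C"
  shows "(\<lambda>t. g t * f t) \<in> sq_integrable M"
proof (rule sq_integrable_bound)
  show "integrable M (\<lambda>t. (C * cmod (f t))\<^sup>2)"
    using assms(1) by (simp add: power_mult_distrib sq_integrable_def)
  show "AE t in M. cmod (g t * f t) \<le> C * cmod (f t)"
    using assms(3) by eventually_elim (simp add: norm_mult mult_right_mono)
qed (use assms in measurable)

lemma integrable_cnj_mult:
  assumes f: "f \<in> sq_integrable M" and g: "g \<in> sq_integrable M"
  shows "integrable M (\<lambda>t. cnj (f t) * g t)"
proof (rule Bochner_Integration.integrable_bound)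
  show "integrable M (\<lambda>t. (cmod (f t))\<^sup>2 + (cmod (g t))\<^sup>2)"
    using f g by (simp add: sq_integrable_def)
  have "cmod x * cmod y \<le> (cmod x)\<^sup>2 + (cmod y)\<^sup>2" for x y
  proof -
    have "2 * (cmod x * cmod y) \<le> (cmod x)\<^sup>2 + (cmod y)\<^sup>2"
      using sum_squares_bound[of "cmod x" "cmod y"] by (simp add: mult.assoc)
    moreover have "0 \<le> cmod x * cmod y" by simp
    ultimately show ?thesis by linarith
  qed
  then show "AE t in M. norm (cnj (f t) * g t) \<le> norm ((cmod (f t))\<^sup>2 + (cmod (g t))\<^sup>2)"
    by (intro always_eventually) (auto simp: norm_mult)
  note [measurable] = sq_integrable_measurable[OF f] sq_integrable_measurable[OF g]
  show "(\<lambda>t. cnj (f t) * g t) \<in> borel_measurable M" by measurable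
qed

lemma sq_dist_nonneg [simp]: "0 \<le> sq_dist M f g"
  by (simp add: sq_dist_def)

lemma sq_dist_commute: "sq_dist M f g = sq_dist M g f"
  by (simp add: sq_dist_def norm_minus_commute)

text \<open>Squaring costs a factor 2, by \<open>cmod_add_sq_le\<close>. This takes the place of
  Minkowski's inequality: arguments with arbitrarily small errors only need some constant.\<close>

lemma sq_dist_triangle:
  assumes "f \<in> sq_integrable M" "g \<in> sq_integrable M" "h \<in> sq_integrable M"
  shows "sq_dist M f h \<le> 2 * sq_dist M f g + 2 * sq_dist M g h"
proof -
  note i = sq_integrable_integrable[OF sq_integrable_diff]
  have "sq_dist M f h \<le> (LINT t|M. 2 * (cmod (f t - g t))\<^sup>2 + 2 * (cmod (g t - h t))\<^sup>2)"
    unfolding sq_dist_def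
  proof (rule integral_mono)
    show "(cmod (f t - h t))\<^sup>2 \<le> 2 * (cmod (f t - g t))\<^sup>2 + 2 * (cmod (g t - h t))\<^sup>2" for t
      using cmod_add_sq_le[of "f t - g t" "g t - h t"] by simp
  qed (intro Bochner_Integration.integrable_add integrable_mult_right i assms)+
  also have "\<dots> = 2 * sq_dist M f g + 2 * sq_dist M g h"
    unfolding sq_dist_def using i[OF assms(1,2)] i[OF assms(2,3)] by simp
  finally show ?thesis .
qed

text \<open>Dominated convergence in mean square: the limit inherits the bound \<open>w\<close>, so
  the squared differences are dominated by \<open>4 * (w t)\<^sup>2\<close>. It drives the later
  approximations by Taylor sums, truncations and disjoint unions.\<close>

lemma sq_dist_tendsto_dominated:
  assumes "f \<in> borel_measurable M" "\<And>n. F n \<in> borel_measurable M"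
    and w: "integrable M (\<lambda>t. (w t)\<^sup>2)"
    and b: "\<And>n. AE t in M. cmod (F n t) \<le> w t"
    and lim: "AE t in M. (\<lambda>n. F n t) \<longlonglongrightarrow> f t"
  shows "f \<in> sq_integrable M" "(\<lambda>n. sq_dist M f (F n)) \<longlonglongrightarrow> 0"
proof -
  have "AE t in M. \<forall>n. cmod (F n t) \<le> w t" using b by (simp add: AE_all_countable)
  with lim have fw: "AE t in M. cmod (f t) \<le> w t"
  proof eventually_elim
    case (elim t)
    show ?case
      by (rule tendsto_upperbound[OF tendsto_norm[OF elim(1)]]) (use elim in auto)
  qed
  show "f \<in> sq_integrable M"
    by (rule sq_integrable_bound[OF assms(1) w fw])
  have "(\<lambda>n. LINT t|M. (cmod (f t - F n t))\<^sup>2) \<longlonglongrightarrow> (LINT t|M. 0)"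
  proof (rule integral_dominated_convergence)
    show "integrable M (\<lambda>t. 4 * (w t)\<^sup>2)" using w by simp
    show "AE t in M. (\<lambda>n. (cmod (f t - F n t))\<^sup>2) \<longlonglongrightarrow> 0"
      using lim
    proof eventually_elim
      case (elim t)
      have "(\<lambda>n. (cmod (f t - F n t))\<^sup>2) \<longlonglongrightarrow> (cmod (f t - f t))\<^sup>2"
        by (intro tendsto_intros elim)
      then show ?case by simp
    qed
    show "AE t in M. norm ((cmod (f t - F n t))\<^sup>2) \<le> 4 * (w t)\<^sup>2" for n
      using fw b[of n]
    proof eventually_elim
      case (elim t)
      have "cmod (f t - F n t) \<le> 2 * w t"
        using elim norm_triangle_ineq4[of "f t" "F n t"] by linarith
      then have "(cmod (f t - F n t))\<^sup>2 \<le> (2 * w t)\<^sup>2" by (intro power_mono) auto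
      then show ?case by (simp add: power_mult_distrib)
    qed
  qed (use assms in measurable)
  then show "(\<lambda>n. sq_dist M f (F n)) \<longlonglongrightarrow> 0" by (simp add: sq_dist_def)
qed

section \<open>Mean-square closure of linear spaces of functions\<close>

definition sq_closure :: "'w measure \<Rightarrow> ('w \<Rightarrow> complex) set \<Rightarrow> ('w \<Rightarrow> complex) set" where
  "sq_closure M P = {f \<in> sq_integrable M. \<forall>e>0. \<exists>p\<in>P. sq_dist M f p < e}"

locale sq_subspace =
  fixes M :: "'w measure" and P :: "('w \<Rightarrow> complex) set"
  assumes P_subset: "P \<subseteq> sq_integrable M"
    and P_add: "p \<in> P \<Longrightarrow> q \<in> P \<Longrightarrow> (\<lambda>t. p t + q t) \<in> P"
    and P_cmult: "p \<in> P \<Longrightarrow> (\<lambda>t. c * p t) \<in> P"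
    and P_zero: "(\<lambda>t. 0) \<in> P"
begin

lemma sq_closure_sq_integrable: "f \<in> sq_closure M P \<Longrightarrow> f \<in> sq_integrable M"
  by (simp add: sq_closure_def)

lemma sq_closure_superset: "p \<in> P \<Longrightarrow> p \<in> sq_closure M P"
  using P_subset by (auto simp: sq_closure_def sq_dist_def intro!: bexI[of _ p])

lemma sq_closure_closed:
  assumes f: "f \<in> sq_integrable M" and "\<And>e. e > 0 \<Longrightarrow> \<exists>g\<in>sq_closure M P. sq_dist M f g < e"
  shows "f \<in> sq_closure M P"
proof -
  have "\<exists>p\<in>P. sq_dist M f p < e" if e: "e > 0" for e
  proof -
    \<comment> \<open>Two errors below \<open>e / 4\<close> stay below \<open>e\<close> after the
      factor 2 of \<open>sq_dist_triangle\<close>.\<close>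
    obtain g where g: "g \<in> sq_closure M P" "sq_dist M f g < e / 4"
      using assms(2)[of "e / 4"] e by auto
    moreover have "e / 4 > 0" using e by simp
    ultimately obtain p where p: "p \<in> P" "sq_dist M g p < e / 4"
      unfolding sq_closure_def by blast
    have "sq_dist M f p \<le> 2 * sq_dist M f g + 2 * sq_dist M g p"
      using f g p P_subset sq_closure_sq_integrable by (intro sq_dist_triangle) auto
    with g p show ?thesis by (intro bexI[of _ p]) auto
  qed
  with f show ?thesis by (simp add: sq_closure_def)
qed

lemma sq_closure_tendsto:
  assumes f: "f \<in> sq_integrable M" and "\<And>n. F n \<in> sq_closure M P"
    and "(\<lambda>n. sq_dist M f (F n)) \<longlonglongrightarrow> 0"
  shows "f \<in> sq_closure M P"
proof (rule sq_closure_closed[OF f])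
  fix e :: real assume "e > 0"
  with assms(3) have "\<forall>\<^sub>F n in sequentially. sq_dist M f (F n) < e" by (rule order_tendstoD)
  then obtain n where "sq_dist M f (F n) < e" using eventually_happens' sequentially_bot by blast
  with assms(2) show "\<exists>g\<in>sq_closure M P. sq_dist M f g < e" by blast
qed

lemma sq_closure_dominated:
  assumes F: "\<And>n. F n \<in> sq_closure M P" and f: "f \<in> borel_measurable M"
    and w: "integrable M (\<lambda>t. (w t)\<^sup>2)"
    and b: "\<And>n. AE t in M. cmod (F n t) \<le> w t"
    and lim: "AE t in M. (\<lambda>n. F n t) \<longlonglongrightarrow> f t"
  shows "f \<in> sq_closure M P"
proof -
  have m: "F n \<in> borel_measurable M" for n
    using sq_closure_sq_integrable[OF F] by measurable
  show ?thesis
    by (rule sq_closure_tendsto[OF sq_dist_tendsto_dominated(1)[OF f m w b lim] F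
          sq_dist_tendsto_dominated(2)[OF f m w b lim]])
qed

lemma sq_closure_add:
  assumes f: "f \<in> sq_closure M P" and g: "g \<in> sq_closure M P"
  shows "(\<lambda>t. f t + g t) \<in> sq_closure M P"
proof -
  have "\<exists>r\<in>P. sq_dist M (\<lambda>t. f t + g t) r < e" if e: "e > 0" for e
  proof -
    have e4: "e / 4 > 0" using e by simp
    obtain p where p: "p \<in> P" "sq_dist M f p < e / 4"
      using f e4 unfolding sq_closure_def by blast
    obtain q where q: "q \<in> P" "sq_dist M g q < e / 4"
      using g e4 unfolding sq_closure_def by blast
    have sq: "f \<in> sq_integrable M" "g \<in> sq_integrable M" "p \<in> sq_integrable M" "q \<in> sq_integrable M"
      using f g p q P_subset by (auto simp: sq_closure_def)
    note i = sq_integrable_integrable[OF sq_integrable_diff]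
    have "sq_dist M (\<lambda>t. f t + g t) (\<lambda>t. p t + q t)
        \<le> (LINT t|M. 2 * (cmod (f t - p t))\<^sup>2 + 2 * (cmod (g t - q t))\<^sup>2)"
      unfolding sq_dist_def
    proof (rule integral_mono)
      show "(cmod (f t + g t - (p t + q t)))\<^sup>2 \<le> 2 * (cmod (f t - p t))\<^sup>2 + 2 * (cmod (g t - q t))\<^sup>2" for t
        using cmod_add_sq_le[of "f t - p t" "g t - q t"] by (simp add: algebra_simps)
    qed (intro Bochner_Integration.integrable_add integrable_mult_right i sq sq_integrable_add)+
    also have "\<dots> = 2 * sq_dist M f p + 2 * sq_dist M g q"
      unfolding sq_dist_def using i[OF sq(1,3)] i[OF sq(2,4)] by simp
    also have "\<dots> < e" using p q by simp
    finally show ?thesis using P_add[OF p(1) q(1)] by auto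
  qed
  then show ?thesis using f g by (simp add: sq_closure_def sq_integrable_add)
qed

lemma sq_closure_cmult:
  assumes f: "f \<in> sq_closure M P"
  shows "(\<lambda>t. c * f t) \<in> sq_closure M P"
proof -
  have "\<exists>r\<in>P. sq_dist M (\<lambda>t. c * f t) r < e" if e: "e > 0" for e
  proof -
    \<comment> \<open>Adding 1 to the denominator covers \<open>c = 0\<close>.\<close>
    have "e / ((cmod c)\<^sup>2 + 1) > 0" using e by (simp add: add_nonneg_pos)
    then obtain p where p: "p \<in> P" "sq_dist M f p < e / ((cmod c)\<^sup>2 + 1)"
      using f unfolding sq_closure_def by blast
    have "sq_dist M (\<lambda>t. c * f t) (\<lambda>t. c * p t) = (cmod c)\<^sup>2 * sq_dist M f p"
      by (simp add: sq_dist_def right_diff_distrib[symmetric] norm_mult power_mult_distrib)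
    also have "\<dots> \<le> ((cmod c)\<^sup>2 + 1) * sq_dist M f p"
      by (intro mult_right_mono) auto
    also have "\<dots> < e"
      using p(2) by (subst (asm) pos_less_divide_eq) (auto simp: add_nonneg_pos mult.commute)
    finally show ?thesis using P_cmult[OF p(1)] by auto
  qed
  then show ?thesis using f by (simp add: sq_closure_def sq_integrable_cmult)
qed

lemma sq_closure_sum:
  "(\<And>i. i \<in> I \<Longrightarrow> f i \<in> sq_closure M P) \<Longrightarrow> (\<lambda>t. \<Sum>i\<in>I. f i t) \<in> sq_closure M P"
  by (induction I rule: infinite_finite_induct)
    (auto intro: sq_closure_add sq_closure_superset P_zero)

lemma sq_closure_diff:
  assumes "f \<in> sq_closure M P" "g \<in> sq_closure M P"
  shows "(\<lambda>t. f t - g t) \<in> sq_closure M P"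
  using sq_closure_add[OF assms(1) sq_closure_cmult[OF assms(2), of "-1"]] by simp

text \<open>Functions that agree almost everywhere are not identified, so this invariance has to be
  derived: the constant sequence \<open>f\<close> converges to \<open>g\<close> almost
  everywhere.\<close>

lemma sq_closure_cong_AE:
  assumes f: "f \<in> sq_closure M P" and g: "g \<in> borel_measurable M" and eq: "AE t in M. f t = g t"
  shows "g \<in> sq_closure M P"
proof (rule sq_closure_dominated[of "\<lambda>_. f"])
  show "integrable M (\<lambda>t. (cmod (f t))\<^sup>2)"
    using f sq_closure_sq_integrable sq_integrable_integrable by blast
qed (use assms in auto)

text \<open>Simple functions bounded by \<open>2 * cmod (f t)\<close> converge pointwise to
  \<open>f\<close>, so dominated convergence reduces density to indicators. It serves both the
  density of polynomials and the cyclicity of the constant 1.\<close>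

lemma sq_closure_eq_if_indicators:
  assumes ind: "\<And>B. B \<in> sets M \<Longrightarrow> indicator B \<in> sq_closure M P"
  shows "sq_closure M P = sq_integrable M"
proof (rule antisym)
  show "sq_closure M P \<subseteq> sq_integrable M" by (auto simp: sq_closure_def)
  show "sq_integrable M \<subseteq> sq_closure M P"
  proof
    fix f assume f: "f \<in> sq_integrable M"
    then have fm: "f \<in> borel_measurable M" by measurable
    obtain s where s: "\<And>i. simple_function M (s i)"
      "\<And>x. x \<in> space M \<Longrightarrow> (\<lambda>i. s i x) \<longlonglongrightarrow> f x"
      "\<And>i x. x \<in> space M \<Longrightarrow> cmod (s i x) \<le> 2 * cmod (f x)"
      using borel_measurable_implies_sequence_metric[OF fm, of 0]
      by (metis dist_norm diff_zero)
    show "f \<in> sq_closure M P"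
    proof (rule sq_closure_dominated[where F = s, OF _ fm])
      fix i
      have "(\<lambda>t. \<Sum>y\<in>s i ` space M. y * indicator (s i -` {y} \<inter> space M) t) \<in> sq_closure M P"
        using s(1)[of i] by (intro sq_closure_sum sq_closure_cmult ind) (auto simp: simple_function_def)
      moreover have eq: "s i t = (\<Sum>y\<in>s i ` space M. y * indicator (s i -` {y} \<inter> space M) t)"
        if "t \<in> space M" for t
      proof -
        have "(\<Sum>y\<in>s i ` space M. y * indicator (s i -` {y} \<inter> space M) t)
            = (\<Sum>y\<in>s i ` space M. if y = s i t then y else 0)"
          using that by (intro sum.cong) (auto simp: indicator_def)
        also have "\<dots> = s i t" using s(1)[of i] that by (simp add: simple_function_def)
        finally show ?thesis by simp
      qed
      then have "AE t in M. (\<Sum>y\<in>s i ` space M. y * indicator (s i -` {y} \<inter> space M) t) = s i t"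
        by (intro AE_I2) (rule sym)
      ultimately show "s i \<in> sq_closure M P"
        by (rule sq_closure_cong_AE[OF _ borel_measurable_simple_function[OF s(1)]])
    next
      show "integrable M (\<lambda>t. (2 * cmod (f t))\<^sup>2)"
        using f by (simp add: power_mult_distrib sq_integrable_def)
    qed (use s in auto)
  qed
qed

end

section \<open>Density of polynomials\<close>

text \<open>Each factor \<open>t\<close> is absorbed by
  \<open>t \<le> 2 / d * exp (d / 2 * t)\<close>; the other half of the rate is left for the
  polynomial of lower degree, hence the induction for arbitrary \<open>d\<close>.\<close>

lemma poly_exp_bound:
  fixes q :: "complex poly" and d :: real
  assumes "d > 0"
  shows "\<exists>C\<ge>0. \<forall>t\<ge>0. cmod (poly q (of_real t)) \<le> C * exp (d * t)"
  using assms
proof (induction q arbitrary: d)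
  case 0
  then show ?case by (intro exI[of _ 0]) auto
next
  case (pCons a q)
  have "d / 2 > 0" using pCons.prems by simp
  then obtain C where C: "C \<ge> 0" "\<And>t. t \<ge> 0 \<Longrightarrow> cmod (poly q (of_real t)) \<le> C * exp (d / 2 * t)"
    using pCons.IH by blast
  have "cmod (poly (pCons a q) (of_real t)) \<le> (cmod a + 2 / d * C) * exp (d * t)" if t: "t \<ge> 0" for t
  proof -
    have "d / 2 * t \<le> exp (d / 2 * t)"
      using exp_ge_add_one_self[of "d / 2 * t"] by linarith
    then have "t \<le> 2 / d * exp (d / 2 * t)"
      using pCons.prems by (simp add: field_simps)
    then have "t * cmod (poly q (of_real t)) \<le> (2 / d * exp (d / 2 * t)) * (C * exp (d / 2 * t))"
      using C t pCons.prems by (intro mult_mono) auto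
    also have "\<dots> = 2 / d * C * exp (d * t)"
      by (simp add: exp_add[symmetric])
    finally have "t * cmod (poly q (of_real t)) \<le> 2 / d * C * exp (d * t)" .
    moreover have "cmod a \<le> cmod a * exp (d * t)"
      using t pCons.prems by (simp add: mult_le_cancel_left1)
    moreover have "cmod (poly (pCons a q) (of_real t)) \<le> cmod a + t * cmod (poly q (of_real t))"
      using norm_triangle_ineq[of a "of_real t * poly q (of_real t)"] t by (simp add: norm_mult)
    ultimately show ?thesis by (simp add: algebra_simps)
  qed
  then show ?case using C pCons.prems by (intro exI[of _ "cmod a + 2 / d * C"]) auto
qed

text \<open>The bound is uniform in \<open>n\<close>, as dominated convergence requires of the
  Taylor sums of a decaying exponential; the price is that the bound itself grows.\<close>

lemma exp_partial_sum_bound: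
  fixes x :: real
  shows "\<bar>\<Sum>i<n. x ^ i / fact i\<bar> \<le> exp \<bar>x\<bar>"
proof -
  have "\<bar>\<Sum>i<n. x ^ i / fact i\<bar> \<le> (\<Sum>i<n. \<bar>x\<bar> ^ i / fact i)"
    by (rule order_trans[OF sum_abs]) (simp add: power_abs)
  also have "\<dots> \<le> (\<Sum>i. \<bar>x\<bar> ^ i / fact i)"
    using summable_exp[of "\<bar>x\<bar>"] by (intro sum_le_suminf) (auto simp: field_simps)
  also have "\<dots> = exp \<bar>x\<bar>" by (simp add: exp_def divide_inverse mult.commute)
  finally show ?thesis .
qed

definition poly_functions :: "(real \<Rightarrow> complex) set" where
  "poly_functions = range (\<lambda>q t. poly q (complex_of_real t))"

text \<open>Kept abstract because it is instantiated twice, by the gamma measure and by its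
  weighting with \<open>1 + t\<^sup>2\<close>.\<close>

locale exp_moment_measure = finite_measure M for M :: "real measure" +
  fixes c :: real
  assumes sets_M [measurable_cong]: "sets M = sets borel"
    and nonneg: "AE t in M. t \<ge> 0"
    and c_pos: "c > 0"
    and exp_moment: "integrable M (\<lambda>t. exp (c * t))"
begin

lemma measurable_poly [measurable]: "(\<lambda>t. poly q (complex_of_real t)) \<in> borel_measurable M"
  by (intro borel_measurable_continuous_onI[THEN measurable_cong_sets[OF sets_M refl, THEN equalityD2, THEN subsetD]]
      continuous_intros)

lemma sq_integrable_exp_bound:
  assumes [measurable]: "f \<in> borel_measurable M" and "AE t in M. cmod (f t) \<le> C * exp (c / 2 * t)"
  shows "f \<in> sq_integrable M"
proof (rule sq_integrable_bound[OF _ _ assms(2)])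
  have "(\<lambda>t. (C * exp (c / 2 * t))\<^sup>2) = (\<lambda>t. C\<^sup>2 * exp (c * t))"
    by (simp add: power_mult_distrib exp_double[symmetric])
  then show "integrable M (\<lambda>t. (C * exp (c / 2 * t))\<^sup>2)"
    using exp_moment by simp
qed measurable

lemma sq_integrable_poly: "(\<lambda>t. poly q (complex_of_real t)) \<in> sq_integrable M"
proof -
  obtain C where "\<And>t. t \<ge> 0 \<Longrightarrow> cmod (poly q (of_real t)) \<le> C * exp (c / 2 * t)"
    using poly_exp_bound[of "c / 2" q] c_pos by auto
  then show ?thesis
    using nonneg by (intro sq_integrable_exp_bound[of _ C]) auto
qed

sublocale polys: sq_subspace M poly_functions
proof
  show "poly_functions \<subseteq> sq_integrable M"
    using sq_integrable_poly by (auto simp: poly_functions_def)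
  fix p q :: "real \<Rightarrow> complex" and c
  assume "p \<in> poly_functions"
  then obtain p' where p': "p = (\<lambda>t. poly p' (of_real t))" by (auto simp: poly_functions_def)
  then show "(\<lambda>t. c * p t) \<in> poly_functions"
    unfolding poly_functions_def by (intro range_eqI[of _ _ "smult c p'"]) simp
  assume "q \<in> poly_functions"
  then obtain q' where "q = (\<lambda>t. poly q' (of_real t))" by (auto simp: poly_functions_def)
  with p' show "(\<lambda>t. p t + q t) \<in> poly_functions"
    unfolding poly_functions_def by (intro range_eqI[of _ _ "p' + q'"]) simp
next
  show "(\<lambda>t. 0) \<in> poly_functions"
    unfolding poly_functions_def by (intro range_eqI[of _ _ 0]) simp
qed

text \<open>Induction on \<open>k\<close>: the Taylor partial sums of one factor \<open>exp (- c / 4 * t)\<close> are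
  dominated by \<open>exp (c / 4 * t)\<close>, which the exponential moment can absorb.\<close>

lemma poly_exp_in_closure:
  "(\<lambda>t. poly q (of_real t) * of_real (exp (- (real k * (c / 4) * t)))) \<in> sq_closure M poly_functions"
proof (induction k arbitrary: q)
  case 0
  show ?case by (rule polys.sq_closure_superset) (simp add: poly_functions_def)
next
  case (Suc k)
  \<comment> \<open>The polynomial and the Taylor sum cost a factor \<open>exp (d * t)\<close> each.
    The square of their product is of order \<open>exp (4 * d * t) = exp (c * t)\<close>, which is
    exactly the available moment.\<close>
  define d where "d = c / 4"
  have d: "d > 0" using c_pos by (simp add: d_def)
  obtain C where C: "C \<ge> 0" "\<And>t. t \<ge> 0 \<Longrightarrow> cmod (poly q (of_real t)) \<le> C * exp (d * t)"
    using poly_exp_bound[OF d] by blast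
  define T where "T n t = (\<Sum>i<n. (- d * t) ^ i / fact i)" for n and t :: real
  define F where "F n t = poly q (of_real t) * of_real (exp (- (real k * d * t))) * complex_of_real (T n t)" for n and t :: real
  have F_eq: "F n = (\<lambda>t. poly (q * (\<Sum>i<n. monom (of_real ((- d) ^ i / fact i)) i)) (of_real t)
      * of_real (exp (- (real k * (c / 4) * t))))" for n
    by (rule ext) (simp add: F_def T_def d_def poly_sum poly_monom power_mult_distrib[symmetric] mult_ac)
  \<comment> \<open>The Taylor sum is a polynomial, so the induction hypothesis applies to its
    product with \<open>q\<close>.\<close>
  have F: "F n \<in> sq_closure M poly_functions" for n
    unfolding F_eq by (rule Suc.IH)
  have "(\<lambda>t. poly q (of_real t) * of_real (exp (- (real k * d * t))) * of_real (exp (- d * t)))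
      \<in> sq_closure M poly_functions"
  proof (rule polys.sq_closure_dominated[OF F])
    have "(\<lambda>t. (C * exp (2 * d * t))\<^sup>2) = (\<lambda>t. C\<^sup>2 * exp (c * t))"
      by (simp add: power_mult_distrib exp_double[symmetric] d_def)
    then show "integrable M (\<lambda>t. (C * exp (2 * d * t))\<^sup>2)" using exp_moment by simp
    show "AE t in M. cmod (F n t) \<le> C * exp (2 * d * t)" for n
      using nonneg
    proof eventually_elim
      case (elim t)
      have "\<bar>T n t\<bar> \<le> exp (d * t)"
        using exp_partial_sum_bound[where x="- d * t" and n=n] d elim
        by (simp add: T_def abs_mult)
      moreover have "cmod (poly q (of_real t)) \<le> C * exp (d * t)" using C elim by simp
      moreover have "exp (- (real k * d * t)) \<le> 1" using d elim by simp
      ultimately have "cmod (F n t) \<le> (C * exp (d * t)) * 1 * exp (d * t)"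
        unfolding F_def norm_mult norm_of_real abs_exp_cancel
        using C by (intro mult_mono) auto
      also have "\<dots> = C * exp (2 * d * t)" by (simp add: exp_add[symmetric])
      finally show ?case .
    qed
    show "AE t in M. (\<lambda>n. F n t) \<longlonglongrightarrow> poly q (of_real t) * of_real (exp (- (real k * d * t))) * of_real (exp (- d * t))"
    proof (intro always_eventually allI)
      fix t
      have "(\<lambda>n. T n t) \<longlonglongrightarrow> exp (- d * t)"
        using exp_converges[of "- d * t"] unfolding sums_def T_def by (simp add: divide_inverse mult.commute)
      then show "(\<lambda>n. F n t) \<longlonglongrightarrow> poly q (of_real t) * of_real (exp (- (real k * d * t))) * of_real (exp (- d * t))"
        unfolding F_def by (intro tendsto_intros)
    qed
  qed measurable
  moreover have "exp (- (real k * d * t)) * exp (- d * t) = exp (- (real (Suc k) * (c / 4) * t))" for t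
    by (simp add: exp_add[symmetric] d_def algebra_simps)
  ultimately show ?case
    by (simp add: mult.assoc flip: of_real_mult)
qed

text \<open>The substitution \<open>u = exp (- (c / 4 * t))\<close> takes the half-line into the
  compact interval from 0 to 1, where Weierstrass approximation is available; powers of
  \<open>u\<close> are covered by \<open>poly_exp_in_closure\<close> with
  \<open>q = 1\<close>.\<close>

lemma continuous_of_exp_in_closure:
  fixes h :: "real \<Rightarrow> real"
  assumes h: "continuous_on UNIV h" and b: "\<And>u. \<bar>h u\<bar> \<le> 1"
  shows "(\<lambda>t. of_real (h (exp (- (c / 4 * t))))) \<in> sq_closure M poly_functions"
proof -
  have "\<exists>g. real_polynomial_function g \<and> (\<forall>u\<in>{0..1}. \<bar>h u - g u\<bar> < 1 / Suc n)" for n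
    using Stone_Weierstrass_real_polynomial_function[of "{0..1::real}" h "1 / Suc n"]
      continuous_on_subset[OF h] by (metis compact_Icc of_nat_0_less_iff subset_UNIV zero_less_Suc zero_less_divide_1_iff)
  then obtain g where g: "\<And>n. real_polynomial_function (g n)"
    "\<And>n u. u \<in> {0..1} \<Longrightarrow> \<bar>h u - g n u\<bar> < 1 / Suc n"
    by metis
  define F where "F n t = complex_of_real (g n (exp (- (c / 4 * t))))" for n t
  have F: "F n \<in> sq_closure M poly_functions" for n
  proof -
    obtain a m where gn: "g n = (\<lambda>u. \<Sum>i\<le>m. a i * u ^ i)"
      using g(1)[of n] real_polynomial_function_iff_sum by blast
    have "(\<lambda>t. \<Sum>i\<le>m. of_real (a i) * (poly 1 (of_real t) * of_real (exp (- (real i * (c / 4) * t)))))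
        \<in> sq_closure M poly_functions"
      by (intro polys.sq_closure_sum polys.sq_closure_cmult poly_exp_in_closure)
    moreover have "F n = (\<lambda>t. \<Sum>i\<le>m. of_real (a i) * (poly 1 (of_real t) * of_real (exp (- (real i * (c / 4) * t)))))"
      by (rule ext) (simp add: F_def gn exp_of_nat_mult[symmetric] mult.assoc)
    ultimately show ?thesis by simp
  qed
  have unit: "AE t in M. exp (- (c / 4 * t)) \<in> {0..1}"
    using nonneg by eventually_elim (use c_pos in auto)
  have h_meas: "h \<in> borel_measurable borel" using h by (rule borel_measurable_continuous_onI)
  show ?thesis
  proof (rule polys.sq_closure_dominated[OF F])
    show "integrable M (\<lambda>t. (2::real)\<^sup>2)" by simp
    show "AE t in M. cmod (F n t) \<le> 2" for n
      using unit
    proof eventually_elim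
      case (elim t)
      have "1 / real (Suc n) \<le> 1" by simp
      then show ?case
        using g(2)[OF elim, of n] b[of "exp (- (c / 4 * t))"] unfolding F_def norm_of_real by linarith
    qed
    show "AE t in M. (\<lambda>n. F n t) \<longlonglongrightarrow> of_real (h (exp (- (c / 4 * t))))"
      using unit
    proof eventually_elim
      case (elim t)
      have "(\<lambda>n. g n (exp (- (c / 4 * t)))) \<longlonglongrightarrow> h (exp (- (c / 4 * t)))"
      proof (rule LIMSEQ_I)
        fix r :: real assume "r > 0"
        then obtain N where N: "1 / real (Suc N) < r"
          using nat_approx_posE by blast
        have "norm (g n (exp (- (c / 4 * t))) - h (exp (- (c / 4 * t)))) < r" if "n \<ge> N" for n
        proof -
          have "1 / real (Suc n) \<le> 1 / real (Suc N)" using that by (simp add: field_simps)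
          then show ?thesis using g(2)[OF elim, of n] N unfolding real_norm_def by linarith
        qed
        then show "\<exists>N. \<forall>n\<ge>N. norm (g n (exp (- (c / 4 * t))) - h (exp (- (c / 4 * t)))) < r" by blast
      qed
      then show ?case unfolding F_def by (rule tendsto_of_real)
    qed
  qed (use h_meas in measurable)
qed

lemma indicator_atMost_in_closure: "indicator {..x} \<in> sq_closure M poly_functions"
proof -
  define u0 where "u0 = exp (- (c / 4 * x))"
  \<comment> \<open>A ramp of slope \<open>n\<close> that reaches 1 at \<open>u0\<close> and stays
    there, so the limit includes the endpoint. As \<open>u\<close> decreases in \<open>t\<close>,
    the set where \<open>u \<ge> u0\<close> is the half-line \<open>{..x}\<close>.\<close>
  define h where "h n u = max 0 (min 1 (1 + real n * (u - u0)))" for n and u :: real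
  have "(\<lambda>t. complex_of_real (h n (exp (- (c / 4 * t))))) \<in> sq_closure M poly_functions" for n
    by (rule continuous_of_exp_in_closure) (auto simp: h_def intro!: continuous_intros)
  then show ?thesis
  proof (rule polys.sq_closure_dominated)
    show "integrable M (\<lambda>t. (1::real)\<^sup>2)" by simp
    show "AE t in M. cmod (complex_of_real (h n (exp (- (c / 4 * t))))) \<le> 1" for n
      by (auto simp: h_def)
    show "AE t in M. (\<lambda>n. complex_of_real (h n (exp (- (c / 4 * t))))) \<longlonglongrightarrow> indicator {..x} t"
    proof (intro always_eventually allI)
      fix t
      define u where "u = exp (- (c / 4 * t))"
      have u: "u \<ge> u0 \<longleftrightarrow> t \<le> x" using c_pos by (simp add: u_def u0_def)
      have "(\<lambda>n. complex_of_real (h n u)) \<longlonglongrightarrow> indicator {..x} t"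
      proof (cases "t \<le> x")
        case True
        then have "h n u = 1" for n using u by (simp add: h_def)
        then show ?thesis using True by simp
      next
        case False
        then have "u0 - u > 0" using u by simp
        then obtain N where N: "1 < real N * (u0 - u)" using ex_less_of_nat_mult by blast
        have "h n u = 0" if "n \<ge> N" for n
        proof -
          have "real N * (u0 - u) \<le> real n * (u0 - u)"
            using that \<open>u0 - u > 0\<close> by (intro mult_right_mono) auto
          with N show ?thesis by (simp add: h_def algebra_simps)
        qed
        then have "\<forall>\<^sub>F n in sequentially. complex_of_real (h n u) = indicator {..x} t"
          using False by (auto simp: eventually_sequentially)
        then show ?thesis by (rule tendsto_eventually)
      qed
      then show "(\<lambda>n. complex_of_real (h n (exp (- (c / 4 * t))))) \<longlonglongrightarrow> indicator {..x} t"
        by (simp add: u_def)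
    qed
  qed measurable
qed

text \<open>Dynkin's argument: the half-lines \<open>{..x}\<close> are stable under intersection and
  generate the Borel sets; complements follow by linearity, disjoint unions by dominated convergence
  with the bound 1.\<close>

lemma indicator_in_closure:
  assumes "B \<in> sets M"
  shows "indicator B \<in> sq_closure M poly_functions"
proof -
  have one: "indicator UNIV \<in> sq_closure M poly_functions"
    unfolding indicator_UNIV poly_functions_def
    by (rule polys.sq_closure_superset[unfolded poly_functions_def]) (auto intro!: image_eqI[of _ _ 1])
  have "sets M = sigma_sets UNIV (range atMost)"
    unfolding sets_M borel_eq_atMost by (simp add: sets_measure_of)
  note sets_eq = this
  have "Int_stable (range (atMost :: real \<Rightarrow> real set))"
    by (auto simp: Int_stable_def intro: image_eqI[of _ _ "min _ _"])
  moreover have "range (atMost :: real \<Rightarrow> real set) \<subseteq> Pow UNIV" by simp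
  moreover have "B \<in> sigma_sets UNIV (range atMost)" using assms sets_eq by simp
  ultimately show ?thesis
  proof (induction B rule: sigma_sets_induct_disjoint)
    case (basic A)
    then show ?case using indicator_atMost_in_closure by auto
  next
    case empty
    then show ?case using polys.sq_closure_superset[OF polys.P_zero] by simp
  next
    case (compl A)
    have "(\<lambda>t. indicator UNIV t - indicator A t :: complex) \<in> sq_closure M poly_functions"
      by (intro polys.sq_closure_diff one compl.IH)
    moreover have "(\<lambda>t. indicator UNIV t - indicator A t :: complex) = indicator (UNIV - A)"
      by (auto simp: indicator_def)
    ultimately show ?case by simp
  next
    case (union A)
    have A: "A i \<in> sets M" for i
      using union.hyps(2) sets_eq by blast
    define F where "F n = (\<lambda>t. \<Sum>i<n. indicator (A i) t :: complex)" for n :: nat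
    have F: "F n \<in> sq_closure M poly_functions" for n
      unfolding F_def by (intro polys.sq_closure_sum union.IH)
    have F_eq: "F n = indicator (\<Union>i<n. A i)" for n
      unfolding F_def
      by (rule ext, rule indicator_UN_disjoint[symmetric])
        (use union.hyps(1) in \<open>auto simp: disjoint_family_on_def\<close>)
    show ?case
    proof (rule polys.sq_closure_dominated[OF F])
      show "integrable M (\<lambda>t. (1::real)\<^sup>2)" by simp
      show "AE t in M. cmod (F n t) \<le> 1" for n
        unfolding F_eq by (auto simp: indicator_def)
      show "AE t in M. (\<lambda>n. F n t) \<longlonglongrightarrow> indicator (\<Union>i. A i) t"
        unfolding F_eq by (intro always_eventually allI LIMSEQ_indicator_UN)
    qed (use A in measurable)
  qed
qed

theorem polynomials_dense: "sq_closure M poly_functions = sq_integrable M"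
  by (rule polys.sq_closure_eq_if_indicators[OF indicator_in_closure])

end

section \<open>Riesz--Fischer and orthonormal bases\<close>

text \<open>Along a subsequence with squared gaps below \<open>4 ^ - k\<close>, the bound \<open>x \<le> 2 ^ - k + 2 ^ k * x\<^sup>2\<close> makes
  the increments absolutely summable almost everywhere.\<close>

theorem riesz_fischer:
  assumes F: "\<And>n. F n \<in> sq_integrable M"
    and cauchy: "\<And>e. e > 0 \<Longrightarrow> \<exists>N. \<forall>m\<ge>N. \<forall>n\<ge>N. sq_dist M (F m) (F n) < e"
  shows "\<exists>f\<in>sq_integrable M. (\<lambda>n. sq_dist M f (F n)) \<longlonglongrightarrow> 0"
proof -
  note [measurable] = sq_integrable_measurable[OF F]
  have nn_sq_dist: "(\<integral>\<^sup>+t. ennreal ((cmod (F m t - F n t))\<^sup>2) \<partial>M) = ennreal (sq_dist M (F m) (F n))" for m n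
    unfolding sq_dist_def
    by (rule nn_integral_eq_integral) (simp_all add: sq_integrable_integrable sq_integrable_diff F)
  have "\<exists>N. \<forall>m\<ge>N. \<forall>n\<ge>N. sq_dist M (F m) (F n) < (1/4) ^ k" for k
    by (rule cauchy) simp
  then obtain N where N: "\<And>k m n. m \<ge> N k \<Longrightarrow> n \<ge> N k \<Longrightarrow> sq_dist M (F m) (F n) < (1/4) ^ k"
    by metis
  \<comment> \<open>Summing the thresholds makes \<open>r\<close> monotone and at least
    \<open>N k\<close>. The extra summand \<open>k\<close> forces \<open>r k \<ge> k\<close>, so
    that the subsequence eventually passes every index, as the Fatou step needs.\<close>
  define r where "r k = k + (\<Sum>i\<le>k. N i)" for k
  have r_ge: "r k \<ge> N k" for k
    unfolding r_def using member_le_sum[of k "{..k}" N] by simp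
  have r_mono: "r k \<le> r l" if "k \<le> l" for k l
    unfolding r_def using that by (intro add_mono sum_mono2) auto
  define D where "D k t = F (r (Suc k)) t - F (r k) t" for k t
  have [measurable]: "D k \<in> borel_measurable M" for k unfolding D_def by measurable
  have "(\<integral>\<^sup>+t. (\<Sum>k. ennreal (2 ^ k * (cmod (D k t))\<^sup>2)) \<partial>M)
      = (\<Sum>k. \<integral>\<^sup>+t. ennreal (2 ^ k * (cmod (D k t))\<^sup>2) \<partial>M)"
    by (rule nn_integral_suminf) measurable
  also have "\<dots> \<le> (\<Sum>k. ennreal ((1/2) ^ k))"
  proof (rule suminf_le)
    fix k
    have "(\<integral>\<^sup>+t. ennreal (2 ^ k * (cmod (D k t))\<^sup>2) \<partial>M)
        = ennreal (2 ^ k) * (\<integral>\<^sup>+t. ennreal ((cmod (D k t))\<^sup>2) \<partial>M)"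
      by (subst nn_integral_cmult[symmetric]) (simp_all add: ennreal_mult)
    also have "\<dots> = ennreal (2 ^ k * sq_dist M (F (r (Suc k))) (F (r k)))"
      unfolding D_def nn_sq_dist by (simp add: ennreal_mult)
    also have "\<dots> \<le> ennreal ((1/2) ^ k)"
    proof (rule ennreal_leI)
      have "sq_dist M (F (r (Suc k))) (F (r k)) \<le> (1/4) ^ k"
        using N[of k "r (Suc k)" "r k"] r_ge[of k] r_mono[of k "Suc k"] by simp
      then have "2 ^ k * sq_dist M (F (r (Suc k))) (F (r k)) \<le> 2 ^ k * (1/4) ^ k"
        by (intro mult_left_mono) auto
      then show "2 ^ k * sq_dist M (F (r (Suc k))) (F (r k)) \<le> (1/2) ^ k"
        by (simp flip: power_mult_distrib)
    qed
    finally show "(\<integral>\<^sup>+t. ennreal (2 ^ k * (cmod (D k t))\<^sup>2) \<partial>M) \<le> ennreal ((1/2) ^ k)" .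
  qed auto
  also have "\<dots> < \<infinity>"
    by (subst suminf_ennreal2) auto
  finally have "AE t in M. (\<Sum>k. ennreal (2 ^ k * (cmod (D k t))\<^sup>2)) \<noteq> \<infinity>"
    by (intro nn_integral_noteq_infinite) auto
  then have conv: "AE t in M. convergent (\<lambda>k. F (r k) t)"
  proof eventually_elim
    case (elim t)
    have s1: "summable (\<lambda>k. 2 ^ k * (cmod (D k t))\<^sup>2)"
      by (rule summable_suminf_not_top) (use elim in auto)
    have s2: "summable (\<lambda>k. (1/2) ^ k + 2 ^ k * (cmod (D k t))\<^sup>2)"
      by (intro summable_add s1) auto
    have "summable (\<lambda>k. cmod (D k t))"
    proof (rule summable_comparison_test'[OF s2])
      fix k
      have "x \<le> (1/2) ^ k + 2 ^ k * x\<^sup>2" if "x \<ge> 0" for x :: real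
      proof (cases "x \<le> (1/2) ^ k")
        case False
        then have "1 \<le> 2 ^ k * x" by (simp add: power_divide field_simps)
        then have "1 * x \<le> (2 ^ k * x) * x" using that by (rule mult_right_mono)
        then have "x \<le> 2 ^ k * x\<^sup>2" by (simp add: power2_eq_square)
        moreover have "0 \<le> (1/2 :: real) ^ k" by simp
        ultimately show ?thesis by linarith
      qed (simp add: add_increasing2)
      then show "norm (cmod (D k t)) \<le> (1/2) ^ k + 2 ^ k * (cmod (D k t))\<^sup>2" by simp
    qed
    then have "summable (\<lambda>k. D k t)" by (rule summable_norm_cancel)
    then have "(\<lambda>k. F (r 0) t + (\<Sum>i<k. D i t)) \<longlonglongrightarrow> F (r 0) t + (\<Sum>i. D i t)"
      by (intro tendsto_intros summable_LIMSEQ)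
    moreover have "F (r 0) t + (\<Sum>i<k. D i t) = F (r k) t" for k
      unfolding D_def by (subst sum_lessThan_telescope[where f = "\<lambda>k. F (r k) t"]) simp
    ultimately show ?case by (auto simp: convergent_def)
  qed
  define f where "f t = lim (\<lambda>k. F (r k) t)" for t
  have [measurable]: "f \<in> borel_measurable M" unfolding f_def by measurable
  \<comment> \<open>Fatou's lemma along the subsequence carries a Cauchy bound over to the limit. It
    is used twice: for square-integrability of \<open>f\<close>, and for convergence of the full
    sequence.\<close>
  have fatou: "(\<integral>\<^sup>+t. ennreal ((cmod (f t - F n t))\<^sup>2) \<partial>M) \<le> ennreal e"
    if n: "\<And>m. m \<ge> N0 \<Longrightarrow> sq_dist M (F m) (F n) \<le> e" for n N0 e
  proof -
    have "AE t in M. liminf (\<lambda>k. ennreal ((cmod (F (r k) t - F n t))\<^sup>2)) = ennreal ((cmod (f t - F n t))\<^sup>2)"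
      using conv
    proof eventually_elim
      case (elim t)
      then have "(\<lambda>k. F (r k) t) \<longlonglongrightarrow> f t" by (simp add: f_def convergent_LIMSEQ_iff)
      then have "(\<lambda>k. ennreal ((cmod (F (r k) t - F n t))\<^sup>2)) \<longlonglongrightarrow> ennreal ((cmod (f t - F n t))\<^sup>2)"
        by (intro tendsto_intros)
      then show ?case by (intro lim_imp_Liminf) auto
    qed
    then have "(\<integral>\<^sup>+t. ennreal ((cmod (f t - F n t))\<^sup>2) \<partial>M)
        = (\<integral>\<^sup>+t. liminf (\<lambda>k. ennreal ((cmod (F (r k) t - F n t))\<^sup>2)) \<partial>M)"
      by (intro nn_integral_cong_AE) auto
    also have "\<dots> \<le> liminf (\<lambda>k. \<integral>\<^sup>+t. ennreal ((cmod (F (r k) t - F n t))\<^sup>2) \<partial>M)"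
      by (rule nn_integral_liminf) measurable
    also have "\<dots> \<le> limsup (\<lambda>k. \<integral>\<^sup>+t. ennreal ((cmod (F (r k) t - F n t))\<^sup>2) \<partial>M)"
      by (rule Liminf_le_Limsup) simp
    also have "\<dots> \<le> ennreal e"
    proof (rule Limsup_bounded)
      have "r k \<ge> N0" if "k \<ge> N0" for k using that by (simp add: r_def)
      then show "\<forall>\<^sub>F k in sequentially. (\<integral>\<^sup>+t. ennreal ((cmod (F (r k) t - F n t))\<^sup>2) \<partial>M) \<le> ennreal e"
        unfolding nn_sq_dist using n by (auto simp: eventually_sequentially intro!: ennreal_leI exI[of _ N0])
    qed
    finally show ?thesis .
  qed
  have f_sq: "f \<in> sq_integrable M"
  proof -
    obtain N0 where N0: "\<And>m n. m \<ge> N0 \<Longrightarrow> n \<ge> N0 \<Longrightarrow> sq_dist M (F m) (F n) < 1"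
      using cauchy[of 1] by auto
    have "(\<integral>\<^sup>+t. ennreal ((cmod (f t - F N0 t))\<^sup>2) \<partial>M) \<le> ennreal 1"
      by (rule fatou[of N0]) (use N0 in \<open>auto intro: less_imp_le\<close>)
    then have "integrable M (\<lambda>t. (cmod (f t - F N0 t))\<^sup>2)"
      by (intro integrableI_bounded) (auto simp: le_less_trans)
    then have "(\<lambda>t. f t - F N0 t) \<in> sq_integrable M" by (simp add: sq_integrable_def)
    from sq_integrable_add[OF this F[of N0]] show ?thesis by simp
  qed
  have "(\<lambda>n. sq_dist M f (F n)) \<longlonglongrightarrow> 0"
  proof (rule LIMSEQ_I)
    fix e :: real assume e: "e > 0"
    then obtain N0 where N0: "\<And>m n. m \<ge> N0 \<Longrightarrow> n \<ge> N0 \<Longrightarrow> sq_dist M (F m) (F n) < e / 2"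
      using cauchy[of "e / 2"] by auto
    have "sq_dist M f (F n) < e" if n: "n \<ge> N0" for n
    proof -
      have "ennreal (sq_dist M f (F n)) = (\<integral>\<^sup>+t. ennreal ((cmod (f t - F n t))\<^sup>2) \<partial>M)"
        unfolding sq_dist_def
        by (rule nn_integral_eq_integral[symmetric])
          (simp_all add: sq_integrable_integrable sq_integrable_diff F f_sq)
      also have "\<dots> \<le> ennreal (e / 2)"
        by (rule fatou[of N0]) (use N0 n in \<open>auto intro: less_imp_le\<close>)
      finally show ?thesis using e by (simp add: ennreal_le_iff)
    qed
    then show "\<exists>no. \<forall>n\<ge>no. norm (sq_dist M f (F n) - 0) < e" by auto
  qed
  with f_sq show ?thesis by blast
qed

section \<open>Inner products of square-integrable functions\<close>

definition sq_inner :: "'w measure \<Rightarrow> ('w \<Rightarrow> complex) \<Rightarrow> ('w \<Rightarrow> complex) \<Rightarrow> complex" where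
  "sq_inner M f g = (LINT t|M. cnj (f t) * g t)"

lemma sq_inner_add_right:
  "f \<in> sq_integrable M \<Longrightarrow> g \<in> sq_integrable M \<Longrightarrow> h \<in> sq_integrable M \<Longrightarrow>
    sq_inner M f (\<lambda>t. g t + h t) = sq_inner M f g + sq_inner M f h"
  unfolding sq_inner_def distrib_left by (intro Bochner_Integration.integral_add integrable_cnj_mult)

lemma sq_inner_diff_right:
  "f \<in> sq_integrable M \<Longrightarrow> g \<in> sq_integrable M \<Longrightarrow> h \<in> sq_integrable M \<Longrightarrow>
    sq_inner M f (\<lambda>t. g t - h t) = sq_inner M f g - sq_inner M f h"
  unfolding sq_inner_def right_diff_distrib by (intro Bochner_Integration.integral_diff integrable_cnj_mult)

lemma sq_inner_cmult_right: "sq_inner M f (\<lambda>t. c * g t) = c * sq_inner M f g"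
  by (simp add: sq_inner_def mult.left_commute[of _ c])

lemma sq_inner_sum_right:
  assumes "f \<in> sq_integrable M" "\<And>i. i \<in> I \<Longrightarrow> g i \<in> sq_integrable M"
  shows "sq_inner M f (\<lambda>t. \<Sum>i\<in>I. g i t) = (\<Sum>i\<in>I. sq_inner M f (g i))"
  unfolding sq_inner_def sum_distrib_left
  by (intro Bochner_Integration.integral_sum integrable_cnj_mult assms)

lemma sq_inner_cnj: "cnj (sq_inner M f g) = sq_inner M g f"
  unfolding sq_inner_def by (subst Bochner_Integration.integral_cnj[symmetric]) (simp add: mult.commute)

lemma sq_inner_self: "sq_inner M f f = of_real (LINT t|M. (cmod (f t))\<^sup>2)"
proof -
  have "cnj z * z = of_real ((cmod z)\<^sup>2)" for z
    by (simp only: complex_norm_square mult.commute)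
  then show ?thesis unfolding sq_inner_def by (simp only: integral_complex_of_real)
qed

lemma sq_dist_expand:
  assumes f: "f \<in> sq_integrable M" and g: "g \<in> sq_integrable M"
  shows "sq_dist M f g = (LINT t|M. (cmod (f t))\<^sup>2) - 2 * Re (sq_inner M f g) + (LINT t|M. (cmod (g t))\<^sup>2)"
proof -
  have sq: "(cmod (x - y))\<^sup>2 = (cmod x)\<^sup>2 - 2 * Re (cnj x * y) + (cmod y)\<^sup>2" for x y
    unfolding cmod_power2 by (simp add: power2_eq_square algebra_simps)
  note i = sq_integrable_integrable[OF f] sq_integrable_integrable[OF g]
    integrable_Re[OF integrable_cnj_mult[OF f g]]
  have "sq_dist M f g = (LINT t|M. (cmod (f t))\<^sup>2) - 2 * (LINT t|M. Re (cnj (f t) * g t)) + (LINT t|M. (cmod (g t))\<^sup>2)"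
    unfolding sq_dist_def sq using i by (simp del: times_complex.sel)
  also have "(LINT t|M. Re (cnj (f t) * g t)) = Re (sq_inner M f g)"
    unfolding sq_inner_def by (rule integral_Re[OF integrable_cnj_mult[OF f g]])
  finally show ?thesis .
qed

text \<open>The weighted arithmetic-geometric mean inequality in place of Cauchy-Schwarz: with
  \<open>g\<close> fixed, a small weight \<open>e\<close> controls its term, and the other term is
  small once \<open>f\<close> is small relative to \<open>e\<close>.\<close>

lemma sq_inner_bound:
  assumes f: "f \<in> sq_integrable M" and g: "g \<in> sq_integrable M" and e: "e > 0"
  shows "cmod (sq_inner M f g) \<le> e * (LINT t|M. (cmod (g t))\<^sup>2) + (LINT t|M. (cmod (f t))\<^sup>2) / e"
proof -
  have "cmod (sq_inner M f g) \<le> (LINT t|M. cmod (cnj (f t) * g t))"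
    unfolding sq_inner_def by (rule integral_norm_bound)
  also have "\<dots> \<le> (LINT t|M. e * (cmod (g t))\<^sup>2 + (cmod (f t))\<^sup>2 / e)"
  proof (rule integral_mono)
    show "integrable M (\<lambda>t. cmod (cnj (f t) * g t))"
      by (intro integrable_norm integrable_cnj_mult f g)
    show "integrable M (\<lambda>t. e * (cmod (g t))\<^sup>2 + (cmod (f t))\<^sup>2 / e)"
      using sq_integrable_integrable[OF f] sq_integrable_integrable[OF g] by simp
    show "cmod (cnj (f t) * g t) \<le> e * (cmod (g t))\<^sup>2 + (cmod (f t))\<^sup>2 / e" for t
    proof -
      have "0 \<le> (e * cmod (g t) - cmod (f t))\<^sup>2" by simp
      then have "2 * (e * (cmod (f t) * cmod (g t))) \<le> e * (e * (cmod (g t))\<^sup>2) + (cmod (f t))\<^sup>2"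
        by (simp add: power2_eq_square algebra_simps)
      moreover have "0 \<le> e * (cmod (f t) * cmod (g t))" using e by simp
      ultimately have "e * (cmod (f t) * cmod (g t)) \<le> e * (e * (cmod (g t))\<^sup>2) + (cmod (f t))\<^sup>2"
        by linarith
      then show ?thesis using e by (simp add: norm_mult field_simps)
    qed
  qed
  also have "\<dots> = e * (LINT t|M. (cmod (g t))\<^sup>2) + (LINT t|M. (cmod (f t))\<^sup>2) / e"
    using sq_integrable_integrable[OF f] sq_integrable_integrable[OF g] by simp
  finally show ?thesis .
qed

lemma sq_inner_tendsto:
  assumes f: "f \<in> sq_integrable M" and F: "\<And>n. F n \<in> sq_integrable M" and g: "g \<in> sq_integrable M"
    and lim: "(\<lambda>n. sq_dist M f (F n)) \<longlonglongrightarrow> 0"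
  shows "(\<lambda>n. sq_inner M g (F n)) \<longlonglongrightarrow> sq_inner M g f"
proof (rule LIMSEQ_I)
  fix r :: real assume r: "r > 0"
  define G where "G = (LINT t|M. (cmod (g t))\<^sup>2)"
  have G: "G \<ge> 0" unfolding G_def by simp
  \<comment> \<open>Chosen so that \<open>e * G < r / 2\<close>; the summand 1 covers
    \<open>G = 0\<close>. The remaining \<open>r / 2\<close> is then met by a squared distance below
    \<open>e * r / 2\<close>.\<close>
  define e where "e = r / (2 * (G + 1))"
  have e: "e > 0" using r G by (simp add: e_def)
  have eG: "e * G < r / 2" using r G by (simp add: e_def field_simps)
  have "\<forall>\<^sub>F n in sequentially. sq_dist M f (F n) < e * r / 2"
    by (rule order_tendstoD[OF lim]) (use e r in simp)
  then obtain N where N: "\<And>n. n \<ge> N \<Longrightarrow> sq_dist M f (F n) < e * r / 2"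
    by (auto simp: eventually_sequentially)
  have "norm (sq_inner M g (F n) - sq_inner M g f) < r" if n: "n \<ge> N" for n
  proof -
    have "norm (sq_inner M g (F n) - sq_inner M g f) = norm (sq_inner M g (\<lambda>t. f t - F n t))"
      by (simp add: sq_inner_diff_right[OF g f F] norm_minus_commute)
    also have "\<dots> = norm (sq_inner M (\<lambda>t. f t - F n t) g)"
      by (subst sq_inner_cnj[symmetric]) simp
    also have "\<dots> \<le> e * G + sq_dist M f (F n) / e"
      unfolding G_def sq_dist_def by (intro sq_inner_bound sq_integrable_diff f F g e)
    also have "\<dots> < r"
    proof -
      have "sq_dist M f (F n) / e < r / 2" using N[OF n] e by (simp add: field_simps)
      with eG show ?thesis by linarith
    qed
    finally show ?thesis .
  qed
  then show "\<exists>no. \<forall>n\<ge>no. norm (sq_inner M g (F n) - sq_inner M g f) < r" by blast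
qed

section \<open>Fourier coefficients with respect to an orthonormal basis\<close>

locale sq_orthonormal_basis =
  fixes M :: "'w measure" and p :: "nat \<Rightarrow> 'w \<Rightarrow> complex"
  assumes p_sq: "p n \<in> sq_integrable M"
    and p_orth: "sq_inner M (p m) (p n) = (if m = n then 1 else 0)"
    and p_dense: "f \<in> sq_integrable M \<Longrightarrow> e > 0 \<Longrightarrow> \<exists>N c. sq_dist M f (\<lambda>t. \<Sum>n<N. c n * p n t) < e"
begin

definition coeff :: "('w \<Rightarrow> complex) \<Rightarrow> nat \<Rightarrow> complex" where
  "coeff f n = sq_inner M (p n) f"

lemma psum_sq: "(\<lambda>t. \<Sum>n\<in>I. c n * p n t) \<in> sq_integrable M"
  by (intro sq_integrable_sum sq_integrable_cmult p_sq)

lemma sq_inner_psum: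
  assumes "f \<in> sq_integrable M"
  shows "sq_inner M f (\<lambda>t. \<Sum>n\<in>I. c n * p n t) = (\<Sum>n\<in>I. c n * cnj (coeff f n))"
  using assms
  by (simp add: sq_inner_sum_right sq_integrable_cmult p_sq sq_inner_cmult_right coeff_def sq_inner_cnj)

lemma coeff_psum:
  assumes "finite I"
  shows "coeff (\<lambda>t. \<Sum>n\<in>I. c n * p n t) m = (if m \<in> I then c m else 0)"
  unfolding coeff_def
  by (simp add: sq_inner_sum_right sq_integrable_cmult p_sq sq_inner_cmult_right p_orth assms
      if_distrib[where f = "(*) _"] cong: if_cong)

lemma norm_psum:
  assumes "finite I"
  shows "(LINT t|M. (cmod (\<Sum>n\<in>I. c n * p n t))\<^sup>2) = (\<Sum>n\<in>I. (cmod (c n))\<^sup>2)"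
proof -
  have "complex_of_real (LINT t|M. (cmod (\<Sum>n\<in>I. c n * p n t))\<^sup>2) = (\<Sum>n\<in>I. c n * cnj (c n))"
    unfolding sq_inner_self[symmetric] sq_inner_psum[OF psum_sq] coeff_psum[OF assms]
    by (intro sum.cong) auto
  also have "\<dots> = complex_of_real (\<Sum>n\<in>I. (cmod (c n))\<^sup>2)"
    by (simp only: of_real_sum complex_norm_square)
  finally show ?thesis by (simp only: of_real_eq_iff)
qed

text \<open>Completing the square. The last sum vanishes for \<open>c = coeff f\<close>, which
  yields Bessel's inequality and the optimality of Fourier coefficients.\<close>

lemma sq_dist_psum:
  assumes f: "f \<in> sq_integrable M" and "finite I"
  shows "sq_dist M f (\<lambda>t. \<Sum>n\<in>I. c n * p n t) =
    (LINT t|M. (cmod (f t))\<^sup>2) - (\<Sum>n\<in>I. (cmod (coeff f n))\<^sup>2) + (\<Sum>n\<in>I. (cmod (coeff f n - c n))\<^sup>2)"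
proof -
  let ?S = "\<lambda>t. \<Sum>n\<in>I. c n * p n t"
  have sq: "(cmod (x - y))\<^sup>2 = (cmod x)\<^sup>2 - 2 * Re (cnj x * y) + (cmod y)\<^sup>2" for x y
    unfolding cmod_power2 by (simp add: power2_eq_square algebra_simps)
  have S: "(LINT t|M. (cmod (?S t))\<^sup>2) = (\<Sum>n\<in>I. (cmod (c n))\<^sup>2)"
    by (rule norm_psum[OF assms(2)])
  have "Re (sq_inner M f ?S) = (\<Sum>n\<in>I. Re (cnj (coeff f n) * c n))"
    unfolding sq_inner_psum[OF f] by (simp add: mult.commute)
  then show ?thesis
    unfolding sq sq_dist_expand[OF f psum_sq] S
    by (simp add: sum.distrib sum_subtractf sum_distrib_left)
qed

lemma bessel:
  assumes "f \<in> sq_integrable M" "finite I"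
  shows "(\<Sum>n\<in>I. (cmod (coeff f n))\<^sup>2) \<le> (LINT t|M. (cmod (f t))\<^sup>2)"
  using sq_dist_psum[OF assms, of "coeff f"] sq_dist_nonneg[of M f "\<lambda>t. \<Sum>n\<in>I. coeff f n * p n t"] by simp

lemma summable_coeff: "f \<in> sq_integrable M \<Longrightarrow> summable (\<lambda>n. (cmod (coeff f n))\<^sup>2)"
  by (rule summableI_nonneg_bounded[where x = "LINT t|M. (cmod (f t))\<^sup>2"]) (auto intro: bessel)

text \<open>Density only provides some coefficients. By \<open>sq_dist_psum\<close>, passing to the
  Fourier coefficients and adding further terms can only reduce the distance.\<close>

lemma psum_tendsto:
  assumes f: "f \<in> sq_integrable M"
  shows "(\<lambda>N. sq_dist M f (\<lambda>t. \<Sum>n<N. coeff f n * p n t)) \<longlonglongrightarrow> 0"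
proof (rule LIMSEQ_I)
  fix e :: real assume "e > 0"
  then obtain N c where N: "sq_dist M f (\<lambda>t. \<Sum>n<N. c n * p n t) < e"
    using p_dense[OF f] by blast
  have "sq_dist M f (\<lambda>t. \<Sum>n<m. coeff f n * p n t) < e" if m: "m \<ge> N" for m
  proof -
    have "(\<Sum>n<N. (cmod (coeff f n))\<^sup>2) \<le> (\<Sum>n<m. (cmod (coeff f n))\<^sup>2)"
      using m by (intro sum_mono2) auto
    moreover have "0 \<le> (\<Sum>n<N. (cmod (coeff f n - c n))\<^sup>2)" by (intro sum_nonneg) simp
    ultimately have "sq_dist M f (\<lambda>t. \<Sum>n<m. coeff f n * p n t) \<le> sq_dist M f (\<lambda>t. \<Sum>n<N. c n * p n t)"
      unfolding sq_dist_psum[OF f finite_lessThan] by simp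
    with N show ?thesis by linarith
  qed
  then show "\<exists>no. \<forall>m\<ge>no. norm (sq_dist M f (\<lambda>t. \<Sum>n<m. coeff f n * p n t) - 0) < e" by auto
qed

theorem parseval:
  assumes f: "f \<in> sq_integrable M" and g: "g \<in> sq_integrable M"
  shows "(\<lambda>n. cnj (coeff f n) * coeff g n) sums sq_inner M f g"
  using sq_inner_tendsto[OF g psum_sq f psum_tendsto[OF g]]
  unfolding sq_inner_psum[OF f] sums_def by (simp add: mult.commute)

text \<open>Completeness of L2 enters here: the partial sums are Cauchy by the Pythagorean identity
  \<open>norm_psum\<close>, and continuity of \<open>sq_inner\<close> reads off the coefficients of
  their limit.\<close>

theorem coeff_surj:
  assumes x: "summable (\<lambda>n. (cmod (x n))\<^sup>2)"
  shows "\<exists>f\<in>sq_integrable M. coeff f = x"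
proof -
  define F where "F N = (\<lambda>t. \<Sum>n<N. x n * p n t)" for N
  have F: "F N \<in> sq_integrable M" for N unfolding F_def by (rule psum_sq)
  have dist: "sq_dist M (F m) (F n) = (\<Sum>k\<in>{m..<n}. (cmod (x k))\<^sup>2)" if "m \<le> n" for m n
  proof -
    have "F n t - F m t = (\<Sum>k\<in>{m..<n}. x k * p k t)" for t
      unfolding F_def using sum_diff_nat_ivl[of 0 m n "\<lambda>k. x k * p k t"] that
      by (simp add: atLeast0LessThan)
    then show ?thesis
      by (subst sq_dist_commute) (simp add: sq_dist_def norm_psum)
  qed
  have "\<exists>N. \<forall>m\<ge>N. \<forall>n\<ge>N. sq_dist M (F m) (F n) < e" if e: "e > 0" for e
  proof -
    obtain N where N: "\<And>m n. m \<ge> N \<Longrightarrow> norm (\<Sum>k\<in>{m..<n}. (cmod (x k))\<^sup>2) < e"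
      using x e unfolding summable_Cauchy by blast
    have "sq_dist M (F m) (F n) < e" if "m \<ge> N" "n \<ge> N" for m n
    proof (cases "m \<le> n")
      case True
      then show ?thesis using N[OF that(1), of n] by (simp add: dist)
    next
      case False
      then show ?thesis using N[OF that(2), of m] by (subst sq_dist_commute) (simp add: dist)
    qed
    then show ?thesis by blast
  qed
  from riesz_fischer[of F, OF F this]
  obtain f where f: "f \<in> sq_integrable M" and lim: "(\<lambda>N. sq_dist M f (F N)) \<longlonglongrightarrow> 0" by blast
  have "coeff f m = x m" for m
  proof (rule LIMSEQ_unique)
    show "(\<lambda>N. coeff (F N) m) \<longlonglongrightarrow> coeff f m"
      unfolding coeff_def by (rule sq_inner_tendsto[OF f F p_sq lim])
    have "coeff (F N) m = x m" if "N \<ge> Suc m" for N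
      unfolding F_def using that by (simp add: coeff_psum)
    then show "(\<lambda>N. coeff (F N) m) \<longlonglongrightarrow> x m"
      by (intro tendsto_eventually) (auto simp: eventually_sequentially)
  qed
  with f show ?thesis by auto
qed

end

section \<open>Multiplication operators in a unitary model\<close>

global_interpretation cvec: vector_space scaleC
  by (rule vector_space_scaleC)

lemma coord_add [simp]: "coord (x + y) n = coord x n + coord y n"
  by (simp add: plus_ell2.rep_eq)

lemma coord_zero [simp]: "coord 0 n = 0"
  by (simp add: zero_ell2.rep_eq)

lemma coord_diff [simp]: "coord (x - y) n = coord x n - coord y n"
  unfolding minus_ell2_def plus_ell2.rep_eq uminus_ell2.rep_eq by simp

lemma coord_scaleC [simp]: "coord (c *\<^sub>C x) n = c * coord x n"
  by (simp add: scaleC.rep_eq)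

lemma ell2_eqI: "(\<And>n. coord x n = coord y n) \<Longrightarrow> x = y"
  by (simp add: coord_inject[symmetric] fun_eq_iff)

lemma cinner_add_right: "cinner x (y + z) = cinner x y + cinner x z"
  unfolding cinner_def by (subst suminf_add[OF summable_cinner summable_cinner]) (simp add: algebra_simps)

lemma cinner_scaleC_right: "cinner x (c *\<^sub>C y) = c * cinner x y"
  unfolding cinner_def by (subst suminf_mult[OF summable_cinner, symmetric]) (simp add: algebra_simps)

lemma cinner_commute: "cinner y x = cnj (cinner x y)"
  unfolding cinner_def
  by (subst bounded_linear.suminf[OF bounded_linear_cnj summable_cinner]) (simp add: mult.commute)

lemma cinner_add_left: "cinner (x + y) z = cinner x z + cinner y z"
  by (subst (1 2 3) cinner_commute) (simp add: cinner_add_right)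

lemma cinner_scaleC_left: "cinner (c *\<^sub>C x) y = cnj c * cinner x y"
  by (subst (1 2) cinner_commute) (simp add: cinner_scaleC_right)

lemma cinner_self: "cinner x x = of_real ((norm x)\<^sup>2)"
proof -
  have "cinner x x = cnj (cinner x x)" by (rule cinner_commute)
  then have "Im (cinner x x) = 0" by (metis Reals_cnj_iff complex_is_Real_iff)
  moreover have "Re (cinner x x) = (norm x)\<^sup>2"
    by (simp add: power2_norm_eq_inner inner_ell2_def)
  ultimately show ?thesis by (simp add: complex_eq_iff)
qed

text \<open>The imaginary part is a real inner product with \<open>\<i> *\<^sub>C x\<close>, so
  continuity of \<open>cinner\<close> is inherited from \<open>inner\<close>.\<close>

lemma cinner_eq_inner: "cinner x y = Complex (inner x y) (inner (\<i> *\<^sub>C x) y)"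
  by (simp add: inner_ell2_def complex_eq_iff cinner_scaleC_left)

lemma continuous_on_cinner_right [continuous_intros]:
  "continuous_on S f \<Longrightarrow> continuous_on S (\<lambda>t. cinner x (f t))"
  unfolding cinner_eq_inner Complex_eq by (intro continuous_intros)

text \<open>\<open>U\<close> stands for a unitary map from L2 onto \<open>K\<close>, but acts on
  functions rather than classes; it is injective only up to null sets, see
  \<open>U_eq_iff\<close>.\<close>

locale unitary_model = finite_measure M for M :: "real measure" +
  fixes K :: "ell2 set" and U :: "(real \<Rightarrow> complex) \<Rightarrow> ell2"
  assumes sets_M [measurable_cong]: "sets M = sets borel"
    and U_add: "f \<in> sq_integrable M \<Longrightarrow> g \<in> sq_integrable M \<Longrightarrow> U (\<lambda>t. f t + g t) = U f + U g"
    and U_cmult: "f \<in> sq_integrable M \<Longrightarrow> U (\<lambda>t. c * f t) = c *\<^sub>C U f"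
    and U_cinner: "f \<in> sq_integrable M \<Longrightarrow> g \<in> sq_integrable M \<Longrightarrow> cinner (U f) (U g) = sq_inner M f g"
    and U_image: "U ` sq_integrable M = K"
    and closed_K: "closed K"
begin

lemma space_M [simp]: "space M = UNIV"
  using sets_eq_imp_space_eq[OF sets_M] by simp

lemma U_in_K: "f \<in> sq_integrable M \<Longrightarrow> U f \<in> K"
  using U_image by blast

lemma U_diff:
  assumes "f \<in> sq_integrable M" "g \<in> sq_integrable M"
  shows "U (\<lambda>t. f t - g t) = U f - U g"
  using U_add[OF assms(1) sq_integrable_cmult[OF assms(2), of "-1"]] U_cmult[OF assms(2), of "-1"]
  by (auto intro!: ell2_eqI)

lemma norm_U:
  assumes "f \<in> sq_integrable M"
  shows "(norm (U f))\<^sup>2 = (LINT t|M. (cmod (f t))\<^sup>2)"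
  using U_cinner[OF assms assms] unfolding cinner_self sq_inner_self by (simp only: of_real_eq_iff)

lemma dist_U:
  assumes "f \<in> sq_integrable M" "g \<in> sq_integrable M"
  shows "(dist (U f) (U g))\<^sup>2 = sq_dist M f g"
  unfolding dist_norm U_diff[OF assms, symmetric] norm_U[OF sq_integrable_diff[OF assms]] sq_dist_def ..

lemma U_eq_iff:
  assumes f: "f \<in> sq_integrable M" and g: "g \<in> sq_integrable M"
  shows "U f = U g \<longleftrightarrow> (AE t in M. f t = g t)"
proof -
  have "U f = U g \<longleftrightarrow> (dist (U f) (U g))\<^sup>2 = 0" by simp
  also have "\<dots> \<longleftrightarrow> (AE t in M. (cmod (f t - g t))\<^sup>2 = 0)"
    unfolding dist_U[OF f g] sq_dist_def
    using sq_integrable_integrable[OF sq_integrable_diff[OF f g]]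
    by (intro integral_nonneg_eq_0_iff_AE) auto
  also have "\<dots> \<longleftrightarrow> (AE t in M. f t = g t)" by simp
  finally show ?thesis .
qed

lemma U_tendsto:
  assumes f: "f \<in> sq_integrable M" and F: "\<And>n. F n \<in> sq_integrable M"
    and lim: "(\<lambda>n. sq_dist M f (F n)) \<longlonglongrightarrow> 0"
  shows "(\<lambda>n. U (F n)) \<longlonglongrightarrow> U f"
proof -
  have "(\<lambda>n. sqrt ((dist (U (F n)) (U f))\<^sup>2)) \<longlonglongrightarrow> sqrt 0"
    unfolding dist_U[OF F f] using lim by (intro tendsto_real_sqrt) (simp add: sq_dist_commute)
  then show ?thesis by (subst tendsto_dist_iff) simp
qed

lemma U_dominated:
  assumes f: "f \<in> borel_measurable M" and F: "\<And>n. F n \<in> borel_measurable M"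
    and w: "integrable M (\<lambda>t. (w t)\<^sup>2)"
    and b: "\<And>n. AE t in M. cmod (F n t) \<le> w t"
    and lim: "AE t in M. (\<lambda>n. F n t) \<longlonglongrightarrow> f t"
  shows "(\<lambda>n. U (F n)) \<longlonglongrightarrow> U f"
  by (rule U_tendsto[OF sq_dist_tendsto_dominated(1)[OF f F w b lim] sq_integrable_bound[OF F w b]
        sq_dist_tendsto_dominated(2)[OF f F w b lim]])

lemma indicator_mult_sq:
  assumes f: "f \<in> sq_integrable M" and B: "B \<in> sets borel"
  shows "(\<lambda>t. indicator B t * f t) \<in> sq_integrable M"
proof (rule sq_integrable_mult_bounded[OF f])
  show "indicator B \<in> borel_measurable M" using B by measurable
  show "AE t in M. cmod (indicator B t) \<le> 1" by (auto simp: indicator_def)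
qed

section \<open>Self-adjointness of multiplication by the variable\<close>

definition mult_op :: oper where
  "mult_op = {(U f, U (\<lambda>t. of_real t * f t)) |f. f \<in> sq_integrable M \<and> (\<lambda>t. of_real t * f t) \<in> sq_integrable M}"

lemma mult_opI:
  "f \<in> sq_integrable M \<Longrightarrow> (\<lambda>t. of_real t * f t) \<in> sq_integrable M \<Longrightarrow>
    (U f, U (\<lambda>t. of_real t * f t)) \<in> mult_op"
  by (auto simp: mult_op_def)

lemma mult_opE:
  assumes "(x, y) \<in> mult_op"
  obtains f where "f \<in> sq_integrable M" "(\<lambda>t. of_real t * f t) \<in> sq_integrable M"
    "x = U f" "y = U (\<lambda>t. of_real t * f t)"
  using assms unfolding mult_op_def by blast

lemma mult_op_sub: "mult_op \<subseteq> K \<times> K"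
  by (auto simp: mult_op_def U_in_K)

lemma single_valued_mult_op: "single_valued mult_op"
proof (rule single_valuedI)
  fix x y z assume "(x, y) \<in> mult_op" "(x, z) \<in> mult_op"
  then obtain f g where f: "f \<in> sq_integrable M" "(\<lambda>t. of_real t * f t) \<in> sq_integrable M"
      "x = U f" "y = U (\<lambda>t. of_real t * f t)"
    and g: "g \<in> sq_integrable M" "(\<lambda>t. of_real t * g t) \<in> sq_integrable M"
      "x = U g" "z = U (\<lambda>t. of_real t * g t)"
    unfolding mult_op_def by blast
  then have "AE t in M. f t = g t" using U_eq_iff by metis
  then have "AE t in M. of_real t * f t = of_real t * g t" by eventually_elim simp
  then show "y = z" unfolding f g using U_eq_iff f g by blast
qed

text \<open>On the truncation interval multiplication by \<open>t\<close> is bounded, so truncated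
  functions lie in the domain of \<open>mult_op\<close>; they provide its density and the test
  vectors for the adjoint.\<close>

definition cut :: "nat \<Rightarrow> real \<Rightarrow> complex" where
  "cut n = indicator {- real n..real n}"

lemma cut_measurable [measurable]: "cut n \<in> borel_measurable M"
  unfolding cut_def by measurable

lemma cut_sq: "f \<in> sq_integrable M \<Longrightarrow> (\<lambda>t. cut n t * f t) \<in> sq_integrable M"
  unfolding cut_def by (rule indicator_mult_sq) auto

lemma mult_cut_sq:
  assumes f: "f \<in> sq_integrable M"
  shows "(\<lambda>t. of_real t * (cut n t * f t)) \<in> sq_integrable M"
proof -
  have "(\<lambda>t. (of_real t * cut n t) * f t) \<in> sq_integrable M"
  proof (rule sq_integrable_mult_bounded[OF f])
    show "AE t in M. cmod (of_real t * cut n t) \<le> real n"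
      by (auto simp: cut_def indicator_def norm_mult)
  qed measurable
  then show ?thesis by (simp add: mult.assoc)
qed

lemma cut_tendsto: "(\<lambda>n. cut n t * x) \<longlonglongrightarrow> x"
proof (rule tendsto_eventually)
  obtain N where "\<bar>t\<bar> \<le> real N" using real_arch_simple by blast
  then have "cut n t * x = x" if "n \<ge> N" for n
    using that by (auto simp: cut_def indicator_def abs_le_iff)
  then show "\<forall>\<^sub>F n in sequentially. cut n t * x = x" by (auto simp: eventually_sequentially)
qed

lemma mult_op_dense: "K \<subseteq> closure (Domain mult_op)"
proof
  fix x assume "x \<in> K"
  then obtain f where f: "f \<in> sq_integrable M" "x = U f" using U_image by auto
  note [measurable] = sq_integrable_measurable[OF f(1)]
  have "(\<lambda>n. U (\<lambda>t. cut n t * f t)) \<longlonglongrightarrow> U f"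
  proof (rule U_dominated)
    show "integrable M (\<lambda>t. (cmod (f t))\<^sup>2)" by (rule sq_integrable_integrable[OF f(1)])
    show "AE t in M. cmod (cut n t * f t) \<le> cmod (f t)" for n
      by (auto simp: cut_def indicator_def)
    show "AE t in M. (\<lambda>n. cut n t * f t) \<longlonglongrightarrow> f t"
      using cut_tendsto by auto
  qed measurable
  moreover have "U (\<lambda>t. cut n t * f t) \<in> Domain mult_op" for n
    using mult_opI[OF cut_sq[OF f(1)] mult_cut_sq[OF f(1)]] by blast
  ultimately show "x \<in> closure (Domain mult_op)"
    unfolding closure_sequential f(2) by (intro exI[of _ "\<lambda>n. U (\<lambda>t. cut n t * f t)"] conjI allI)
qed

text \<open>One inclusion holds because \<open>t\<close> is real. For the other, a pair
  \<open>(U g, U h)\<close> of the adjoint is tested against the truncated difference of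
  \<open>t * g\<close> and \<open>h\<close>; this shows that the difference has norm 0 on every
  truncation interval.\<close>

lemma adjoint_mult_op: "adjoint_in K mult_op = mult_op"
proof (rule antisym)
  show "mult_op \<subseteq> adjoint_in K mult_op"
  proof
    fix yz assume "yz \<in> mult_op"
    then obtain g where g: "g \<in> sq_integrable M" "(\<lambda>t. of_real t * g t) \<in> sq_integrable M"
      "yz = (U g, U (\<lambda>t. of_real t * g t))" unfolding mult_op_def by blast
    have "cinner w (U g) = cinner x (U (\<lambda>t. of_real t * g t))" if xw: "(x, w) \<in> mult_op" for x w
    proof -
      obtain f where f: "f \<in> sq_integrable M" "(\<lambda>t. of_real t * f t) \<in> sq_integrable M"
        "x = U f" "w = U (\<lambda>t. of_real t * f t)" using xw by (rule mult_opE)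
      show ?thesis
        unfolding f U_cinner[OF f(2) g(1)] U_cinner[OF f(1) g(2)] by (simp add: sq_inner_def mult_ac)
    qed
    with g show "yz \<in> adjoint_in K mult_op" unfolding adjoint_in_def by (auto intro: U_in_K)
  qed
  show "adjoint_in K mult_op \<subseteq> mult_op"
  proof
    fix yz assume yz: "yz \<in> adjoint_in K mult_op"
    then obtain g h where g: "g \<in> sq_integrable M" and h: "h \<in> sq_integrable M" and gh: "yz = (U g, U h)"
      unfolding adjoint_in_def U_image[symmetric] by blast
    note [measurable] = sq_integrable_measurable[OF g] sq_integrable_measurable[OF h]
    have "AE t in M. cut n t * (of_real t * g t) = cut n t * h t" for n
    proof -
      define d where "d t = of_real t * (cut n t * g t) - cut n t * h t" for t
      have d: "d \<in> sq_integrable M"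
        unfolding d_def by (intro sq_integrable_diff mult_cut_sq cut_sq g h)
      have cd: "cut n t * d t = d t" for t by (simp add: d_def cut_def indicator_def)
      have td: "(\<lambda>t. of_real t * d t) \<in> sq_integrable M"
        using mult_cut_sq[OF d, of n] unfolding cd .
      have "cinner (U (\<lambda>t. of_real t * d t)) (U g) = cinner (U d) (U h)"
        using yz mult_opI[OF d td] unfolding gh adjoint_in_def by auto
      then have *: "sq_inner M (\<lambda>t. of_real t * d t) g = sq_inner M d h"
        unfolding U_cinner[OF td g] U_cinner[OF d h] .
      \<comment> \<open>Since \<open>d\<close> vanishes outside the truncation interval, the cut can
        be inserted into the other factor, which makes \<open>t * g\<close>
        square-integrable.\<close>
      have cut_eq: "cnj (of_real t * d t) * g t = cnj (d t) * (of_real t * (cut n t * g t))"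
        "cnj (d t) * h t = cnj (d t) * (cut n t * h t)" for t
        by (auto simp: d_def cut_def indicator_def)
      have "sq_inner M d (\<lambda>t. of_real t * (cut n t * g t)) = sq_inner M d (\<lambda>t. cut n t * h t)"
        using * unfolding sq_inner_def cut_eq .
      then have "sq_inner M d d = 0"
        using sq_inner_diff_right[OF d mult_cut_sq[OF g, of n] cut_sq[OF h, of n]] unfolding d_def by simp
      then have "(LINT t|M. (cmod (d t))\<^sup>2) = 0"
        unfolding sq_inner_self by (simp only: of_real_eq_0_iff)
      then have "AE t in M. (cmod (d t))\<^sup>2 = 0"
        using sq_integrable_integrable[OF d] by (subst (asm) integral_nonneg_eq_0_iff_AE) auto
      then show ?thesis by eventually_elim (simp add: d_def algebra_simps)
    qed
    then have "AE t in M. \<forall>n. cut n t * (of_real t * g t) = cut n t * h t"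
      by (subst AE_all_countable) blast
    then have eq: "AE t in M. h t = of_real t * g t"
    proof eventually_elim
      case (elim t)
      show ?case
        by (rule LIMSEQ_unique[OF cut_tendsto[of t]]) (use cut_tendsto[of t "of_real t * g t"] elim in simp)
    qed
    have tg: "(\<lambda>t. of_real t * g t) \<in> sq_integrable M"
      by (rule sq_integrable_cong_AE[OF h _ eq]) measurable
    have "U h = U (\<lambda>t. of_real t * g t)" using U_eq_iff[OF h tg] eq by simp
    then show "yz \<in> mult_op" unfolding gh using mult_opI[OF g tg] by simp
  qed
qed

theorem self_adjoint_mult_op: "self_adjoint_in K mult_op"
  unfolding self_adjoint_in_def
  using mult_op_sub single_valued_mult_op mult_op_dense adjoint_mult_op by blast

section \<open>Spectral projections and a cyclic vector\<close>

lemma U_zero: "U (\<lambda>_. 0) = 0"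
  using U_cmult[OF sq_integrable_zero, of 0] by (auto intro!: ell2_eqI)

lemma subspace_K: "cvec.subspace K"
  unfolding cvec.subspace_def
proof (intro conjI ballI allI)
  show "0 \<in> K" using U_in_K[OF sq_integrable_zero] U_zero by simp
  show "x + y \<in> K" if "x \<in> K" "y \<in> K" for x y
    using that unfolding U_image[symmetric] by (auto simp flip: U_add intro!: imageI sq_integrable_add)
  show "c *\<^sub>C x \<in> K" if "x \<in> K" for c x
    using that unfolding U_image[symmetric] by (auto simp flip: U_cmult intro!: imageI sq_integrable_cmult)
qed

text \<open>Only meaningful on \<open>K\<close>, where it picks a preimage under \<open>U\<close>.\<close>

definition repr :: "ell2 \<Rightarrow> real \<Rightarrow> complex" where
  "repr x = (SOME f. f \<in> sq_integrable M \<and> U f = x)"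

lemma repr:
  assumes "x \<in> K"
  shows "repr x \<in> sq_integrable M" "U (repr x) = x"
proof -
  have "\<exists>f. f \<in> sq_integrable M \<and> U f = x" using assms U_image by blast
  then have "repr x \<in> sq_integrable M \<and> U (repr x) = x" unfolding repr_def by (rule someI_ex)
  then show "repr x \<in> sq_integrable M" "U (repr x) = x" by auto
qed

definition pvm :: "real set \<Rightarrow> ell2 \<Rightarrow> ell2" where
  "pvm B x = U (\<lambda>t. indicator B t * repr x t)"

text \<open>Independence of the chosen preimage: two preimages agree almost everywhere, hence so do
  their products with an indicator.\<close>

lemma pvm_U:
  assumes f: "f \<in> sq_integrable M" and B: "B \<in> sets borel"
  shows "pvm B (U f) = U (\<lambda>t. indicator B t * f t)"
proof -
  have r: "repr (U f) \<in> sq_integrable M" "U (repr (U f)) = U f"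
    using repr U_in_K[OF f] by auto
  then have "AE t in M. repr (U f) t = f t" using U_eq_iff[OF r(1) f] by simp
  then have "AE t in M. indicator B t * repr (U f) t = indicator B t * f t" by eventually_elim simp
  then show ?thesis
    unfolding pvm_def using U_eq_iff[OF indicator_mult_sq[OF r(1) B] indicator_mult_sq[OF f B]] by simp
qed

lemma norm_pvm_U:
  assumes f: "f \<in> sq_integrable M" and B: "B \<in> sets borel"
  shows "ennreal ((norm (pvm B (U f)))\<^sup>2) = emeasure (density M (\<lambda>t. ennreal ((cmod (f t))\<^sup>2))) B"
proof -
  note [measurable] = sq_integrable_measurable[OF f] B
  have "emeasure (density M (\<lambda>t. ennreal ((cmod (f t))\<^sup>2))) B
      = (\<integral>\<^sup>+t. ennreal ((cmod (indicator B t * f t))\<^sup>2) \<partial>M)"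
    by (subst emeasure_density) (auto intro!: nn_integral_cong simp: indicator_def)
  also have "\<dots> = ennreal (LINT t|M. (cmod (indicator B t * f t))\<^sup>2)"
    by (rule nn_integral_eq_integral[OF sq_integrable_integrable[OF indicator_mult_sq[OF f B]]]) simp
  also have "\<dots> = ennreal ((norm (pvm B (U f)))\<^sup>2)"
    unfolding pvm_U[OF f B] norm_U[OF indicator_mult_sq[OF f B]] ..
  finally show ?thesis ..
qed

text \<open>Turns integrals over spectral measures into integrals over \<open>M\<close>. A
  \<open>measure_of\<close> depends only on the values on the generated sigma-algebra, where
  \<open>norm_pvm_U\<close> applies.\<close>

lemma scalar_measure_pvm:
  assumes f: "f \<in> sq_integrable M"
  shows "scalar_measure pvm (U f) = density M (\<lambda>t. ennreal ((cmod (f t))\<^sup>2))" (is "_ = ?D")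
proof -
  have "scalar_measure pvm (U f) = measure_of UNIV (sets borel) (emeasure ?D)"
    unfolding scalar_measure_def
  proof (rule measure_of_eq)
    fix B assume "B \<in> sigma_sets UNIV (sets (borel :: real measure))"
    then have "B \<in> sets borel" using sets.sigma_sets_eq[of "borel :: real measure"] by simp
    then show "ennreal ((norm (pvm B (U f)))\<^sup>2) = emeasure ?D B" by (rule norm_pvm_U[OF f])
  qed simp
  also have "\<dots> = measure_of (space ?D) (sets ?D) (emeasure ?D)" by (simp add: sets_M)
  finally show ?thesis by (simp only: measure_of_of_measure)
qed

lemma pvm_pvm: "projection_valued_measure_in K pvm"
  unfolding projection_valued_measure_in_def orth_projection_in_def
proof (intro conjI ballI allI impI)
  fix B assume B: "B \<in> sets (borel :: real measure)"
  {
    fix x assume x: "x \<in> K"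
    show "pvm B x \<in> K"
      unfolding pvm_def by (intro U_in_K indicator_mult_sq repr x B)
    have "pvm B (pvm B x) = U (\<lambda>t. indicator B t * (indicator B t * repr x t))"
      by (subst (2) pvm_def) (intro pvm_U indicator_mult_sq repr x B)
    also have "(\<lambda>t. indicator B t * (indicator B t * repr x t)) = (\<lambda>t. indicator B t * repr x t)"
      by (auto simp: indicator_def)
    finally show "pvm B (pvm B x) = pvm B x" unfolding pvm_def .
    fix C assume C: "C \<in> sets (borel :: real measure)"
    have "pvm B (pvm C x) = U (\<lambda>t. indicator B t * (indicator C t * repr x t))"
      by (subst (2) pvm_def) (intro pvm_U indicator_mult_sq repr x B C)
    also have "(\<lambda>t. indicator B t * (indicator C t * repr x t)) = (\<lambda>t. indicator (B \<inter> C) t * repr x t)"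
      by (auto simp: indicator_def)
    finally show "pvm (B \<inter> C) x = pvm B (pvm C x)" unfolding pvm_def ..
  }
  fix x y assume x: "x \<in> K" and y: "y \<in> K"
  have "cinner (pvm B (U (repr x))) (U (repr y)) = cinner (U (repr x)) (pvm B (U (repr y)))"
    unfolding pvm_U[OF repr(1)[OF x] B] pvm_U[OF repr(1)[OF y] B]
      U_cinner[OF indicator_mult_sq[OF repr(1)[OF x] B] repr(1)[OF y]]
      U_cinner[OF repr(1)[OF x] indicator_mult_sq[OF repr(1)[OF y] B]]
    unfolding sq_inner_def
    by (intro Bochner_Integration.integral_cong refl) (simp add: indicator_def)
  then show "cinner (pvm B x) y = cinner x (pvm B y)" using repr(2) x y by simp
next
  fix x assume x: "x \<in> K"
  show "pvm UNIV x = x" unfolding pvm_def by (simp add: repr x)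
  fix B :: "nat \<Rightarrow> real set" assume B: "range B \<subseteq> sets borel" and disj: "disjoint_family B"
  note [measurable] = sq_integrable_measurable[OF repr(1)[OF x]]
  have Bm [measurable]: "B n \<in> sets borel" for n using B by auto
  have part: "(\<Sum>i<n. pvm (B i) x) = U (\<lambda>t. indicator (\<Union>i<n. B i) t * repr x t)" for n
  proof (induction n)
    case 0
    show ?case by (simp add: U_zero)
  next
    case (Suc n)
    have m: "(\<Union>i<n. B i) \<in> sets borel" by measurable
    have "(indicator (\<Union>i<Suc n. B i) t :: complex) = indicator (\<Union>i<n. B i) t + indicator (B n) t" for t
    proof -
      have "B i \<inter> B n = {}" if "i < n" for i
        using disjoint_family_onD[OF disj, of i n] that by auto
      then have "(\<Union>i<n. B i) \<inter> B n = {}" by blast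
      then have "indicator ((\<Union>i<n. B i) \<union> B n) t = (indicator (\<Union>i<n. B i) t + indicator (B n) t :: complex)"
        by (cases "t \<in> B n") (auto simp: indicator_def)
      then show ?thesis by (simp add: lessThan_Suc Un_commute)
    qed
    then have "U (\<lambda>t. indicator (\<Union>i<Suc n. B i) t * repr x t)
        = U (\<lambda>t. indicator (\<Union>i<n. B i) t * repr x t + indicator (B n) t * repr x t)"
      by (simp add: distrib_right)
    also have "\<dots> = (\<Sum>i<Suc n. pvm (B i) x)"
      using U_add[OF indicator_mult_sq[OF repr(1)[OF x] m] indicator_mult_sq[OF repr(1)[OF x] Bm]]
      by (simp add: Suc.IH pvm_def[of "B n"])
    finally show ?case ..
  qed
  show "(\<lambda>n. pvm (B n) x) sums pvm (\<Union>n. B n) x"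
    unfolding sums_def part unfolding pvm_def
  proof (rule U_dominated)
    show "integrable M (\<lambda>t. (cmod (repr x t))\<^sup>2)" by (intro sq_integrable_integrable repr x)
    show "AE t in M. cmod (indicator (\<Union>i<n. B i) t * repr x t) \<le> cmod (repr x t)" for n
      by (auto simp: indicator_def)
    show "AE t in M. (\<lambda>n. indicator (\<Union>i<n. B i) t * repr x t) \<longlonglongrightarrow> indicator (\<Union>n. B n) t * repr x t"
      by (intro always_eventually allI tendsto_intros LIMSEQ_indicator_UN)
  qed measurable
qed

text \<open>Against the density \<open>(cmod (f t))\<^sup>2\<close>, integrability of
  \<open>t\<^sup>2\<close> says precisely that \<open>t * f\<close> is square-integrable, so the
  natural domain of the spectral integral is the domain of \<open>mult_op\<close>.\<close>

lemma spectral_measure_pvm: "spectral_measure_in K mult_op pvm"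
  unfolding spectral_measure_in_def
proof (intro conjI)
  show "projection_valued_measure_in K pvm" by (rule pvm_pvm)
  have int_iff: "integrable (scalar_measure pvm (U f)) (\<lambda>t. t\<^sup>2) \<longleftrightarrow> (\<lambda>t. of_real t * f t) \<in> sq_integrable M"
    if f: "f \<in> sq_integrable M" for f
  proof -
    note [measurable] = sq_integrable_measurable[OF f]
    have "integrable (scalar_measure pvm (U f)) (\<lambda>t. t\<^sup>2) \<longleftrightarrow> integrable M (\<lambda>t. (cmod (f t))\<^sup>2 * t\<^sup>2)"
      unfolding scalar_measure_pvm[OF f] by (subst integrable_density) auto
    also have "\<dots> \<longleftrightarrow> (\<lambda>t. of_real t * f t) \<in> sq_integrable M"
      by (simp add: sq_integrable_def norm_mult power_mult_distrib mult.commute)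
    finally show ?thesis .
  qed
  show "Domain mult_op = {x \<in> K. integrable (scalar_measure pvm x) (\<lambda>t. t\<^sup>2)}"
  proof (intro set_eqI iffI)
    fix x assume "x \<in> Domain mult_op"
    then obtain f where "f \<in> sq_integrable M" "(\<lambda>t. of_real t * f t) \<in> sq_integrable M" "x = U f"
      by (auto elim: mult_opE)
    then show "x \<in> {x \<in> K. integrable (scalar_measure pvm x) (\<lambda>t. t\<^sup>2)}"
      using int_iff U_in_K by auto
  next
    fix x assume "x \<in> {x \<in> K. integrable (scalar_measure pvm x) (\<lambda>t. t\<^sup>2)}"
    then have x: "x \<in> K" "integrable (scalar_measure pvm x) (\<lambda>t. t\<^sup>2)" by auto
    then have "(\<lambda>t. of_real t * repr x t) \<in> sq_integrable M"
      using int_iff[OF repr(1)[OF x(1)]] repr(2) by simp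
    from mult_opI[OF repr(1)[OF x(1)] this] show "x \<in> Domain mult_op"
      using repr(2)[OF x(1)] by auto
  qed
  show "\<forall>(x, y)\<in>mult_op. cinner x y = complex_of_real (LINT t|scalar_measure pvm x. t)"
  proof (intro ballI, clarify)
    fix x y assume "(x, y) \<in> mult_op"
    then obtain f where f: "f \<in> sq_integrable M" "(\<lambda>t. of_real t * f t) \<in> sq_integrable M"
      "x = U f" "y = U (\<lambda>t. of_real t * f t)" by (rule mult_opE)
    note [measurable] = sq_integrable_measurable[OF f(1)]
    have "cnj (f t) * (of_real t * f t) = of_real ((cmod (f t))\<^sup>2 * t)" for t
    proof -
      have "cnj (f t) * (of_real t * f t) = of_real t * (f t * cnj (f t))" by simp
      also have "\<dots> = of_real ((cmod (f t))\<^sup>2 * t)" unfolding complex_norm_square[symmetric] by simp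
      finally show ?thesis .
    qed
    then have "cinner x y = complex_of_real (LINT t|M. (cmod (f t))\<^sup>2 * t)"
      unfolding f(3,4) U_cinner[OF f(1,2)] sq_inner_def by (simp only: integral_complex_of_real)
    also have "(LINT t|M. (cmod (f t))\<^sup>2 * t) = (LINT t|scalar_measure pvm x. t)"
      unfolding f(3) scalar_measure_pvm[OF f(1)] by (subst integral_density) auto
    finally show "cinner x y = complex_of_real (LINT t|scalar_measure pvm x. t)" .
  qed
qed

lemma one_sq: "(\<lambda>_. 1) \<in> sq_integrable M"
  by (simp add: sq_integrable_def)

text \<open>The spectral projections send the constant 1 to all indicators. The functions that
  \<open>U\<close> maps into the span form a linear space containing these indicators, so
  \<open>sq_closure_eq_if_indicators\<close> makes it dense, and \<open>U\<close> preserves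
  distances.\<close>

lemma cyclic: "closure (cspan {pvm B (U (\<lambda>_. 1)) |B. B \<in> sets borel}) = K"
proof (rule antisym)
  let ?G = "{pvm B (U (\<lambda>_. 1)) |B. B \<in> sets borel}"
  have pvm1: "pvm B (U (\<lambda>_. 1)) = U (indicator B)" if "B \<in> sets borel" for B
    using pvm_U[OF one_sq that] by simp
  have ind_sq: "indicator B \<in> sq_integrable M" if "B \<in> sets borel" for B
    using indicator_mult_sq[OF one_sq that] by simp
  have "?G \<subseteq> K" using pvm1 ind_sq U_in_K by auto
  then have "cspan ?G \<subseteq> K"
    unfolding cspan_def by (rule cvec.span_minimal[OF _ subspace_K])
  then show "closure (cspan ?G) \<subseteq> K" using closed_K by (rule closure_minimal)
  define P where "P = {f \<in> sq_integrable M. U f \<in> cspan ?G}"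
  interpret P: sq_subspace M P
  proof
    show "P \<subseteq> sq_integrable M" by (auto simp: P_def)
    show "(\<lambda>t. p t + q t) \<in> P" if "p \<in> P" "q \<in> P" for p q
      using that by (auto simp: P_def U_add sq_integrable_add cspan_def cvec.span_add)
    show "(\<lambda>t. c * p t) \<in> P" if "p \<in> P" for c p
      using that by (auto simp: P_def U_cmult sq_integrable_cmult cspan_def cvec.span_scale)
    show "(\<lambda>t. 0) \<in> P" by (simp add: P_def U_zero cspan_def cvec.span_zero)
  qed
  have "indicator B \<in> sq_closure M P" if "B \<in> sets M" for B
  proof (rule P.sq_closure_superset)
    have B: "B \<in> sets borel" using that sets_M by simp
    then have "U (indicator B) \<in> ?G" using pvm1[OF B] by (metis (mono_tags, lifting) mem_Collect_eq)
    then show "indicator B \<in> P"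
      unfolding P_def cspan_def using ind_sq[OF B] cvec.span_base by auto
  qed
  then have dense: "sq_closure M P = sq_integrable M" by (rule P.sq_closure_eq_if_indicators)
  show "K \<subseteq> closure (cspan ?G)"
  proof
    fix x assume x: "x \<in> K"
    define f where "f = repr x"
    have f: "f \<in> sq_integrable M" "x = U f"
      using repr[OF x] by (simp_all add: f_def)
    show "x \<in> closure (cspan ?G)"
      unfolding closure_approachable
    proof (intro allI impI)
      fix e :: real assume e: "e > 0"
      then have "e\<^sup>2 > 0" by simp
      moreover have "f \<in> sq_closure M P" using f dense by simp
      ultimately obtain p where p: "p \<in> P" "sq_dist M f p < e\<^sup>2"
        unfolding sq_closure_def by blast
      then have "(dist (U p) x)\<^sup>2 < e\<^sup>2"
        unfolding f(2) using dist_U[OF _ f(1), of p] by (simp add: P_def sq_dist_commute)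
      then have "dist (U p) x < e" using e by (simp add: power2_less_imp_less)
      with p show "\<exists>y\<in>cspan ?G. dist y x < e" by (auto simp: P_def)
    qed
  qed
qed

theorem simple_spectrum_mult_op: "simple_spectrum_in K mult_op"
  unfolding simple_spectrum_in_def
  using self_adjoint_mult_op spectral_measure_pvm cyclic U_in_K[OF one_sq] by blast

section \<open>Spectrum of the multiplication operator\<close>

lemma shift_mult_op:
  "shift mult_op z = {(U f, U (\<lambda>t. (of_real t - z) * f t)) |f.
    f \<in> sq_integrable M \<and> (\<lambda>t. of_real t * f t) \<in> sq_integrable M}"
proof -
  have "U (\<lambda>t. of_real t * f t) - z *\<^sub>C U f = U (\<lambda>t. (of_real t - z) * f t)"
    if "f \<in> sq_integrable M" "(\<lambda>t. of_real t * f t) \<in> sq_integrable M" for f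
    unfolding U_cmult[OF that(1), symmetric] U_diff[OF that(2) sq_integrable_cmult[OF that(1)], symmetric]
    by (simp add: left_diff_distrib)
  then show ?thesis unfolding shift_def mult_op_def by (force simp: image_iff)
qed

text \<open>Off the half-line, division by \<open>t - z\<close> is bounded. At
  \<open>l \<ge> 0\<close>, indicators of short intervals are approximate eigenvectors; the
  intervals lie to the right of \<open>l\<close> so that \<open>l = 0\<close> is included.\<close>

theorem spectrum_mult_op_half_line:
  assumes nonneg: "AE t in M. t \<ge> 0"
    and pos: "\<And>l e. l \<ge> 0 \<Longrightarrow> e > 0 \<Longrightarrow> emeasure M {l<..<l + e} \<noteq> 0"
  shows "spectrum_in K mult_op = complex_of_real ` {0..}"
proof -
  have "z \<in> resolvent_set_in K mult_op" if z: "z \<notin> complex_of_real ` {0..}" for z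
  proof -
    \<comment> \<open>A lower bound for the distance from \<open>z\<close> to the half-line:
      \<open>- Re z\<close> for real \<open>z\<close>, which is then negative, and the modulus of
      \<open>Im z\<close> otherwise.\<close>
    have "\<exists>d>0. \<forall>t\<ge>0. d \<le> cmod (of_real t - z)"
    proof (cases "Im z = 0")
      case True
      then have "z = of_real (Re z)" by (simp add: complex_eq_iff)
      with z have "Re z < 0" by (metis atLeast_iff image_eqI not_le)
      then show ?thesis
        using complex_Re_le_cmod[of "of_real _ - z"] by (intro exI[of _ "- Re z"]) (force intro: order_trans[rotated])
    next
      case False
      then show ?thesis
        using abs_Im_le_cmod[of "of_real _ - z"] by (intro exI[of _ "\<bar>Im z\<bar>"]) auto
    qed
    then obtain d where d: "d > 0" "\<And>t. t \<ge> 0 \<Longrightarrow> d \<le> cmod (of_real t - z)" by blast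
    have nz: "AE t in M. of_real t \<noteq> z" using nonneg by eventually_elim (use d in force)
    have bound: "norm (U f) \<le> 1 / d * norm (U g)"
      if f: "f \<in> sq_integrable M" and g: "g \<in> sq_integrable M" and "AE t in M. g t = (of_real t - z) * f t" for f g
    proof -
      have "(LINT t|M. (d * cmod (f t))\<^sup>2) \<le> (LINT t|M. (cmod (g t))\<^sup>2)"
      proof (rule integral_mono_AE)
        show "integrable M (\<lambda>t. (d * cmod (f t))\<^sup>2)"
          using sq_integrable_integrable[OF f] by (simp add: power_mult_distrib)
        show "AE t in M. (d * cmod (f t))\<^sup>2 \<le> (cmod (g t))\<^sup>2"
          using nonneg that(3)
        proof eventually_elim
          case (elim t)
          have "d * cmod (f t) \<le> cmod (g t)"
            unfolding elim(2) norm_mult using d elim by (intro mult_right_mono) auto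
          then show ?case using d by (intro power_mono) auto
        qed
      qed (rule sq_integrable_integrable[OF g])
      then have "(d * norm (U f))\<^sup>2 \<le> (norm (U g))\<^sup>2"
        by (simp add: power_mult_distrib norm_U f g)
      then have "d * norm (U f) \<le> norm (U g)" by (rule power2_le_imp_le) simp
      then show ?thesis using d by (simp add: field_simps)
    qed
    have shift_sq: "(\<lambda>t. (of_real t - z) * f t) \<in> sq_integrable M"
      if "f \<in> sq_integrable M" "(\<lambda>t. of_real t * f t) \<in> sq_integrable M" for f
      using sq_integrable_diff[OF that(2) sq_integrable_cmult[OF that(1), of z]] by (simp add: left_diff_distrib)
    show ?thesis
      unfolding resolvent_set_in_def
    proof (intro CollectI conjI)
      show "single_valued ((shift mult_op z)\<inverse>)"
      proof (rule single_valuedI)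
        fix w x y assume "(w, x) \<in> (shift mult_op z)\<inverse>" "(w, y) \<in> (shift mult_op z)\<inverse>"
        then obtain f g where f: "f \<in> sq_integrable M" "(\<lambda>t. of_real t * f t) \<in> sq_integrable M"
            "x = U f" "w = U (\<lambda>t. (of_real t - z) * f t)"
          and g: "g \<in> sq_integrable M" "(\<lambda>t. of_real t * g t) \<in> sq_integrable M"
            "y = U g" "w = U (\<lambda>t. (of_real t - z) * g t)"
          unfolding shift_mult_op by auto
        have "AE t in M. (of_real t - z) * f t = (of_real t - z) * g t"
          using U_eq_iff[OF shift_sq[OF f(1,2)] shift_sq[OF g(1,2)]] f g by metis
        with nz have "AE t in M. f t = g t" by eventually_elim auto
        then show "x = y" using U_eq_iff f g by blast
      qed
      show "Range (shift mult_op z) = K"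
      proof (intro set_eqI iffI)
        show "x \<in> K" if "x \<in> Range (shift mult_op z)" for x
          using that unfolding shift_mult_op by (auto intro!: U_in_K shift_sq)
        fix x assume x: "x \<in> K"
        define g where "g = repr x"
        have g: "g \<in> sq_integrable M" "x = U g"
          using repr[OF x] by (simp_all add: g_def)
        note [measurable] = sq_integrable_measurable[OF g(1)]
        define f where "f t = g t / (of_real t - z)" for t
        have "(\<lambda>t. (1 / (of_real t - z)) * g t) \<in> sq_integrable M"
        proof (rule sq_integrable_mult_bounded[OF g(1)])
          show "AE t in M. cmod (1 / (of_real t - z)) \<le> 1 / d"
            using nonneg
          proof eventually_elim
            case (elim t)
            then show ?case unfolding norm_divide norm_one using d by (intro divide_left_mono mult_pos_pos) (force intro: less_le_trans)+
          qed
        qed measurable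
        then have f: "f \<in> sq_integrable M" unfolding f_def by simp
        have ae: "AE t in M. (of_real t - z) * f t = g t"
          using nz by eventually_elim (simp add: f_def)
        note [measurable] = sq_integrable_measurable[OF f]
        \<comment> \<open>The quotient lies in the domain since \<open>t * f = g + z * f\<close>
          almost everywhere.\<close>
        have tf: "(\<lambda>t. of_real t * f t) \<in> sq_integrable M"
          by (rule sq_integrable_cong_AE[OF sq_integrable_add[OF g(1) sq_integrable_cmult[OF f, of z]]])
            (measurable, use ae in eventually_elim, simp add: algebra_simps)
        have "U (\<lambda>t. (of_real t - z) * f t) = x"
          unfolding g(2) using U_eq_iff[OF shift_sq[OF f tf] g(1)] ae by simp
        then show "x \<in> Range (shift mult_op z)" unfolding shift_mult_op using f tf by blast
      qed
      have "norm x \<le> 1 / d * norm y" if xy: "(x, y) \<in> shift mult_op z" for x y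
      proof -
        obtain f where f: "f \<in> sq_integrable M" "(\<lambda>t. of_real t * f t) \<in> sq_integrable M"
          "x = U f" "y = U (\<lambda>t. (of_real t - z) * f t)" using xy unfolding shift_mult_op by auto
        show ?thesis unfolding f(3,4) by (rule bound[OF f(1) shift_sq[OF f(1,2)]]) simp
      qed
      then show "\<exists>C. \<forall>(x, y)\<in>shift mult_op z. norm x \<le> C * norm y" by blast
    qed
  qed
  moreover have "of_real l \<notin> resolvent_set_in K mult_op" if l: "l \<ge> 0" for l
  proof
    assume "of_real l \<in> resolvent_set_in K mult_op"
    then obtain C where C: "\<And>x y. (x, y) \<in> shift mult_op (of_real l) \<Longrightarrow> norm x \<le> C * norm y"
      unfolding resolvent_set_in_def by blast
    \<comment> \<open>So short an interval that \<open>\<bar>C\<bar> * e < 1\<close>, which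
      contradicts the resolvent bound with constant \<open>C\<close>.\<close>
    define e where "e = 1 / (\<bar>C\<bar> + 1)"
    have e: "e > 0" by (simp add: e_def add_nonneg_pos)
    define f where "f = (indicator {l<..<l + e} :: real \<Rightarrow> complex)"
    have f: "f \<in> sq_integrable M"
      unfolding f_def using indicator_mult_sq[OF one_sq, of "{l<..<l + e}"] by simp
    have mult_f: "(\<lambda>t. g t * f t) \<in> sq_integrable M"
      if [measurable]: "g \<in> borel_measurable M" and g: "\<And>t. t \<in> {l<..<l + e} \<Longrightarrow> cmod (g t) \<le> B" and B: "B \<ge> 0" for g B
    proof (rule sq_integrable_bound)
      show "integrable M (\<lambda>t. B\<^sup>2)" by simp
      show "AE t in M. cmod (g t * f t) \<le> B" using g B by (auto simp: f_def indicator_def)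
    qed (use f in measurable)
    have mf: "(\<lambda>t. of_real t * f t) \<in> sq_integrable M"
      by (rule mult_f[of _ "l + e"]) (use l e in auto)
    have sf: "(\<lambda>t. (of_real t - of_real l) * f t) \<in> sq_integrable M"
    proof (rule mult_f)
      show "cmod (of_real t - of_real l) \<le> e" if "t \<in> {l<..<l + e}" for t
        using that by (simp flip: of_real_diff)
    qed (use e in auto)
    have "(norm (U (\<lambda>t. (of_real t - of_real l) * f t)))\<^sup>2 \<le> (LINT t|M. e\<^sup>2 * (cmod (f t))\<^sup>2)"
      unfolding norm_U[OF sf]
    proof (rule integral_mono)
      show "(cmod ((of_real t - of_real l) * f t))\<^sup>2 \<le> e\<^sup>2 * (cmod (f t))\<^sup>2" for t
        by (auto simp: f_def indicator_def simp flip: of_real_diff intro!: power_mono)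
    qed (use sq_integrable_integrable[OF sf] sq_integrable_integrable[OF f] in auto)
    also have "\<dots> = (e * norm (U f))\<^sup>2" by (simp add: norm_U[OF f] power_mult_distrib)
    finally have le: "norm (U (\<lambda>t. (of_real t - of_real l) * f t)) \<le> e * norm (U f)"
      by (rule power2_le_imp_le) (use e in simp)
    have "U f \<noteq> U (\<lambda>_. 0)"
    proof
      assume "U f = U (\<lambda>_. 0)"
      then have "AE t in M. t \<notin> {l<..<l + e}"
        unfolding U_eq_iff[OF f sq_integrable_zero] by eventually_elim (auto simp: f_def indicator_def)
      then have "emeasure M {l<..<l + e} = 0"
        by (subst (asm) AE_iff_measurable[of "{l<..<l + e}"]) (auto simp: sets_M)
      with pos[OF l e] show False by simp
    qed
    then have nz: "norm (U f) > 0" by (simp add: U_zero)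
    have "norm (U f) \<le> C * norm (U (\<lambda>t. (of_real t - of_real l) * f t))"
      by (rule C) (use f mf in \<open>auto simp: shift_mult_op\<close>)
    also have "\<dots> \<le> \<bar>C\<bar> * (e * norm (U f))"
      using le by (intro mult_mono) auto
    also have "\<dots> = \<bar>C\<bar> / (\<bar>C\<bar> + 1) * norm (U f)" by (simp add: e_def)
    also have "\<dots> < 1 * norm (U f)"
      using nz by (intro mult_strict_right_mono) (auto simp: field_simps)
    finally show False by simp
  qed
  ultimately show ?thesis unfolding spectrum_in_def by auto
qed

end

section \<open>Gamma measures and Laguerre polynomials\<close>

text \<open>Euler's integral after the substitution of \<open>r * t\<close> for
  \<open>t\<close>.\<close>

lemma nn_integral_gamma:
  fixes s r :: real
  assumes s: "s > 0" and r: "r > 0"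
  shows "(\<integral>\<^sup>+t. ennreal (indicator {0..} t * (t powr (s - 1) * exp (- (r * t)))) \<partial>lborel)
    = ennreal (Gamma s / r powr s)"
proof -
  have "ennreal (Gamma s) = (\<integral>\<^sup>+t. ennreal (indicator {0..} t * t powr (s - 1) / exp t) \<partial>lborel)"
    by (rule Gamma_conv_nn_integral_real[OF s])
  also have "\<dots> = ennreal \<bar>r\<bar> * (\<integral>\<^sup>+t. ennreal (indicator {0..} (0 + r * t) * (0 + r * t) powr (s - 1) / exp (0 + r * t)) \<partial>lborel)"
    by (rule nn_integral_real_affine) (use r in auto)
  also have "\<dots> = ennreal \<bar>r\<bar> * (\<integral>\<^sup>+t. ennreal (r powr (s - 1)) * ennreal (indicator {0..} t * (t powr (s - 1) * exp (- (r * t)))) \<partial>lborel)"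
    using r by (intro arg_cong2[where f = "(*)"] nn_integral_cong refl)
      (auto simp: indicator_def powr_mult exp_minus divide_inverse zero_le_mult_iff mult_ac simp flip: ennreal_mult)
  also have "\<dots> = ennreal (r powr s) * (\<integral>\<^sup>+t. ennreal (indicator {0..} t * (t powr (s - 1) * exp (- (r * t)))) \<partial>lborel)"
    using r by (subst nn_integral_cmult) (auto simp: mult.assoc[symmetric] powr_mult_base simp flip: ennreal_mult)
  finally have *: "ennreal (Gamma s) = ennreal (r powr s) * (\<integral>\<^sup>+t. ennreal (indicator {0..} t * (t powr (s - 1) * exp (- (r * t)))) \<partial>lborel)" (is "_ = _ * ?I") .
  have "ennreal (Gamma s / r powr s) = ennreal (1 / r powr s) * ennreal (Gamma s)"
    using r s by (simp flip: ennreal_mult add: Gamma_real_pos less_imp_le)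
  also have "\<dots> = ennreal (1 / r powr s * r powr s) * ?I"
    unfolding * using r by (subst ennreal_mult) (auto simp: mult.assoc)
  also have "\<dots> = ?I" using r by simp
  finally show ?thesis ..
qed

text \<open>The scaling (rate 2 instead of 1) turns the Hamiltonian into multiplication by \<open>t\<close>
  instead of \<open>t / 2\<close>.\<close>

definition gamma_measure :: "real \<Rightarrow> real measure" where
  "gamma_measure c = density lborel
     (\<lambda>t. ennreal (2 powr c / Gamma c * (indicator {0..} t * (t powr (c - 1) * exp (- (2 * t))))))"

lemma sets_gamma_measure [simp, measurable_cong]: "sets (gamma_measure c) = sets borel"
  by (simp add: gamma_measure_def)

lemma space_gamma_measure [simp]: "space (gamma_measure c) = UNIV"
  by (simp add: gamma_measure_def)

lemma AE_gamma_measure_nonneg: "AE t in gamma_measure c. 0 \<le> t"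
  unfolding gamma_measure_def by (subst AE_density) (auto simp: indicator_def)

text \<open>One formula for two uses: \<open>u = 0\<close> gives the moments, \<open>u = 1\<close>
  the exponential moments with and without the weight \<open>1 + t\<^sup>2\<close>. The restriction
  on \<open>u\<close> is the rate 2 of the density.\<close>

lemma nn_integral_gamma_measure:
  assumes c: "c > 0" and u: "u < 2"
  shows "(\<integral>\<^sup>+t. ennreal (\<bar>t\<bar> ^ k * exp (u * t)) \<partial>gamma_measure c)
    = ennreal (2 powr c / Gamma c * (Gamma (c + k) / (2 - u) powr (c + k)))"
proof -
  have G: "Gamma c > 0" using c by (rule Gamma_real_pos)
  have "(\<integral>\<^sup>+t. ennreal (\<bar>t\<bar> ^ k * exp (u * t)) \<partial>gamma_measure c)
      = (\<integral>\<^sup>+t. ennreal (2 powr c / Gamma c) * ennreal (indicator {0..} t * (t powr (c + k - 1) * exp (- ((2 - u) * t)))) \<partial>lborel)"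
    unfolding gamma_measure_def
  proof (subst nn_integral_density, (measurable)[2], intro nn_integral_cong_AE)
    show "AE t in lborel. ennreal (2 powr c / Gamma c * (indicator {0..} t * (t powr (c - 1) * exp (- (2 * t))))) * ennreal (\<bar>t\<bar> ^ k * exp (u * t))
        = ennreal (2 powr c / Gamma c) * ennreal (indicator {0..} t * (t powr (c + k - 1) * exp (- ((2 - u) * t))))"
      \<comment> \<open>Discarding the null set \<open>{0}\<close> leaves \<open>t > 0\<close> on
        the half-line, where the laws of \<open>powr\<close> and natural powers combine.\<close>
      using AE_lborel_singleton[of 0]
    proof eventually_elim
      case (elim t)
      have "t powr (c - 1) * exp (- (2 * t)) * (\<bar>t\<bar> ^ k * exp (u * t)) = t powr (c + k - 1) * exp (- ((2 - u) * t))" if "t > 0"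
      proof -
        have "t powr (c + k - 1) = t powr (c - 1) * t ^ k"
          using that by (simp add: powr_realpow[symmetric] powr_add[symmetric] algebra_simps)
        moreover have "exp (- ((2 - u) * t)) = exp (- (2 * t)) * exp (u * t)"
          by (simp add: exp_add[symmetric] algebra_simps)
        ultimately show ?thesis using that by (simp add: mult_ac)
      qed
      then show ?case
        using G elim by (auto simp: indicator_def mult.assoc simp flip: ennreal_mult)
    qed
  qed
  also have "\<dots> = ennreal (2 powr c / Gamma c) * ennreal (Gamma (c + k) / (2 - u) powr (c + k))"
    using c u nn_integral_gamma[of "c + k" "2 - u"] by (subst nn_integral_cmult) auto
  also have "\<dots> = ennreal (2 powr c / Gamma c * (Gamma (c + k) / (2 - u) powr (c + k)))"
    using G c by (intro ennreal_mult[symmetric]) (auto intro!: divide_nonneg_nonneg less_imp_le[OF Gamma_real_pos])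
  finally show ?thesis .
qed

lemma integrable_gamma_measure:
  assumes c: "c > 0" and u: "u < 2"
  shows "integrable (gamma_measure c) (\<lambda>t. t ^ k * exp (u * t))"
proof (rule integrableI_bounded)
  show "(\<integral>\<^sup>+t. ennreal (norm (t ^ k * exp (u * t))) \<partial>gamma_measure c) < \<infinity>"
    using nn_integral_gamma_measure[OF c u, of k] by (simp add: abs_mult power_abs)
qed measurable

lemma moment_gamma_measure:
  assumes c: "c > 0"
  shows "(LINT t|gamma_measure c. (2 * t) ^ k) = pochhammer c k"
proof -
  have G: "Gamma c > 0" using c by (rule Gamma_real_pos)
  have i: "integrable (gamma_measure c) (\<lambda>t. t ^ k)"
    using integrable_gamma_measure[OF c, of 0 k] by simp
  have "(LINT t|gamma_measure c. t ^ k) = Gamma (c + k) / Gamma c / 2 ^ k"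
  proof (rule integral_eq_nn_integral[THEN trans])
    show "AE t in gamma_measure c. 0 \<le> t ^ k" using AE_gamma_measure_nonneg by eventually_elim simp
    have "(\<integral>\<^sup>+t. ennreal (t ^ k) \<partial>gamma_measure c) = (\<integral>\<^sup>+t. ennreal (\<bar>t\<bar> ^ k * exp (0 * t)) \<partial>gamma_measure c)"
    proof (rule nn_integral_cong_AE)
      show "AE t in gamma_measure c. ennreal (t ^ k) = ennreal (\<bar>t\<bar> ^ k * exp (0 * t))"
        using AE_gamma_measure_nonneg[of c] by eventually_elim simp
    qed
    also have "\<dots> = ennreal (2 powr c / Gamma c * (Gamma (c + k) / (2 - 0) powr (c + k)))"
      by (rule nn_integral_gamma_measure) (use c in auto)
    also have "2 powr c / Gamma c * (Gamma (c + k) / (2 - 0) powr (c + k)) = Gamma (c + k) / Gamma c / 2 ^ k"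
      by (simp add: powr_add powr_realpow)
    finally show "enn2real (\<integral>\<^sup>+t. ennreal (t ^ k) \<partial>gamma_measure c) = Gamma (c + k) / Gamma c / 2 ^ k"
      using c by (simp add: Gamma_real_pos less_imp_le)
  qed (use i in auto)
  then have "(LINT t|gamma_measure c. (2 * t) ^ k) = Gamma (c + k) / Gamma c"
    by (simp add: power_mult_distrib)
  also have "\<dots> = pochhammer c k"
    using c by (intro pochhammer_Gamma[symmetric]) (auto elim!: nonpos_Ints_cases)
  finally show ?thesis .
qed

lemma finite_measure_gamma_measure:
  assumes "c > 0"
  shows "finite_measure (gamma_measure c)"
proof
  have "emeasure (gamma_measure c) (space (gamma_measure c)) = (\<integral>\<^sup>+t. ennreal (\<bar>t\<bar> ^ 0 * exp (0 * t)) \<partial>gamma_measure c)"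
    by simp
  also have "\<dots> = ennreal (2 powr c / Gamma c * (Gamma (c + real 0) / (2 - 0) powr (c + real 0)))"
    by (rule nn_integral_gamma_measure) (use assms in auto)
  finally show "emeasure (gamma_measure c) (space (gamma_measure c)) \<noteq> \<infinity>" by simp
qed

text \<open>The density is strictly positive on the interval, so a null set there would be
  Lebesgue-null. This is the full-support condition behind the spectrum.\<close>

lemma emeasure_gamma_measure_interval:
  assumes c: "c > 0" and l: "l \<ge> 0" and e: "e > 0"
  shows "emeasure (gamma_measure c) {l<..<l + e} \<noteq> 0"
proof
  assume "emeasure (gamma_measure c) {l<..<l + e} = 0"
  then have "AE t in gamma_measure c. t \<notin> {l<..<l + e}"
    by (intro AE_not_in) (simp add: null_sets_def)
  then have "AE t in lborel. t \<notin> {l<..<l + e}"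
    unfolding gamma_measure_def
    by (subst (asm) AE_density) (use l c Gamma_real_pos[OF c] in \<open>auto elim!: eventually_mono\<close>)
  then have "emeasure lborel {l<..<l + e} = 0"
    by (subst (asm) AE_iff_measurable[of "{l<..<l + e}"]) auto
  with e show False by simp
qed

lemma exp_moment_gamma_measure: "c > 0 \<Longrightarrow> exp_moment_measure (gamma_measure c) 1"
  using integrable_gamma_measure[of c 1 0]
  by (intro exp_moment_measure.intro exp_moment_measure_axioms.intro finite_measure_gamma_measure
      AE_gamma_measure_nonneg) auto

lemma exp_moment_weighted_gamma_measure:
  assumes c: "c > 0"
  shows "exp_moment_measure (density (gamma_measure c) (\<lambda>t. ennreal (1 + t\<^sup>2))) 1" (is "exp_moment_measure ?N 1")
proof (intro exp_moment_measure.intro exp_moment_measure_axioms.intro)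
  have "integrable (gamma_measure c) (\<lambda>t. (1 + t\<^sup>2) * exp (u * t))" if "u < 2" for u
    using integrable_gamma_measure[OF c that, of 0] integrable_gamma_measure[OF c that, of 2]
    by (simp add: distrib_right)
  then have i: "integrable ?N (\<lambda>t. exp (u * t))" if "u < 2" for u
    using that by (subst integrable_density) auto
  show "integrable ?N (\<lambda>t. exp (1 * t))" by (rule i) simp
  have "integrable ?N (\<lambda>t. 1 :: real)" using i[of 0] by simp
  then have "emeasure ?N (space ?N) < \<infinity>" unfolding integrable_iff_bounded by simp
  then show "finite_measure ?N" by (intro finite_measureI) auto
  show "AE t in ?N. 0 \<le> t"
    using AE_gamma_measure_nonneg[of c] by (subst AE_density) auto
qed auto

section \<open>Laguerre polynomials and their three-term recurrence\<close>

text \<open>This is \<open>n! / pochhammer c n\<close> times the classical Laguerre polynomial of index \<open>c - 1\<close>,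
  evaluated at \<open>2 * t\<close>.\<close>

definition laguerre :: "real \<Rightarrow> nat \<Rightarrow> real \<Rightarrow> real" where
  "laguerre c n t = (\<Sum>k\<le>n. real (n choose k) / pochhammer c k * (- (2 * t)) ^ k)"

lemma laguerre_extend:
  assumes "n \<le> m"
  shows "laguerre c n t = (\<Sum>k\<le>m. real (n choose k) / pochhammer c k * (- (2 * t)) ^ k)"
  unfolding laguerre_def by (rule sum.mono_neutral_left) (use assms in auto)

text \<open>Comparison of coefficients in powers of \<open>- (2 * t)\<close>. The constant terms
  cancel because \<open>(2 * n + c) - (n + c) - n = 0\<close>; the others reduce to absorption and
  Pascal's rule for binomial coefficients. For \<open>n = 0\<close> the factor \<open>n\<close>
  removes the term with the truncated index \<open>n - 1\<close>.\<close>

lemma laguerre_recurrence: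
  assumes c: "c > 0"
  shows "2 * t * laguerre c n t =
    (2 * n + c) * laguerre c n t - (n + c) * laguerre c (Suc n) t - n * laguerre c (n - 1) t"
proof -
  define y where "y = - (2 * t)"
  define f where "f m k = real (m choose k) / pochhammer c k * y ^ k" for m k
  have eq: "y * f n k + ((2 * n + c) * f n (Suc k) - (n + c) * f (Suc n) (Suc k) - n * f (n - 1) (Suc k)) = 0" for k
  proof -
    have P: "pochhammer c k > 0" "c + k > 0" using c by (auto intro: pochhammer_pos)
    have "(n - k) * (n choose k) = n * ((n - 1) choose k)" by (rule binomial_absorb_comp)
    then have "real ((n - k) * (n choose k)) = real (n * ((n - 1) choose k))" by simp
    moreover have "real ((n - k) * (n choose k)) = (real n - real k) * real (n choose k)"
      by (cases "k \<le> n") (auto simp: of_nat_diff)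
    ultimately have b1: "(real n - real k) * real (n choose k) = real n * real ((n - 1) choose k)" by simp
    have b2: "real n * real (n choose Suc k) = real n * real ((n - 1) choose k) + real n * real ((n - 1) choose Suc k)"
      by (cases n) (auto simp: distrib_left)
    have "(c + k) * real (n choose k) + (2 * n + c) * real (n choose Suc k)
        - (n + c) * real (Suc n choose Suc k) - n * real ((n - 1) choose Suc k) = 0"
      using b1 b2 by (simp add: algebra_simps)
    moreover have "y * f n k + ((2 * n + c) * f n (Suc k) - (n + c) * f (Suc n) (Suc k) - n * f (n - 1) (Suc k))
      = y ^ Suc k / (pochhammer c k * (c + k)) * ((c + k) * real (n choose k) + (2 * n + c) * real (n choose Suc k)
        - (n + c) * real (Suc n choose Suc k) - n * real ((n - 1) choose Suc k))"
    proof -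
      \<comment> \<open>The common factor of all four terms, by
        \<open>pochhammer c (Suc k) = pochhammer c k * (c + k)\<close>.\<close>
      define W where "W = y ^ Suc k / (pochhammer c k * (c + k))"
      have "y * f n k = W * ((c + k) * real (n choose k))" using P by (simp add: f_def W_def)
      moreover have "f m (Suc k) = W * real (m choose Suc k)" for m
        by (simp add: f_def W_def pochhammer_Suc)
      ultimately show ?thesis unfolding W_def[symmetric] by (simp add: algebra_simps)
    qed
    ultimately show ?thesis by simp
  qed
  have "y * laguerre c n t = (\<Sum>k\<le>n. y * f n k)"
    by (simp add: laguerre_def f_def y_def sum_distrib_left)
  moreover have "laguerre c m t = f m 0 + (\<Sum>k\<le>n. f m (Suc k))" if "m \<le> Suc n" for m
    unfolding laguerre_extend[OF that] f_def y_def sum.atMost_Suc_shift ..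
  moreover have "f m 0 = 1" for m by (simp add: f_def)
  ultimately have "y * laguerre c n t + ((2 * n + c) * laguerre c n t - (n + c) * laguerre c (Suc n) t - n * laguerre c (n - 1) t)
      = (\<Sum>k\<le>n. y * f n k + ((2 * n + c) * f n (Suc k) - (n + c) * f (Suc n) (Suc k) - n * f (n - 1) (Suc k)))"
    by (simp add: sum.distrib sum_subtractf sum_distrib_left algebra_simps)
  also have "\<dots> = 0" unfolding eq by simp
  finally show ?thesis by (simp add: y_def algebra_simps)
qed

text \<open>The factor gives unit norm for \<open>gamma_measure c\<close>; its successive ratio
  \<open>sqrt ((n + c) / (n + 1))\<close> is also what symmetrizes the recurrence.\<close>

definition laguerre_normalized :: "real \<Rightarrow> nat \<Rightarrow> real \<Rightarrow> real" where
  "laguerre_normalized c n t = sqrt (pochhammer c n / fact n) * laguerre c n t"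

text \<open>The geometric mean of the two neighbour coefficients that
  \<open>laguerre_recurrence\<close> yields for multiplication by \<open>t\<close>:
  \<open>(n + c) / 2\<close> from index \<open>n\<close> up and \<open>(n + 1) / 2\<close> from
  index \<open>n + 1\<close> back down. It is the absolute value of the matrix entry, which is
  negative.\<close>

definition jacobi_offdiag :: "real \<Rightarrow> nat \<Rightarrow> real" where
  "jacobi_offdiag c n = sqrt ((n + 1) * (n + c)) / 2"

lemma jacobi_offdiag_pos: "c > 0 \<Longrightarrow> jacobi_offdiag c n > 0"
  by (simp add: jacobi_offdiag_def add_nonneg_pos)

lemma laguerre_normalized_zero [simp]: "laguerre_normalized c 0 t = 1"
  by (simp add: laguerre_normalized_def laguerre_def)

lemma laguerre_normalized_recurrence:
  assumes c: "c > 0"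
  shows "t * laguerre_normalized c n t = (n + c / 2) * laguerre_normalized c n t
    - jacobi_offdiag c n * laguerre_normalized c (Suc n) t
    - (if n = 0 then 0 else jacobi_offdiag c (n - 1) * laguerre_normalized c (n - 1) t)"
proof -
  define N where "N m = sqrt (pochhammer c m / fact m)" for m
  have N_Suc: "N (Suc m) = N m * (sqrt (m + c) / sqrt (m + 1))" for m
    unfolding N_def by (simp add: pochhammer_Suc real_sqrt_mult real_sqrt_divide add.commute)
  have off: "jacobi_offdiag c m = sqrt (m + 1) * sqrt (m + c) / 2" for m
    by (simp add: jacobi_offdiag_def real_sqrt_mult)
  have sq: "sqrt (real m + 1) > 0" "sqrt (real m + 1) * sqrt (real m + 1) = real m + 1"
    "sqrt (real m + c) * sqrt (real m + c) = real m + c" for m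
    using c by (auto simp: add_nonneg_pos)
  \<comment> \<open>\<open>up\<close> and \<open>down\<close> trade the unequal coefficients of the
    raw recurrence for the common one, using the ratio of consecutive normalization factors.\<close>
  have up: "jacobi_offdiag c m * N (Suc m) = (m + c) * N m / 2" for m
  proof -
    have "jacobi_offdiag c m * N (Suc m) = (sqrt (m + c) * sqrt (m + c)) * N m / 2"
      unfolding off N_Suc using sq(1)[of m] by simp
    then show ?thesis unfolding sq .
  qed
  have down: "jacobi_offdiag c m * N m = (real m + 1) * N (Suc m) / 2" for m
  proof -
    have "(real m + 1) * N (Suc m) / 2 = (sqrt (real m + 1) * sqrt (real m + 1)) * N (Suc m) / 2" unfolding sq ..
    also have "\<dots> = jacobi_offdiag c m * N m"
    proof -
      have "(A * A) * (X * (B / A)) / 2 = A * B / 2 * X" if "A > 0" for A B X :: real using that by simp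
      from this[OF sq(1)] show ?thesis unfolding off N_Suc .
    qed
    finally show ?thesis ..
  qed
  have "t * laguerre_normalized c n t = N n / 2 * (2 * t * laguerre c n t)"
    by (simp add: laguerre_normalized_def N_def)
  also have "\<dots> = (n + c / 2) * (N n * laguerre c n t) - ((n + c) * N n / 2) * laguerre c (Suc n) t
      - (n * N n / 2) * laguerre c (n - 1) t"
    unfolding laguerre_recurrence[OF c] by (simp add: field_simps)
  also have "(n + c) * N n / 2 = jacobi_offdiag c n * N (Suc n)" by (simp add: up)
  also have "n * N n / 2 = (if n = 0 then 0 else jacobi_offdiag c (n - 1) * N (n - 1))"
    using down[of "n - 1"] by (cases n) (auto simp: add.commute)
  finally show ?thesis by (auto simp: laguerre_normalized_def N_def mult.assoc)
qed

section \<open>Polynomials as combinations of Laguerre functions\<close>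

definition laguerre_fun :: "real \<Rightarrow> nat \<Rightarrow> real \<Rightarrow> complex" where
  "laguerre_fun c n t = of_real (laguerre_normalized c n t)"

lemma laguerre_fun_recurrence:
  assumes "c > 0"
  shows "of_real t * laguerre_fun c n t = of_real (n + c / 2) * laguerre_fun c n t
    - of_real (jacobi_offdiag c n) * laguerre_fun c (Suc n) t
    - of_real (if n = 0 then 0 else jacobi_offdiag c (n - 1)) * laguerre_fun c (n - 1) t"
  unfolding laguerre_fun_def of_real_mult[symmetric] laguerre_normalized_recurrence[OF assms]
  by simp

lemma laguerre_fun_poly: "laguerre_fun c n \<in> poly_functions"
proof -
  have "laguerre_fun c n t = poly (\<Sum>k\<le>n. monom (of_real (sqrt (pochhammer c n / fact n)
      * (real (n choose k) / pochhammer c k * (- 2) ^ k))) k) (of_real t)" for t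
    by (simp add: laguerre_fun_def laguerre_normalized_def laguerre_def poly_sum poly_monom sum_distrib_left
        power_mult_distrib[symmetric] mult.assoc)
  then show ?thesis unfolding poly_functions_def by (intro range_eqI) (rule ext)
qed

text \<open>Adding one term at a time, with indices in any order and repeated, makes stability under
  multiplication by \<open>t\<close> a plain induction; coefficients are collected only in
  \<open>laguerre_span_sum\<close>.\<close>

inductive_set laguerre_span :: "real \<Rightarrow> (real \<Rightarrow> complex) set" for c where
  zero: "(\<lambda>t. 0) \<in> laguerre_span c"
| add: "f \<in> laguerre_span c \<Longrightarrow> (\<lambda>t. f t + a * laguerre_fun c n t) \<in> laguerre_span c"

lemma laguerre_span_add: "g \<in> laguerre_span c \<Longrightarrow> f \<in> laguerre_span c \<Longrightarrow> (\<lambda>t. f t + g t) \<in> laguerre_span c"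
  by (induction g rule: laguerre_span.induct) (auto simp: add.assoc[symmetric] intro: laguerre_span.add)

lemma laguerre_span_base: "(\<lambda>t. a * laguerre_fun c n t) \<in> laguerre_span c"
  using laguerre_span.add[OF laguerre_span.zero] by simp

lemma laguerre_span_mult:
  assumes c: "c > 0" and f: "f \<in> laguerre_span c"
  shows "(\<lambda>t. of_real t * f t) \<in> laguerre_span c"
  using f
proof (induction f rule: laguerre_span.induct)
  case (add f a n)
  have "(\<lambda>t. a * of_real (n + c / 2) * laguerre_fun c n t
      + (- a * of_real (jacobi_offdiag c n) * laguerre_fun c (Suc n) t
      + - a * of_real (if n = 0 then 0 else jacobi_offdiag c (n - 1)) * laguerre_fun c (n - 1) t)) \<in> laguerre_span c"
    by (intro laguerre_span_add laguerre_span_base)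
  moreover have "of_real t * (a * laguerre_fun c n t) = a * of_real (n + c / 2) * laguerre_fun c n t
      + (- a * of_real (jacobi_offdiag c n) * laguerre_fun c (Suc n) t
      + - a * of_real (if n = 0 then 0 else jacobi_offdiag c (n - 1)) * laguerre_fun c (n - 1) t)" for t
    unfolding mult.left_commute[of _ a] laguerre_fun_recurrence[OF c] by (simp add: algebra_simps)
  ultimately have "(\<lambda>t. of_real t * (a * laguerre_fun c n t)) \<in> laguerre_span c" by simp
  from laguerre_span_add[OF this add.IH] show ?case by (simp add: distrib_left)
qed (auto intro: laguerre_span.zero)

text \<open>The span contains \<open>laguerre_fun c 0 = 1\<close> and is stable under multiplication
  by \<open>t\<close>, so Horner's scheme stays inside it.\<close>

lemma poly_in_laguerre_span:
  assumes c: "c > 0"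
  shows "(\<lambda>t. poly q (of_real t)) \<in> laguerre_span c"
proof (induction q)
  case 0
  show ?case using laguerre_span.zero by simp
next
  case (pCons a q)
  have "(\<lambda>t. a * laguerre_fun c 0 t + of_real t * poly q (of_real t)) \<in> laguerre_span c"
    by (intro laguerre_span_add laguerre_span_base laguerre_span_mult c pCons.IH)
  then show ?case by (simp add: laguerre_fun_def)
qed

lemma laguerre_span_sum:
  assumes "f \<in> laguerre_span c"
  shows "\<exists>N a. f = (\<lambda>t. \<Sum>n<N. a n * laguerre_fun c n t)"
  using assms
proof (induction f rule: laguerre_span.induct)
  case zero
  show ?case by (intro exI[of _ 0]) simp
next
  case (add f b m)
  then obtain N a where f: "f = (\<lambda>t. \<Sum>n<N. a n * laguerre_fun c n t)" by blast
  define a' where "a' n = (if n < N then a n else 0) + (if n = m then b else 0)" for n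
  have "(\<Sum>n<max N (Suc m). a' n * laguerre_fun c n t) = f t + b * laguerre_fun c m t" for t
  proof -
    have "(\<Sum>n<max N (Suc m). a' n * laguerre_fun c n t)
        = (\<Sum>n<max N (Suc m). if n < N then a n * laguerre_fun c n t else 0)
          + (\<Sum>n<max N (Suc m). if n = m then b * laguerre_fun c n t else 0)"
      unfolding a'_def sum.distrib[symmetric] by (intro sum.cong) (auto simp: algebra_simps)
    also have "(\<Sum>n<max N (Suc m). if n < N then a n * laguerre_fun c n t else 0) = f t"
      unfolding f by (rule sum.mono_neutral_cong_right) auto
    also have "(\<Sum>n<max N (Suc m). if n = m then b * laguerre_fun c n t else 0) = b * laguerre_fun c m t"
      by simp
    finally show ?thesis .
  qed
  then show ?case by (intro exI[of _ "max N (Suc m)"] exI[of _ a']) auto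
qed

lemma poly_functions_sum:
  assumes "c > 0" "f \<in> poly_functions"
  shows "\<exists>N a. f = (\<lambda>t. \<Sum>n<N. a n * laguerre_fun c n t)"
  using poly_in_laguerre_span[OF assms(1)] assms(2) laguerre_span_sum by (auto simp: poly_functions_def)

section \<open>Orthonormality and completeness of the Laguerre functions\<close>

context
  fixes c :: real
  assumes c: "c > 0"
begin

interpretation exp_moment_measure "gamma_measure c" 1
  by (rule exp_moment_gamma_measure[OF c])

lemma laguerre_fun_sq: "laguerre_fun c n \<in> sq_integrable (gamma_measure c)"
  using laguerre_fun_poly polys.P_subset by blast

lemma mult_laguerre_fun_sq: "(\<lambda>t. of_real t * laguerre_fun c n t) \<in> sq_integrable (gamma_measure c)"
  unfolding laguerre_fun_recurrence[OF c]
  by (intro sq_integrable_diff sq_integrable_cmult laguerre_fun_sq)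

text \<open>The moments of \<open>2 * t\<close> are the \<open>pochhammer\<close> symbols in the
  denominators of the coefficients, so only an alternating sum of binomial coefficients remains.
  This is the first row of the Gram matrix, up to normalization.\<close>

lemma integral_laguerre: "(LINT t|gamma_measure c. laguerre c n t) = (if n = 0 then 1 else 0)"
proof -
  have i: "integrable (gamma_measure c) (\<lambda>t. t ^ k)" for k
    using integrable_gamma_measure[OF c, of 0 k] by simp
  have "(LINT t|gamma_measure c. laguerre c n t)
      = (LINT t|gamma_measure c. (\<Sum>k\<le>n. real (n choose k) / pochhammer c k * (- 1) ^ k * (2 * t) ^ k))"
    unfolding laguerre_def
    by (intro Bochner_Integration.integral_cong sum.cong refl) (simp only: power_minus[of "2 * _"] mult.assoc)
  also have "\<dots> = (\<Sum>k\<le>n. real (n choose k) / pochhammer c k * (- 1) ^ k * (LINT t|gamma_measure c. (2 * t) ^ k))"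
    using i by (subst Bochner_Integration.integral_sum) (auto simp: power_mult_distrib)
  also have "\<dots> = (\<Sum>k\<le>n. (- 1) ^ k * real (n choose k))"
    unfolding moment_gamma_measure[OF c] using pochhammer_pos[OF c]
    by (intro sum.cong refl) (simp add: less_imp_neq[symmetric])
  also have "\<dots> = (if n = 0 then 1 else 0)"
    using choose_alternating_sum[of n, where 'a = real] by (cases "n = 0") auto
  finally show ?thesis .
qed

text \<open>Multiplication by \<open>t\<close> is symmetric, so the Gram matrix commutes with the Jacobi matrix of the
  recurrence; hence its first row determines it.\<close>

lemma laguerre_fun_orth:
  "sq_inner (gamma_measure c) (laguerre_fun c m) (laguerre_fun c n) = (if m = n then 1 else 0)"
proof -
  let ?p = "laguerre_fun c"
  let ?g = "jacobi_offdiag c"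
  define G where "G m n = sq_inner (gamma_measure c) (?p m) (?p n)" for m n
  have cnj: "cnj (?p n t) = ?p n t" for n t by (simp add: laguerre_fun_def)
  have G_sym: "G m n = G n m" for m n by (simp add: G_def sq_inner_def cnj mult.commute)
  have J: "sq_inner (gamma_measure c) (?p m) (\<lambda>t. of_real t * ?p n t)
      = of_real (n + c / 2) * G m n - of_real (?g n) * G m (Suc n)
        - of_real (if n = 0 then 0 else ?g (n - 1)) * G m (n - 1)" for m n
    unfolding laguerre_fun_recurrence[OF c] G_def
    by (simp only: sq_inner_diff_right sq_inner_cmult_right sq_integrable_diff sq_integrable_cmult laguerre_fun_sq)
  have "sq_inner (gamma_measure c) (?p m) (\<lambda>t. of_real t * ?p n t)
      = sq_inner (gamma_measure c) (?p n) (\<lambda>t. of_real t * ?p m t)" for m n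
    by (simp add: sq_inner_def cnj mult_ac)
  then have step: "of_real (?g m) * G n (Suc m) = of_real (m + c / 2) * G n m
        - of_real (if m = 0 then 0 else ?g (m - 1)) * G n (m - 1)
        - (of_real (n + c / 2) * G m n - of_real (?g n) * G m (Suc n)
        - of_real (if n = 0 then 0 else ?g (n - 1)) * G m (n - 1))" for m n
    unfolding J[of m n, symmetric] using J[of n m] by (simp add: algebra_simps)
  \<comment> \<open>All rows up to \<open>m\<close> are carried along because \<open>step\<close>
    expresses row \<open>m + 1\<close> through rows \<open>m\<close> and \<open>m - 1\<close>;
    dividing by the positive off-diagonal entry then determines it.\<close>
  have "\<forall>k\<le>m. \<forall>n. G k n = (if k = n then 1 else 0)" for m
  proof (induction m)
    case 0
    have "G 0 n = of_real (sqrt (pochhammer c n / fact n) * (LINT t|gamma_measure c. laguerre c n t))" for n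
      by (simp add: G_def sq_inner_def laguerre_fun_def laguerre_normalized_def[of c n] del: of_real_mult)
    then show ?case unfolding integral_laguerre by auto
  next
    case (Suc m)
    have "G (Suc m) n = (if Suc m = n then 1 else 0)" for n
    proof -
      have IH: "G k l = (if k = l then 1 else 0)" "G l k = (if k = l then 1 else 0)" if "k \<le> m" for k l
        using Suc that G_sym[of l k] by auto
      have "of_real (?g m) * G n (Suc m) = of_real (?g m) * (if Suc m = n then 1 else 0)"
        unfolding step[of m n] IH(1)[OF order_refl] IH(2)[OF order_refl] IH(2)[OF diff_le_self]
        by (auto simp: of_nat_diff)
      then show ?thesis using jacobi_offdiag_pos[OF c, of m] G_sym by auto
    qed
    then show ?case using Suc by (auto simp: le_Suc_eq)
  qed
  then show ?thesis unfolding G_def by blast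
qed

lemma laguerre_orthonormal_basis: "sq_orthonormal_basis (gamma_measure c) (laguerre_fun c)"
proof
  fix f :: "real \<Rightarrow> complex" and e :: real
  assume "f \<in> sq_integrable (gamma_measure c)" "e > 0"
  then obtain p where "p \<in> poly_functions" "sq_dist (gamma_measure c) f p < e"
    using polynomials_dense unfolding sq_closure_def by blast
  then show "\<exists>N a. sq_dist (gamma_measure c) f (\<lambda>t. \<Sum>n<N. a n * laguerre_fun c n t) < e"
    using poly_functions_sum[OF c] by metis
qed (rule laguerre_fun_sq laguerre_fun_orth)+

end

section \<open>Orthogonal sums of self-adjoint operators\<close>

definition oper_sum :: "oper \<Rightarrow> oper \<Rightarrow> oper" where
  "oper_sum A B = {(x + x', y + y') |x y x' y'. (x, y) \<in> A \<and> (x', y') \<in> B}"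

lemma oper_sumI: "(x, y) \<in> A \<Longrightarrow> (x', y') \<in> B \<Longrightarrow> (x + x', y + y') \<in> oper_sum A B"
  by (auto simp: oper_sum_def)

lemma oper_sumE:
  assumes "(x, y) \<in> oper_sum A B"
  obtains x0 y0 x1 y1 where "(x0, y0) \<in> A" "(x1, y1) \<in> B" "x = x0 + x1" "y = y0 + y1"
  using assms unfolding oper_sum_def by blast

lemma oper_sum_commute: "oper_sum A B = oper_sum B A"
  by (auto simp: oper_sum_def) (metis add.commute)+

text \<open>An adjoint is cut out by continuous equations, hence closed. A sum that is its own
  adjoint is therefore a closed operator, which can absorb a closure.\<close>

lemma closed_adjoint:
  assumes "closed K"
  shows "closed (adjoint_in K A)"
proof -
  have "adjoint_in K A = (K \<times> K) \<inter> (\<Inter>(x, w)\<in>A. {yz. cinner w (fst yz) = cinner x (snd yz)})"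
    by (auto simp: adjoint_in_def)
  moreover have "closed {yz. cinner w (fst yz) = cinner x (snd yz)}" for x w
    by (intro closed_Collect_eq continuous_intros)
  ultimately show ?thesis using assms by (auto intro!: closed_Int closed_INT closed_Times)
qed

lemma cinner_zero_left [simp]: "cinner 0 y = 0"
  by (simp add: cinner_def)

lemma cinner_zero_right [simp]: "cinner x 0 = 0"
  by (simp add: cinner_def)

locale orthogonal_pair =
  fixes W0 W1 :: "ell2 set" and A0 A1 :: oper
  assumes subspace0: "cvec.subspace W0" and subspace1: "cvec.subspace W1"
    and orth: "x \<in> W0 \<Longrightarrow> y \<in> W1 \<Longrightarrow> cinner x y = 0"
    and decomp: "\<exists>x\<in>W0. \<exists>y\<in>W1. v = x + y"
    and self_adjoint0: "self_adjoint_in W0 A0" and self_adjoint1: "self_adjoint_in W1 A1"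
begin

lemma orth': "x \<in> W0 \<Longrightarrow> y \<in> W1 \<Longrightarrow> cinner y x = 0"
  using orth[of x y] cinner_commute[of x y] by (metis complex_cnj_zero_iff)

lemma sub0: "(x, y) \<in> A0 \<Longrightarrow> x \<in> W0 \<and> y \<in> W0"
  and sub1: "(x, y) \<in> A1 \<Longrightarrow> x \<in> W1 \<and> y \<in> W1"
  using self_adjoint0 self_adjoint1 unfolding self_adjoint_in_def by auto

text \<open>Operators are bare sets of pairs, so membership of the zero pair is read off from the
  adjoint. It lets each summand be embedded in the sum.\<close>

lemma zero0: "(0, 0) \<in> A0"
proof -
  have "(0, 0) \<in> adjoint_in W0 A0"
    using cvec.subspace_0[OF subspace0] by (auto simp: adjoint_in_def)
  then show ?thesis using self_adjoint0 by (simp add: self_adjoint_in_def)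
qed

lemma zero1: "(0, 0) \<in> A1"
proof -
  have "(0, 0) \<in> adjoint_in W1 A1"
    using cvec.subspace_0[OF subspace1] by (auto simp: adjoint_in_def)
  then show ?thesis using self_adjoint1 by (simp add: self_adjoint_in_def)
qed

text \<open>The difference of the first components lies in both subspaces and is thus orthogonal to
  itself.\<close>

lemma unique:
  assumes "x0 + x1 = y0 + y1" "x0 \<in> W0" "y0 \<in> W0" "x1 \<in> W1" "y1 \<in> W1"
  shows "x0 = y0" "x1 = y1"
proof -
  have eq: "x0 - y0 = y1 - x1" using assms(1) by (simp add: algebra_simps)
  have "x0 - y0 \<in> W0" using assms cvec.subspace_diff[OF subspace0] by blast
  moreover have "y1 - x1 \<in> W1" using assms cvec.subspace_diff[OF subspace1] by blast
  ultimately have "cinner (x0 - y0) (x0 - y0) = 0" using orth eq by metis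
  then show "x0 = y0" unfolding cinner_self by simp
  with assms(1) show "x1 = y1" by simp
qed

lemma norm_le0: "x \<in> W0 \<Longrightarrow> y \<in> W1 \<Longrightarrow> norm x \<le> norm (x + y)"
  and norm_le1: "x \<in> W0 \<Longrightarrow> y \<in> W1 \<Longrightarrow> norm y \<le> norm (x + y)"
proof -
  assume "x \<in> W0" "y \<in> W1"
  then have "inner x y = 0" using orth by (simp add: inner_ell2_def)
  then have "(norm (x + y))\<^sup>2 = (norm x)\<^sup>2 + (norm y)\<^sup>2"
    by (simp add: power2_norm_eq_inner inner_add_left inner_add_right inner_commute)
  then have "(norm x)\<^sup>2 \<le> (norm (x + y))\<^sup>2" "(norm y)\<^sup>2 \<le> (norm (x + y))\<^sup>2" by auto
  then show "norm x \<le> norm (x + y)" "norm y \<le> norm (x + y)" by (auto intro: power2_le_imp_le)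
qed

lemma oper_sum_left: "(x, y) \<in> A0 \<Longrightarrow> (x, y) \<in> oper_sum A0 A1"
  using oper_sumI[OF _ zero1] by fastforce

lemma oper_sum_right: "(x, y) \<in> A1 \<Longrightarrow> (x, y) \<in> oper_sum A0 A1"
  using oper_sumI[OF zero0] by fastforce

text \<open>Inner products split along the decomposition. Conversely, testing against pairs from one
  summand alone isolates the components in its subspace, where self-adjointness of that summand
  applies.\<close>

lemma adjoint_oper_sum: "adjoint_in UNIV (oper_sum A0 A1) = oper_sum A0 A1"
proof (rule antisym)
  show "oper_sum A0 A1 \<subseteq> adjoint_in UNIV (oper_sum A0 A1)"
  proof clarify
    fix y z assume "(y, z) \<in> oper_sum A0 A1"
    then obtain y0 z0 y1 z1 where yz: "(y0, z0) \<in> A0" "(y1, z1) \<in> A1" "y = y0 + y1" "z = z0 + z1"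
      by (rule oper_sumE)
    have "cinner w y = cinner x z" if xw: "(x, w) \<in> oper_sum A0 A1" for x w
    proof -
      obtain x0 w0 x1 w1 where xw: "(x0, w0) \<in> A0" "(x1, w1) \<in> A1" "x = x0 + x1" "w = w0 + w1"
        using xw by (rule oper_sumE)
      have "(y0, z0) \<in> adjoint_in W0 A0" "(y1, z1) \<in> adjoint_in W1 A1"
        using yz self_adjoint0 self_adjoint1 by (auto simp: self_adjoint_in_def)
      then have "cinner w0 y0 = cinner x0 z0" "cinner w1 y1 = cinner x1 z1"
        using xw unfolding adjoint_in_def by auto
      then show ?thesis
        using sub0[OF yz(1)] sub1[OF yz(2)] sub0[OF xw(1)] sub1[OF xw(2)]
        by (simp add: yz xw cinner_add_left cinner_add_right orth orth')
    qed
    then show "(y, z) \<in> adjoint_in UNIV (oper_sum A0 A1)" by (auto simp: adjoint_in_def)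
  qed
  show "adjoint_in UNIV (oper_sum A0 A1) \<subseteq> oper_sum A0 A1"
  proof clarify
    fix y z assume yz: "(y, z) \<in> adjoint_in UNIV (oper_sum A0 A1)"
    obtain y0 y1 where y: "y0 \<in> W0" "y1 \<in> W1" "y = y0 + y1" using decomp by blast
    obtain z0 z1 where z: "z0 \<in> W0" "z1 \<in> W1" "z = z0 + z1" using decomp by blast
    have A: "cinner w y = cinner x z" if "(x, w) \<in> oper_sum A0 A1" for x w
      using yz that by (auto simp: adjoint_in_def)
    have "cinner w y0 = cinner x z0" if "(x, w) \<in> A0" for x w
      using A[OF oper_sum_left[OF that]] sub0[OF that] y z by (simp add: cinner_add_right orth)
    then have "(y0, z0) \<in> adjoint_in W0 A0" using y z by (auto simp: adjoint_in_def)
    moreover have "cinner w y1 = cinner x z1" if "(x, w) \<in> A1" for x w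
      using A[OF oper_sum_right[OF that]] sub1[OF that] y z by (simp add: cinner_add_right orth')
    then have "(y1, z1) \<in> adjoint_in W1 A1" using y z by (auto simp: adjoint_in_def)
    ultimately show "(y, z) \<in> oper_sum A0 A1"
      unfolding y z using self_adjoint0 self_adjoint1 by (auto simp: self_adjoint_in_def intro: oper_sumI)
  qed
qed

lemma self_adjoint_oper_sum: "self_adjoint_in UNIV (oper_sum A0 A1)"
  unfolding self_adjoint_in_def
proof (intro conjI)
  show "single_valued (oper_sum A0 A1)"
  proof (rule single_valuedI)
    fix x y z assume y: "(x, y) \<in> oper_sum A0 A1" and z: "(x, z) \<in> oper_sum A0 A1"
    obtain x0 y0 x1 y1 where y: "(x0, y0) \<in> A0" "(x1, y1) \<in> A1" "x = x0 + x1" "y = y0 + y1"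
      using y by (rule oper_sumE)
    obtain x0' z0 x1' z1 where z: "(x0', z0) \<in> A0" "(x1', z1) \<in> A1" "x = x0' + x1'" "z = z0 + z1"
      using z by (rule oper_sumE)
    have "x0 + x1 = x0' + x1'" using y z by simp
    then have "x0 = x0'" "x1 = x1'" using unique sub0 sub1 y z by blast+
    then show "y = z"
      using y z self_adjoint0 self_adjoint1 unfolding self_adjoint_in_def single_valued_def by metis
  qed
  show "UNIV \<subseteq> closure (Domain (oper_sum A0 A1))"
  proof
    fix v
    obtain x y where v: "x \<in> W0" "y \<in> W1" "v = x + y" using decomp by blast
    have "x \<in> closure (Domain A0)" "y \<in> closure (Domain A1)"
      using v self_adjoint0 self_adjoint1 unfolding self_adjoint_in_def by auto
    then obtain f g where f: "\<And>n. f n \<in> Domain A0" "f \<longlonglongrightarrow> x" and g: "\<And>n. g n \<in> Domain A1" "g \<longlonglongrightarrow> y"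
      unfolding closure_sequential by blast
    have "f n + g n \<in> Domain (oper_sum A0 A1)" for n
      using f(1)[of n] g(1)[of n] oper_sumI by fast
    moreover have "(\<lambda>n. f n + g n) \<longlonglongrightarrow> v" unfolding v using f g by (intro tendsto_add)
    ultimately show "v \<in> closure (Domain (oper_sum A0 A1))"
      unfolding closure_sequential by (intro exI[of _ "\<lambda>n. f n + g n"]) auto
  qed
qed (simp_all add: adjoint_oper_sum)

lemma restriction_oper_sum: "restriction (oper_sum A0 A1) W0 = A0"
proof (intro set_eqI iffI; clarify?)
  fix x y assume "(x, y) \<in> restriction (oper_sum A0 A1) W0"
  then have xy: "(x, y) \<in> oper_sum A0 A1" and x: "x \<in> W0" by (auto simp: restriction_def)
  obtain x0 y0 x1 y1 where s: "(x0, y0) \<in> A0" "(x1, y1) \<in> A1" "x = x0 + x1" "y = y0 + y1"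
    using xy by (rule oper_sumE)
  have "x0 + x1 = x + 0" using s by simp
  then have "x1 = 0" "x0 = x"
    using unique[of x0 x1 x 0] sub0[OF s(1)] sub1[OF s(2)] x cvec.subspace_0[OF subspace1] by auto
  moreover have "single_valued A1" using self_adjoint1 by (simp add: self_adjoint_in_def)
  \<comment> \<open>An operator maps 0 only to 0, so the component in \<open>W1\<close> of the image
    disappears with that of the argument.\<close>
  ultimately have "y1 = 0" using s(2) zero1 by (auto dest: single_valuedD)
  then show "(x, y) \<in> A0" using s \<open>x1 = 0\<close> by simp
next
  fix x y assume "(x, y) \<in> A0"
  then show "(x, y) \<in> restriction (oper_sum A0 A1) W0"
    using oper_sum_left sub0 by (auto simp: restriction_def)
qed

lemma preserves_oper_sum: "preserves (oper_sum A0 A1) W0"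
  unfolding preserves_def
proof clarify
  fix x y assume xy: "(x, y) \<in> oper_sum A0 A1"
  obtain x0 y0 x1 y1 where s: "(x0, y0) \<in> A0" "(x1, y1) \<in> A1" "x = x0 + x1" "y = y0 + y1"
    using xy by (rule oper_sumE)
  have "x - x0 \<in> orth_compl W0" "y - y0 \<in> orth_compl W0"
    using s sub1[OF s(2)] by (auto simp: orth_compl_def orth)
  with s sub0[OF s(1)] oper_sum_left
  show "\<exists>(u, v)\<in>oper_sum A0 A1. u \<in> W0 \<and> v \<in> W0 \<and> x - u \<in> orth_compl W0 \<and> y - v \<in> orth_compl W0"
    by (intro bexI[of _ "(x0, y0)"]) auto
qed

section \<open>Resolvent sets of orthogonal sums\<close>

lemma shift_sub0: "(x, y) \<in> shift A0 z \<Longrightarrow> x \<in> W0 \<and> y \<in> W0"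
  using sub0 cvec.subspace_diff[OF subspace0] cvec.subspace_scale[OF subspace0] by (auto simp: shift_def)

lemma shift_sub1: "(x, y) \<in> shift A1 z \<Longrightarrow> x \<in> W1 \<and> y \<in> W1"
  using sub1 cvec.subspace_diff[OF subspace1] cvec.subspace_scale[OF subspace1] by (auto simp: shift_def)

lemma shift_oper_sum: "shift (oper_sum A0 A1) z = oper_sum (shift A0 z) (shift A1 z)"
proof -
  have eq: "y0 + y1 - z *\<^sub>C (x0 + x1) = (y0 - z *\<^sub>C x0) + (y1 - z *\<^sub>C x1)" for x0 x1 y0 y1
    by (simp add: cvec.scale_right_distrib)
  show ?thesis
  proof (intro set_eqI iffI; clarify?)
    fix x w assume "(x, w) \<in> shift (oper_sum A0 A1) z"
    then obtain y where w: "w = y - z *\<^sub>C x" and xy: "(x, y) \<in> oper_sum A0 A1" by (auto simp: shift_def)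
    obtain x0 y0 x1 y1 where s: "(x0, y0) \<in> A0" "(x1, y1) \<in> A1" "x = x0 + x1" "y = y0 + y1"
      using xy by (rule oper_sumE)
    show "(x, w) \<in> oper_sum (shift A0 z) (shift A1 z)"
      unfolding w s(3,4) eq by (rule oper_sumI) (use s in \<open>auto simp: shift_def\<close>)
  next
    fix x w assume xw: "(x, w) \<in> oper_sum (shift A0 z) (shift A1 z)"
    obtain x0 w0 x1 w1 where s: "(x0, w0) \<in> shift A0 z" "(x1, w1) \<in> shift A1 z" "x = x0 + x1" "w = w0 + w1"
      using xw by (rule oper_sumE)
    then obtain y0 y1 where "(x0, y0) \<in> A0" "w0 = y0 - z *\<^sub>C x0" "(x1, y1) \<in> A1" "w1 = y1 - z *\<^sub>C x1"
      by (auto simp: shift_def)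
    with s show "(x, w) \<in> shift (oper_sum A0 A1) z"
      unfolding shift_def by (intro image_eqI[of _ _ "(x0 + x1, y0 + y1)"]) (auto simp: eq oper_sumI)
  qed
qed

text \<open>Pairing with \<open>(0, 0)\<close> places the shifted summand inside the shifted sum, so
  injectivity and the norm bound restrict; surjectivity onto \<open>W0\<close> follows from
  uniqueness of the decomposition.\<close>

lemma resolvent_oper_sum_subset: "resolvent_set_in UNIV (oper_sum A0 A1) \<subseteq> resolvent_set_in W0 A0"
proof
  fix z assume "z \<in> resolvent_set_in UNIV (oper_sum A0 A1)"
  then have sv: "single_valued ((oper_sum (shift A0 z) (shift A1 z))\<inverse>)"
    and rg: "Range (oper_sum (shift A0 z) (shift A1 z)) = UNIV"
    and bd: "\<exists>C. \<forall>(x, y)\<in>oper_sum (shift A0 z) (shift A1 z). norm x \<le> C * norm y"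
    unfolding resolvent_set_in_def shift_oper_sum by auto
  have z1: "(0, 0) \<in> shift A1 z" using zero1 by (force simp: shift_def)
  have left: "(x, y) \<in> oper_sum (shift A0 z) (shift A1 z)" if "(x, y) \<in> shift A0 z" for x y
    using oper_sumI[OF that z1] by simp
  have "single_valued ((shift A0 z)\<inverse>)"
    using sv left unfolding single_valued_def converse_iff by blast
  moreover have "Range (shift A0 z) = W0"
  proof (intro set_eqI iffI)
    fix w assume w: "w \<in> W0"
    obtain x where "(x, w) \<in> oper_sum (shift A0 z) (shift A1 z)" using rg by blast
    then obtain x0 w0 x1 w1 where s: "(x0, w0) \<in> shift A0 z" "(x1, w1) \<in> shift A1 z" "w = w0 + w1"
      by (auto elim: oper_sumE)
    have "w0 = w"
      using unique(1)[of w0 w1 w 0] shift_sub0[OF s(1)] shift_sub1[OF s(2)] w s cvec.subspace_0[OF subspace1] by auto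
    then show "w \<in> Range (shift A0 z)" using s by blast
  qed (use shift_sub0 in blast)
  moreover have "\<exists>C. \<forall>(x, y)\<in>shift A0 z. norm x \<le> C * norm y" using bd left by blast
  ultimately show "z \<in> resolvent_set_in W0 A0" unfolding resolvent_set_in_def by blast
qed

text \<open>Solving componentwise is enough since components are no longer than their orthogonal
  sum. The bounding constants may be negative, hence the absolute values in the combined
  constant.\<close>

lemma resolvent_oper_sum_superset:
  "resolvent_set_in W0 A0 \<inter> resolvent_set_in W1 A1 \<subseteq> resolvent_set_in UNIV (oper_sum A0 A1)"
proof
  fix z assume "z \<in> resolvent_set_in W0 A0 \<inter> resolvent_set_in W1 A1"
  then obtain C0 C1 where sv: "single_valued ((shift A0 z)\<inverse>)" "single_valued ((shift A1 z)\<inverse>)"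
    and rg: "Range (shift A0 z) = W0" "Range (shift A1 z) = W1"
    and C: "\<And>x y. (x, y) \<in> shift A0 z \<Longrightarrow> norm x \<le> C0 * norm y" "\<And>x y. (x, y) \<in> shift A1 z \<Longrightarrow> norm x \<le> C1 * norm y"
    unfolding resolvent_set_in_def by blast
  let ?S = "oper_sum (shift A0 z) (shift A1 z)"
  have "single_valued (?S\<inverse>)"
  proof (rule single_valuedI, unfold converse_iff)
    fix w x y assume x: "(x, w) \<in> ?S" and y: "(y, w) \<in> ?S"
    obtain x0 w0 x1 w1 where x: "(x0, w0) \<in> shift A0 z" "(x1, w1) \<in> shift A1 z" "x = x0 + x1" "w = w0 + w1"
      using x by (rule oper_sumE)
    obtain y0 w0' y1 w1' where y: "(y0, w0') \<in> shift A0 z" "(y1, w1') \<in> shift A1 z" "y = y0 + y1" "w = w0' + w1'"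
      using y by (rule oper_sumE)
    have "w0 + w1 = w0' + w1'" using x y by simp
    then have "w0 = w0'" "w1 = w1'" using unique shift_sub0 shift_sub1 x y by blast+
    then have "x0 = y0" "x1 = y1" using sv x y unfolding single_valued_def converse_iff by blast+
    then show "x = y" using x y by simp
  qed
  moreover have "Range ?S = UNIV"
  proof -
    have "v \<in> Range ?S" for v
    proof -
      obtain w0 w1 where v: "w0 \<in> W0" "w1 \<in> W1" "v = w0 + w1" using decomp by blast
      then obtain x0 x1 where "(x0, w0) \<in> shift A0 z" "(x1, w1) \<in> shift A1 z" using rg by blast
      then show ?thesis unfolding v by (blast intro: oper_sumI)
    qed
    then show ?thesis by blast
  qed
  moreover have "norm x \<le> (\<bar>C0\<bar> + \<bar>C1\<bar>) * norm w" if xw: "(x, w) \<in> ?S" for x w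
  proof -
    obtain x0 w0 x1 w1 where s: "(x0, w0) \<in> shift A0 z" "(x1, w1) \<in> shift A1 z" "x = x0 + x1" "w = w0 + w1"
      using xw by (rule oper_sumE)
    have "norm x0 \<le> \<bar>C0\<bar> * norm w"
      using C(1)[OF s(1)] norm_le0[of w0 w1] shift_sub0[OF s(1)] shift_sub1[OF s(2)] s
      by (intro order_trans[OF C(1)[OF s(1)]] mult_mono) auto
    moreover have "norm x1 \<le> \<bar>C1\<bar> * norm w"
      using C(2)[OF s(2)] norm_le1[of w0 w1] shift_sub0[OF s(1)] shift_sub1[OF s(2)] s
      by (intro order_trans[OF C(2)[OF s(2)]] mult_mono) auto
    ultimately show ?thesis
      unfolding s(3) using norm_triangle_ineq[of x0 x1] by (simp add: distrib_right)
  qed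
  then have "\<exists>C. \<forall>(x, y)\<in>?S. norm x \<le> C * norm y" by blast
  ultimately show "z \<in> resolvent_set_in UNIV (oper_sum A0 A1)"
    unfolding resolvent_set_in_def shift_oper_sum by blast
qed

text \<open>Transfers restriction and invariance statements from the first subspace to the
  second.\<close>

lemma swap: "orthogonal_pair W1 W0 A1 A0"
proof
  show "\<exists>x\<in>W1. \<exists>y\<in>W0. v = x + y" for v using decomp[of v] by (metis add.commute)
qed (use subspace0 subspace1 orth' self_adjoint0 self_adjoint1 in auto)

end

section \<open>The Hamiltonian as a pair of Jacobi operators\<close>

lemma coord_basis: "coord (basis k) n = (if n = k then 1 else 0)"
  by (simp add: basis.rep_eq)

lemma coord_uminus [simp]: "coord (- x) n = - coord x n"
  by (simp add: uminus_ell2.rep_eq)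

lemma coord_sum [simp]: "coord (\<Sum>i\<in>I. f i) n = (\<Sum>i\<in>I. coord (f i) n)"
  by (induction I rule: infinite_finite_induct) auto

lemma cinner_basis: "cinner (basis k) x = coord x k"
proof -
  have "(\<lambda>n. cnj (coord (basis k) n) * coord x n) = (\<lambda>n. if n = k then coord x n else 0)"
    by (auto simp: coord_basis)
  then show ?thesis unfolding cinner_def using sums_single[of k "coord x"] by (simp add: sums_iff)
qed

text \<open>A description by vanishing coordinates makes closedness, orthogonality and the
  decomposition direct; \<open>closure_cspan_parity\<close> identifies it with the closed
  spans.\<close>

definition parity_space :: "nat \<Rightarrow> ell2 set" where
  "parity_space s = {x. \<forall>k. k mod 2 \<noteq> s \<longrightarrow> coord x k = 0}"

lemma subspace_parity_space: "cvec.subspace (parity_space s)"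
  by (auto simp: cvec.subspace_def parity_space_def)

lemma closed_parity_space: "closed (parity_space s)"
proof -
  have "parity_space s = (\<Inter>k\<in>{k. k mod 2 \<noteq> s}. {x. cinner (basis k) x = 0})"
    by (auto simp: parity_space_def cinner_basis)
  then show ?thesis by (auto intro!: closed_INT closed_Collect_eq continuous_intros)
qed

lemma parity_space_orth: "x \<in> parity_space s \<Longrightarrow> y \<in> parity_space s' \<Longrightarrow> s \<noteq> s' \<Longrightarrow> cinner x y = 0"
proof -
  assume "x \<in> parity_space s" "y \<in> parity_space s'" "s \<noteq> s'"
  then have "cnj (coord x n) * coord y n = 0" for n
    by (cases "n mod 2 = s") (auto simp: parity_space_def)
  then show ?thesis by (simp only: cinner_def suminf_zero)
qed

lemma parity_decomposition: "\<exists>x\<in>parity_space 0. \<exists>y\<in>parity_space 1. v = x + y"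
proof -
  define part where "part s = Abs_ell2 (\<lambda>k. if k mod 2 = s then coord v k else 0)" for s :: nat
  have part: "coord (part s) k = (if k mod 2 = s then coord v k else 0)" for s k
  proof -
    have "summable (\<lambda>k. (cmod (if k mod 2 = s then coord v k else 0))\<^sup>2)"
      by (rule summable_comparison_test'[OF summable_coord[of v]]) auto
    then show ?thesis unfolding part_def by (subst Abs_ell2_inverse) auto
  qed
  have "v = part 0 + part 1" by (rule ell2_eqI) (auto simp: part)
  moreover have "part s \<in> parity_space s" for s by (simp add: parity_space_def part)
  ultimately show ?thesis by blast
qed

lemma not_in_range_parity:
  fixes n s :: nat
  assumes "s < 2" "n \<notin> range (\<lambda>i. 2 * i + s)"
  shows "n mod 2 \<noteq> s"
proof
  assume "n mod 2 = s"
  then have "n = 2 * (n div 2) + s" using mult_div_mod_eq[of 2 n] by simp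
  with assms(2) show False by blast
qed

section \<open>Embedding Fourier coefficients into the parity subspaces\<close>

context sq_orthonormal_basis
begin

definition embed :: "nat \<Rightarrow> ('w \<Rightarrow> complex) \<Rightarrow> ell2" where
  "embed s f = Abs_ell2 (\<lambda>k. if k mod 2 = s then coeff f (k div 2) else 0)"

lemma summable_embed:
  assumes x: "summable (\<lambda>n. (cmod (x n))\<^sup>2)" and s: "s < 2"
  shows "summable (\<lambda>k. (cmod (if k mod 2 = s then x (k div 2) else 0 :: complex))\<^sup>2)"
proof (subst summable_mono_reindex[of "\<lambda>i. 2 * i + s", symmetric])
  show "strict_mono (\<lambda>i. 2 * i + s)" by (simp add: strict_mono_def)
  show "(cmod (if n mod 2 = s then x (n div 2) else 0))\<^sup>2 = 0" if "n \<notin> range (\<lambda>i. 2 * i + s)" for n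
    using not_in_range_parity[OF s that] by simp
  have "(2 * i + s) mod 2 = s" "(2 * i + s) div 2 = i" for i using s by auto
  then show "summable (\<lambda>i. (cmod (if (2 * i + s) mod 2 = s then x ((2 * i + s) div 2) else 0))\<^sup>2)"
    using x by simp
qed

lemma coord_embed:
  assumes "f \<in> sq_integrable M" "s < 2"
  shows "coord (embed s f) k = (if k mod 2 = s then coeff f (k div 2) else 0)"
  unfolding embed_def using summable_embed[OF summable_coeff[OF assms(1)] assms(2)]
  by (subst Abs_ell2_inverse) auto

lemma coeff_add: "f \<in> sq_integrable M \<Longrightarrow> g \<in> sq_integrable M \<Longrightarrow> coeff (\<lambda>t. f t + g t) n = coeff f n + coeff g n"
  unfolding coeff_def by (rule sq_inner_add_right[OF p_sq])

lemma coeff_cmult: "coeff (\<lambda>t. c * f t) n = c * coeff f n"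
  unfolding coeff_def by (rule sq_inner_cmult_right)

lemma embed_add:
  "f \<in> sq_integrable M \<Longrightarrow> g \<in> sq_integrable M \<Longrightarrow> s < 2 \<Longrightarrow> embed s (\<lambda>t. f t + g t) = embed s f + embed s g"
  by (rule ell2_eqI) (simp add: coord_embed sq_integrable_add coeff_add)

lemma embed_cmult: "f \<in> sq_integrable M \<Longrightarrow> s < 2 \<Longrightarrow> embed s (\<lambda>t. c * f t) = c *\<^sub>C embed s f"
  by (rule ell2_eqI) (simp add: coord_embed sq_integrable_cmult coeff_cmult)

lemma cinner_embed:
  assumes f: "f \<in> sq_integrable M" and g: "g \<in> sq_integrable M" and s: "s < 2"
  shows "cinner (embed s f) (embed s g) = sq_inner M f g"
proof -
  define h where "h k = cnj (coord (embed s f) k) * coord (embed s g) k" for k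
  have "h (2 * i + s) = cnj (coeff f i) * coeff g i" for i
    unfolding h_def coord_embed[OF f s] coord_embed[OF g s] using s by simp
  then have "(\<lambda>i. h (2 * i + s)) sums sq_inner M f g"
    using parseval[OF f g] by simp
  moreover have "h n = 0" if "n \<notin> range (\<lambda>i. 2 * i + s)" for n
    unfolding h_def coord_embed[OF f s] using not_in_range_parity[OF s that] by simp
  ultimately have "h sums sq_inner M f g"
    by (subst (asm) sums_mono_reindex) (auto simp: strict_mono_def)
  then show ?thesis unfolding cinner_def h_def by (simp add: sums_iff)
qed

lemma embed_image:
  assumes s: "s < 2"
  shows "embed s ` sq_integrable M = parity_space s"
proof (intro set_eqI iffI)
  show "x \<in> parity_space s" if "x \<in> embed s ` sq_integrable M" for x
    using that s by (auto simp: parity_space_def coord_embed)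
  fix x assume x: "x \<in> parity_space s"
  have "summable (\<lambda>i. (cmod (coord x (2 * i + s)))\<^sup>2)"
    by (subst summable_mono_reindex[of "\<lambda>i. 2 * i + s" "\<lambda>k. (cmod (coord x k))\<^sup>2"])
      (use x not_in_range_parity[OF s] in \<open>auto simp: strict_mono_def parity_space_def summable_coord\<close>)
  from coeff_surj[OF this]
  obtain f where f: "f \<in> sq_integrable M" "coeff f = (\<lambda>i. coord x (2 * i + s))" ..
  have "embed s f = x"
  proof (rule ell2_eqI)
    fix k
    have "2 * (k div 2) + s = k" if "k mod 2 = s" using mult_div_mod_eq[of 2 k] that by simp
    then show "coord (embed s f) k = coord x k"
      using x by (auto simp: coord_embed[OF f(1) s] f(2) parity_space_def)
  qed
  with f show "x \<in> embed s ` sq_integrable M" by blast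
qed

lemma embed_psum:
  assumes s: "s < 2"
  shows "embed s (\<lambda>t. \<Sum>n<N. c n * p n t) = (\<Sum>n<N. c n *\<^sub>C basis (2 * n + s))"
proof (rule ell2_eqI)
  fix k
  have "(\<Sum>n<N. c n * coord (basis (2 * n + s)) k) = (\<Sum>n<N. if n = k div 2 \<and> k mod 2 = s then c n else 0)"
    by (intro sum.cong refl) (use s in \<open>auto simp: coord_basis\<close>)
  also have "\<dots> = (if k mod 2 = s \<and> k div 2 < N then c (k div 2) else 0)" by auto
  finally show "coord (embed s (\<lambda>t. \<Sum>n<N. c n * p n t)) k = coord (\<Sum>n<N. c n *\<^sub>C basis (2 * n + s)) k"
    by (simp add: coord_embed[OF psum_sq s] coeff_psum)
qed

end

lemma unitary_model_embed:
  fixes M :: "real measure"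
  assumes "sq_orthonormal_basis M p" "finite_measure M" "sets M = sets borel" "s < 2"
  shows "unitary_model M (parity_space s) (sq_orthonormal_basis.embed M p s)"
proof -
  interpret sq_orthonormal_basis M p by fact
  interpret finite_measure M by fact
  show ?thesis
    by unfold_locales (use assms in \<open>simp_all add: embed_add embed_cmult cinner_embed embed_image closed_parity_space\<close>)
qed

text \<open>The maximal operator of the Jacobi matrix on parity \<open>s\<close>, transported from
  multiplication by \<open>t\<close>. The shape is \<open>a\<close> on the even part and
  \<open>a + 1\<close> on the odd part.\<close>

definition jacobi_op :: "real \<Rightarrow> nat \<Rightarrow> oper" where
  "jacobi_op a s = unitary_model.mult_op (gamma_measure (a + s))
     (sq_orthonormal_basis.embed (gamma_measure (a + s)) (laguerre_fun (a + s)) s)"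

section \<open>Matrix entries of the Hamiltonian\<close>

definition finite_support :: "ell2 \<Rightarrow> bool" where
  "finite_support x \<longleftrightarrow> finite {k. coord x k \<noteq> 0}"

lemma finite_support_finite_combinations:
  assumes "x \<in> finite_combinations"
  shows "finite_support x"
proof -
  have "finite_combinations \<subseteq> {x. finite_support x}"
    unfolding finite_combinations_def cspan_def
  proof (rule cvec.span_minimal)
    show "range basis \<subseteq> {x. finite_support x}" by (auto simp: finite_support_def coord_basis)
    have "finite {k. coord x k + coord y k \<noteq> 0}" if "finite_support x" "finite_support y" for x y
      by (rule finite_subset[of _ "{k. coord x k \<noteq> 0} \<union> {k. coord y k \<noteq> 0}"])
        (use that in \<open>auto simp: finite_support_def\<close>)
    then show "cvec.subspace {x. finite_support x}"
      by (auto simp: cvec.subspace_def finite_support_def)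
  qed
  with assms show ?thesis by blast
qed

text \<open>The common coefficient of \<open>b_plus a\<close> from \<open>basis k\<close> to \<open>basis (k + 1)\<close> and of \<open>b_minus a\<close> back.\<close>

definition ladder_coeff :: "real \<Rightarrow> nat \<Rightarrow> real" where
  "ladder_coeff a k = (if even k then sqrt (2 * (real (k div 2) + a)) else sqrt (2 * (real (k div 2) + 1)))"

text \<open>\<open>lin_ext\<close> sums over the support, which is meaningful only if that is
  finite; then a single basis index contributes to each coordinate.\<close>

lemma coord_b_plus:
  assumes "finite_support x"
  shows "coord (b_plus a x) k = (if k = 0 then 0 else of_real (ladder_coeff a (k - 1)) * coord x (k - 1))"
proof -
  have "coord (b_plus a x) k = (\<Sum>m | coord x m \<noteq> 0. coord x m * (of_real (ladder_coeff a m) * (if k = m + 1 then 1 else 0)))"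
    unfolding b_plus_def lin_ext_def coord_sum coord_scaleC
    by (intro sum.cong refl arg_cong2[where f = "(*)"]) (simp add: Let_def ladder_coeff_def coord_basis)
  also have "\<dots> = (\<Sum>m | coord x m \<noteq> 0. if m = k - 1 \<and> k \<noteq> 0 then of_real (ladder_coeff a m) * coord x m else 0)"
    by (intro sum.cong refl) auto
  also have "\<dots> = (if k = 0 then 0 else of_real (ladder_coeff a (k - 1)) * coord x (k - 1))"
    using assms by (cases "k = 0") (simp_all add: finite_support_def)
  finally show ?thesis .
qed

lemma coord_b_minus:
  assumes "finite_support x"
  shows "coord (b_minus a x) k = of_real (ladder_coeff a k) * coord x (k + 1)"
proof -
  have eq: "coord (let n = real (m div 2) in
     if even m then complex_of_real (sqrt (2 * n)) *\<^sub>C basis (m - 1)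
     else complex_of_real (sqrt (2 * (n + a))) *\<^sub>C basis (m - 1)) k = (if m = k + 1 then of_real (ladder_coeff a k) else 0)" for m
  proof (cases "m = k + 1")
    case True
    then show ?thesis
      by (cases "even k") (auto simp: Let_def ladder_coeff_def coord_basis elim!: evenE oddE)
  next
    case False
    \<comment> \<open>For \<open>m = 0\<close> the index \<open>m - 1\<close> is truncated to 0, but
      the coefficient is \<open>sqrt 0\<close>.\<close>
    then show ?thesis by (cases "m = 0") (auto simp: Let_def coord_basis)
  qed
  have "coord (b_minus a x) k = (\<Sum>m | coord x m \<noteq> 0. if m = k + 1 then of_real (ladder_coeff a k) * coord x m else 0)"
    unfolding b_minus_def lin_ext_def coord_sum coord_scaleC eq
    by (intro sum.cong refl) auto
  also have "\<dots> = of_real (ladder_coeff a k) * coord x (k + 1)"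
    using assms by (simp add: finite_support_def)
  finally show ?thesis .
qed

lemma finite_support_b_plus: "finite_support x \<Longrightarrow> finite_support (b_plus a x)"
proof -
  assume x: "finite_support x"
  have "{k. coord (b_plus a x) k \<noteq> 0} \<subseteq> Suc ` {k. coord x k \<noteq> 0}"
  proof
    fix k assume "k \<in> {k. coord (b_plus a x) k \<noteq> 0}"
    then have "k \<noteq> 0" "coord x (k - 1) \<noteq> 0" by (auto simp: coord_b_plus[OF x] split: if_splits)
    then show "k \<in> Suc ` {k. coord x k \<noteq> 0}" by (intro image_eqI[of _ _ "k - 1"]) auto
  qed
  with x show ?thesis unfolding finite_support_def by (auto intro: finite_subset)
qed

lemma finite_support_b_minus: "finite_support x \<Longrightarrow> finite_support (b_minus a x)"
proof -
  assume x: "finite_support x"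
  have "{k. coord (b_minus a x) k \<noteq> 0} \<subseteq> (\<lambda>k. k - 1) ` {k. coord x k \<noteq> 0}"
  proof
    fix k assume "k \<in> {k. coord (b_minus a x) k \<noteq> 0}"
    then have "coord x (k + 1) \<noteq> 0" by (auto simp: coord_b_minus[OF x])
    then show "k \<in> (\<lambda>k. k - 1) ` {k. coord x k \<noteq> 0}" by (intro image_eqI[of _ _ "k + 1"]) auto
  qed
  with x show ?thesis unfolding finite_support_def by (auto intro: finite_subset)
qed

definition hamiltonian :: "real \<Rightarrow> ell2 \<Rightarrow> ell2" where
  "hamiltonian a x = (- 1/2) *\<^sub>C (op_e a x - op_f a x - op_h a x)"

lemma free_hamiltonian_closure:
  "free_hamiltonian a = closure ((\<lambda>x. (x, hamiltonian a x)) ` finite_combinations)"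
  by (simp add: free_hamiltonian_def hamiltonian_def)

text \<open>Adjacent ladder coefficients multiply to \<open>4 * jacobi_offdiag (a + s) n\<close>,
  and the two squares meeting at a coordinate add up to \<open>4 * (n + (a + s) / 2)\<close>. The
  factor 4 cancels against the factors one half in the Hamiltonian and in \<open>op_h\<close>,
  \<open>op_e\<close> and \<open>op_f\<close>. For \<open>n = 0\<close> there is no lower neighbour,
  so its coefficient is 0.\<close>

lemma coord_hamiltonian:
  assumes a: "a > 0" and x: "finite_support x" and s: "s < 2"
  shows "coord (hamiltonian a x) (2 * n + s) = of_real (n + (a + s) / 2) * coord x (2 * n + s)
    - of_real (jacobi_offdiag (a + s) n) * coord x (2 * Suc n + s)
    - of_real (if n = 0 then 0 else jacobi_offdiag (a + s) (n - 1)) * coord x (2 * (n - 1) + s)"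
proof -
  let ?l = "\<lambda>k. complex_of_real (ladder_coeff a k)"
  define k where "k = 2 * n + s"
  have fs: "finite_support (b_plus a x)" "finite_support (b_minus a x)"
    using x by (auto intro: finite_support_b_plus finite_support_b_minus)
  have up: "ladder_coeff a (2 * m + s) * ladder_coeff a (Suc (2 * m + s)) = 4 * jacobi_offdiag (a + s) m" for m
  proof -
    have "s = 0 \<or> s = 1" using s by auto
    then have "ladder_coeff a (2 * m + s) * ladder_coeff a (Suc (2 * m + s))
        = sqrt (2 * 2 * ((m + 1) * (m + (a + s))))"
      by (auto simp: ladder_coeff_def simp flip: real_sqrt_mult intro!: arg_cong[of _ _ sqrt])
         (auto simp: algebra_simps)
    then show ?thesis by (simp add: jacobi_offdiag_def real_sqrt_mult)
  qed
  have sq: "ladder_coeff a m * ladder_coeff a m = (if even m then 2 * (real (m div 2) + a) else 2 * (real (m div 2) + 1))" for m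
    using a by (simp add: ladder_coeff_def)
  have diag: "(if k = 0 then 0 else ladder_coeff a (k - 1) * ladder_coeff a (k - 1)) + ladder_coeff a k * ladder_coeff a k
      = 4 * (n + (a + s) / 2)"
  proof -
    have "s = 0 \<or> s = 1" using s by auto
    then show ?thesis
    proof
      assume "s = 0"
      then show ?thesis unfolding sq k_def by (cases n) (auto simp: algebra_simps)
    next
      assume "s = 1"
      then show ?thesis unfolding sq k_def by (simp add: algebra_simps)
    qed
  qed
  have e: "coord (op_e a x) k = 1/2 * (of_real (if n = 0 then 0 else 4 * jacobi_offdiag (a + s) (n - 1)) * coord x (2 * (n - 1) + s))"
  proof (cases n)
    case 0
    then have "k = 0 \<or> k = 1" using s by (auto simp: k_def)
    then show ?thesis using 0 by (auto simp: op_e_def coord_b_plus[OF fs(1)] coord_b_plus[OF x])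
  next
    case (Suc m)
    then have "k = Suc (Suc (2 * m + s))" by (simp add: k_def)
    moreover have "?l (Suc (2 * m + s)) * (?l (2 * m + s) * coord x (2 * m + s))
        = of_real (ladder_coeff a (2 * m + s) * ladder_coeff a (Suc (2 * m + s))) * coord x (2 * m + s)"
      by simp
    ultimately show ?thesis
      using Suc unfolding up by (simp add: op_e_def coord_b_plus[OF fs(1)] coord_b_plus[OF x])
  qed
  have f: "coord (op_f a x) k = - 1/2 * (of_real (4 * jacobi_offdiag (a + s) n) * coord x (2 * Suc n + s))"
    unfolding up[symmetric] by (simp add: op_f_def coord_b_minus[OF fs(2)] coord_b_minus[OF x] k_def)
  have h: "coord (op_h a x) k = 1/2 * (of_real (4 * (n + (a + s) / 2)) * coord x k)"
    unfolding diag[symmetric]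
    by (auto simp: op_h_def coord_b_plus[OF fs(2)] coord_b_minus[OF fs(1)] coord_b_plus[OF x] coord_b_minus[OF x] algebra_simps)
  have "coord (hamiltonian a x) k = - 1/2 * (coord (op_e a x) k - coord (op_f a x) k - coord (op_h a x) k)"
    by (simp add: hamiltonian_def)
  also have "\<dots> = of_real (n + (a + s) / 2) * coord x k
    - of_real (jacobi_offdiag (a + s) n) * coord x (2 * Suc n + s)
    - of_real (if n = 0 then 0 else jacobi_offdiag (a + s) (n - 1)) * coord x (2 * (n - 1) + s)"
    unfolding e f h by (simp add: algebra_simps add_divide_distrib diff_divide_distrib)
  finally show ?thesis unfolding k_def .
qed

abbreviation laguerre_embed :: "real \<Rightarrow> nat \<Rightarrow> (real \<Rightarrow> complex) \<Rightarrow> ell2" where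
  "laguerre_embed a s \<equiv> sq_orthonormal_basis.embed (gamma_measure (a + real s)) (laguerre_fun (a + real s)) s"

lemma mult_poly_functions: "q \<in> poly_functions \<Longrightarrow> (\<lambda>t. of_real t * q t) \<in> poly_functions"
proof -
  assume "q \<in> poly_functions"
  then obtain q' where "q = (\<lambda>t. poly q' (of_real t))" by (auto simp: poly_functions_def)
  then show ?thesis unfolding poly_functions_def by (intro range_eqI[of _ _ "pCons 0 q'"]) simp
qed

text \<open>Polynomials are a core: the graph norm of multiplication by \<open>t\<close> is the $L^2$ norm for the
  weight \<open>1 + t\<^sup>2\<close>, which still has exponential moments.\<close>

lemma poly_graph_dense:
  assumes c: "c > 0" and f: "f \<in> sq_integrable (gamma_measure c)"
    and tf: "(\<lambda>t. of_real t * f t) \<in> sq_integrable (gamma_measure c)"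
  shows "\<exists>Q. (\<forall>n. Q n \<in> poly_functions) \<and> (\<lambda>n. sq_dist (gamma_measure c) f (Q n)) \<longlonglongrightarrow> 0
    \<and> (\<lambda>n. sq_dist (gamma_measure c) (\<lambda>t. of_real t * f t) (\<lambda>t. of_real t * Q n t)) \<longlonglongrightarrow> 0"
proof -
  let ?M = "gamma_measure c"
  let ?N = "density ?M (\<lambda>t. ennreal (1 + t\<^sup>2))"
  interpret M: exp_moment_measure ?M 1 by (rule exp_moment_gamma_measure[OF c])
  interpret N: exp_moment_measure ?N 1 by (rule exp_moment_weighted_gamma_measure[OF c])
  have split: "(1 + t\<^sup>2) * (cmod z)\<^sup>2 = (cmod z)\<^sup>2 + (cmod (of_real t * z))\<^sup>2" for t z
    by (simp add: norm_mult power_mult_distrib distrib_right)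
  have fN: "g \<in> sq_integrable ?N" if g: "g \<in> sq_integrable ?M" "(\<lambda>t. of_real t * g t) \<in> sq_integrable ?M" for g
  proof -
    note [measurable] = sq_integrable_measurable[OF g(1)]
    have "integrable ?N (\<lambda>t. (cmod (g t))\<^sup>2)"
      using sq_integrable_integrable[OF g(1)] sq_integrable_integrable[OF g(2)]
      by (subst integrable_density) (auto simp only: split real_scaleR_def intro!: Bochner_Integration.integrable_add, auto)
    then show ?thesis unfolding sq_integrable_def by simp
  qed
  have dist: "sq_dist ?N f q = sq_dist ?M f q + sq_dist ?M (\<lambda>t. of_real t * f t) (\<lambda>t. of_real t * q t)"
    if q: "q \<in> poly_functions" for q
  proof -
    have q': "q \<in> sq_integrable ?M" "(\<lambda>t. of_real t * q t) \<in> sq_integrable ?M"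
      using q mult_poly_functions M.polys.P_subset by blast+
    note [measurable] = sq_integrable_measurable[OF f] sq_integrable_measurable[OF q'(1)]
    have "sq_dist ?N f q = (LINT t|?M. (1 + t\<^sup>2) * (cmod (f t - q t))\<^sup>2)"
      unfolding sq_dist_def by (subst integral_density) auto
    also have "\<dots> = (LINT t|?M. (cmod (f t - q t))\<^sup>2 + (cmod (of_real t * f t - of_real t * q t))\<^sup>2)"
      unfolding split right_diff_distrib ..
    also have "\<dots> = sq_dist ?M f q + sq_dist ?M (\<lambda>t. of_real t * f t) (\<lambda>t. of_real t * q t)"
      unfolding sq_dist_def
      by (intro Bochner_Integration.integral_add sq_integrable_integrable sq_integrable_diff f tf q')
    finally show ?thesis .
  qed
  have "f \<in> sq_closure ?N poly_functions"
    using N.polynomials_dense fN[OF f tf] by simp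
  then have "\<exists>q\<in>poly_functions. sq_dist ?N f q < e" if "e > 0" for e
    using that unfolding sq_closure_def by blast
  from this[of "1 / real (Suc _)"] have "\<forall>n. \<exists>q. q \<in> poly_functions \<and> sq_dist ?N f q < 1 / real (Suc n)"
    by (auto simp del: of_nat_Suc)
  then obtain Q where Q: "\<And>n. Q n \<in> poly_functions" "\<And>n. sq_dist ?N f (Q n) < 1 / real (Suc n)" by metis
  have le: "sq_dist ?M f (Q n) \<le> 1 / real (Suc n)"
    "sq_dist ?M (\<lambda>t. of_real t * f t) (\<lambda>t. of_real t * Q n t) \<le> 1 / real (Suc n)" for n
    using Q(2)[of n] dist[OF Q(1)[of n]] sq_dist_nonneg[of ?M f "Q n"]
      sq_dist_nonneg[of ?M "\<lambda>t. of_real t * f t" "\<lambda>t. of_real t * Q n t"] by linarith+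
  have lim: "(\<lambda>n. 1 / real (Suc n)) \<longlonglongrightarrow> 0" using LIMSEQ_Suc[OF lim_1_over_n] by simp
  show ?thesis
    by (intro exI[of _ Q] conjI allI Q(1) tendsto_sandwich[OF _ _ tendsto_const lim] always_eventually sq_dist_nonneg le)
qed

text \<open>Partial Fourier sums are embedded as finite combinations of basis vectors, so density of
  the latter follows from that of the former. The statement does not involve \<open>a\<close>, hence
  the model with shape 1.\<close>

lemma closure_cspan_parity:
  assumes s: "s < 2"
  shows "closure (cspan (range (\<lambda>n. basis (2 * n + s)))) = parity_space s"
proof (rule antisym)
  have "range (\<lambda>n. basis (2 * n + s)) \<subseteq> parity_space s"
    using s by (auto simp: parity_space_def coord_basis)
  then have "cspan (range (\<lambda>n. basis (2 * n + s))) \<subseteq> parity_space s"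
    unfolding cspan_def by (rule cvec.span_minimal[OF _ subspace_parity_space])
  then show "closure (cspan (range (\<lambda>n. basis (2 * n + s)))) \<subseteq> parity_space s"
    using closed_parity_space by (rule closure_minimal)
  interpret L: sq_orthonormal_basis "gamma_measure 1" "laguerre_fun 1"
    by (rule laguerre_orthonormal_basis) simp
  interpret U: unitary_model "gamma_measure 1" "parity_space s" "L.embed s"
    by (rule unitary_model_embed[OF L.sq_orthonormal_basis_axioms finite_measure_gamma_measure _ s]) auto
  show "parity_space s \<subseteq> closure (cspan (range (\<lambda>n. basis (2 * n + s))))"
  proof
    fix x assume x: "x \<in> parity_space s"
    define f where "f = U.repr x"
    have f: "f \<in> sq_integrable (gamma_measure 1)" "L.embed s f = x"
      unfolding f_def using U.repr[OF x] by auto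
    have lim: "(\<lambda>N. L.embed s (\<lambda>t. \<Sum>n<N. L.coeff f n * laguerre_fun 1 n t)) \<longlonglongrightarrow> x"
      unfolding f(2)[symmetric] by (rule U.U_tendsto[OF f(1) L.psum_sq L.psum_tendsto[OF f(1)]])
    have mem: "L.embed s (\<lambda>t. \<Sum>n<N. L.coeff f n * laguerre_fun 1 n t) \<in> cspan (range (\<lambda>n. basis (2 * n + s)))" for N
      unfolding L.embed_psum[OF s] cspan_def
      by (intro cvec.span_sum cvec.span_scale cvec.span_base) auto
    show "x \<in> closure (cspan (range (\<lambda>n. basis (2 * n + s))))"
      unfolding closure_sequential by (intro exI conjI allI) (rule mem, rule lim)
  qed
qed

lemma V_even_eq: "V_even = parity_space 0"
  using closure_cspan_parity[of 0] by (simp add: V_even_def)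

lemma V_odd_eq: "V_odd = parity_space 1"
  using closure_cspan_parity[of 1] by (simp add: V_odd_def)

section \<open>Identification of the Hamiltonian with the sum of its parity parts\<close>

context
  fixes a :: real
  assumes a: "a > 0"
begin

lemma shifted_pos: "a + real s > 0"
  using a by (simp add: add_pos_nonneg)

lemma laguerre_basis: "sq_orthonormal_basis (gamma_measure (a + real s)) (laguerre_fun (a + real s))"
  by (rule laguerre_orthonormal_basis[OF shifted_pos])

lemma unitary_laguerre: "s < 2 \<Longrightarrow> unitary_model (gamma_measure (a + real s)) (parity_space s) (laguerre_embed a s)"
  by (rule unitary_model_embed[OF laguerre_basis finite_measure_gamma_measure[OF shifted_pos]]) auto

lemma self_adjoint_jacobi: "s < 2 \<Longrightarrow> self_adjoint_in (parity_space s) (jacobi_op a s)"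
  unfolding jacobi_op_def by (rule unitary_model.self_adjoint_mult_op[OF unitary_laguerre])

lemma simple_spectrum_jacobi: "s < 2 \<Longrightarrow> simple_spectrum_in (parity_space s) (jacobi_op a s)"
  unfolding jacobi_op_def by (rule unitary_model.simple_spectrum_mult_op[OF unitary_laguerre])

lemma spectrum_jacobi: "s < 2 \<Longrightarrow> spectrum_in (parity_space s) (jacobi_op a s) = complex_of_real ` {0..}"
  unfolding jacobi_op_def
  by (rule unitary_model.spectrum_mult_op_half_line[OF unitary_laguerre AE_gamma_measure_nonneg
        emeasure_gamma_measure_interval[OF shifted_pos]])

lemma jacobi_opE:
  assumes "s < 2" "(x, y) \<in> jacobi_op a s"
  obtains f where "f \<in> sq_integrable (gamma_measure (a + real s))"
    "(\<lambda>t. of_real t * f t) \<in> sq_integrable (gamma_measure (a + real s))"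
    "x = laguerre_embed a s f" "y = laguerre_embed a s (\<lambda>t. of_real t * f t)"
  using assms(2) unfolding jacobi_op_def unitary_model.mult_op_def[OF unitary_laguerre[OF assms(1)]] by blast

lemma jacobi_opI:
  assumes "s < 2" "f \<in> sq_integrable (gamma_measure (a + real s))"
    "(\<lambda>t. of_real t * f t) \<in> sq_integrable (gamma_measure (a + real s))"
  shows "(laguerre_embed a s f, laguerre_embed a s (\<lambda>t. of_real t * f t)) \<in> jacobi_op a s"
  unfolding jacobi_op_def by (rule unitary_model.mult_opI[OF unitary_laguerre[OF assms(1)] assms(2,3)])

lemma coord_laguerre_embed:
  assumes "f \<in> sq_integrable (gamma_measure (a + real s))" "s < 2"
  shows "coord (laguerre_embed a s f) k =
    (if k mod 2 = s then sq_inner (gamma_measure (a + real s)) (laguerre_fun (a + real s) (k div 2)) f else 0)"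
  using sq_orthonormal_basis.coord_embed[OF laguerre_basis assms] sq_orthonormal_basis.coeff_def[OF laguerre_basis] by simp

text \<open>The factor \<open>t\<close> is moved over to the Laguerre function, where the recurrence
  applies; the recurrence coefficients are real and pass through the conjugations.\<close>

lemma coeff_mult:
  fixes s :: nat
  defines "c \<equiv> a + real s"
  assumes f: "f \<in> sq_integrable (gamma_measure c)"
  shows "sq_inner (gamma_measure c) (laguerre_fun c n) (\<lambda>t. of_real t * f t) =
    of_real (n + c / 2) * sq_inner (gamma_measure c) (laguerre_fun c n) f
    - of_real (jacobi_offdiag c n) * sq_inner (gamma_measure c) (laguerre_fun c (Suc n)) f
    - of_real (if n = 0 then 0 else jacobi_offdiag c (n - 1)) * sq_inner (gamma_measure c) (laguerre_fun c (n - 1)) f"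
proof -
  have c: "c > 0" unfolding c_def by (rule shifted_pos)
  have "sq_inner (gamma_measure c) (laguerre_fun c n) (\<lambda>t. of_real t * f t)
      = cnj (sq_inner (gamma_measure c) f (\<lambda>t. of_real t * laguerre_fun c n t))"
    unfolding sq_inner_cnj by (simp add: sq_inner_def mult_ac)
  also have "sq_inner (gamma_measure c) f (\<lambda>t. of_real t * laguerre_fun c n t)
      = of_real (n + c / 2) * sq_inner (gamma_measure c) f (laguerre_fun c n)
      - of_real (jacobi_offdiag c n) * sq_inner (gamma_measure c) f (laguerre_fun c (Suc n))
      - of_real (if n = 0 then 0 else jacobi_offdiag c (n - 1)) * sq_inner (gamma_measure c) f (laguerre_fun c (n - 1))"
    unfolding laguerre_fun_recurrence[OF c]
    by (simp only: sq_inner_diff_right sq_inner_cmult_right sq_integrable_diff sq_integrable_cmult laguerre_fun_sq[OF c] f)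
  finally show ?thesis
    by (simp only: complex_cnj_diff complex_cnj_mult complex_cnj_complex_of_real sq_inner_cnj)
qed

text \<open>The intertwining relation: in each parity, \<open>coord_hamiltonian\<close> and
  \<open>coeff_mult\<close> are the same three-term recurrence. Indexing the functions by parity
  lets one computation treat both parts.\<close>

lemma hamiltonian_embed:
  assumes x: "finite_support x" "x = laguerre_embed a 0 (F 0) + laguerre_embed a 1 (F 1)"
    and F: "\<And>s. s < 2 \<Longrightarrow> F s \<in> sq_integrable (gamma_measure (a + real s))"
    and tF: "\<And>s. s < 2 \<Longrightarrow> (\<lambda>t. of_real t * F s t) \<in> sq_integrable (gamma_measure (a + real s))"
  shows "hamiltonian a x = laguerre_embed a 0 (\<lambda>t. of_real t * F 0 t) + laguerre_embed a 1 (\<lambda>t. of_real t * F 1 t)"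
proof (rule ell2_eqI)
  fix k :: nat
  define s where "s = k mod 2"
  define n where "n = k div 2"
  have s: "s < 2" by (simp add: s_def)
  have k: "k = 2 * n + s" by (simp add: s_def n_def)
  have sum: "coord (laguerre_embed a 0 (G 0) + laguerre_embed a 1 (G 1)) (2 * m + s)
      = sq_inner (gamma_measure (a + real s)) (laguerre_fun (a + real s) m) (G s)"
    if G: "\<And>s. s < 2 \<Longrightarrow> G s \<in> sq_integrable (gamma_measure (a + real s))" for G m
  proof -
    have "s = 0 \<or> s = 1" using s by auto
    then show ?thesis
      using coord_laguerre_embed[OF G[of 0], of "2 * m + s"] coord_laguerre_embed[OF G[of 1], of "2 * m + s"] by auto
  qed
  have sum_F: "coord (laguerre_embed a 0 (F 0) + laguerre_embed a 1 (F 1)) (2 * m + s)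
      = sq_inner (gamma_measure (a + real s)) (laguerre_fun (a + real s) m) (F s)" for m
    by (rule sum) (rule F)
  have sum_tF: "coord (laguerre_embed a 0 (\<lambda>t. of_real t * F 0 t) + laguerre_embed a 1 (\<lambda>t. of_real t * F 1 t)) (2 * n + s)
      = sq_inner (gamma_measure (a + real s)) (laguerre_fun (a + real s) n) (\<lambda>t. of_real t * F s t)"
    by (rule sum) (rule tF)
  show "coord (hamiltonian a x) k
      = coord (laguerre_embed a 0 (\<lambda>t. of_real t * F 0 t) + laguerre_embed a 1 (\<lambda>t. of_real t * F 1 t)) k"
    unfolding k coord_hamiltonian[OF a x(1) s] unfolding x(2) sum_F sum_tF
      coeff_mult[OF F[OF s]] ..
qed

lemma poly_functions_sq:
  assumes "q \<in> poly_functions"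
  shows "q \<in> sq_integrable (gamma_measure (a + real s))" "(\<lambda>t. of_real t * q t) \<in> sq_integrable (gamma_measure (a + real s))"
proof -
  interpret exp_moment_measure "gamma_measure (a + real s)" 1 by (rule exp_moment_gamma_measure[OF shifted_pos])
  show "q \<in> sq_integrable (gamma_measure (a + real s))" "(\<lambda>t. of_real t * q t) \<in> sq_integrable (gamma_measure (a + real s))"
    using assms mult_poly_functions polys.P_subset by blast+
qed

lemma embed_poly_finite:
  assumes "q \<in> poly_functions" "s < 2"
  shows "laguerre_embed a s q \<in> finite_combinations"
proof -
  obtain N b where q: "q = (\<lambda>t. \<Sum>n<N. b n * laguerre_fun (a + real s) n t)"
    using poly_functions_sum[OF shifted_pos assms(1)] by blast
  show ?thesis
    unfolding q sq_orthonormal_basis.embed_psum[OF laguerre_basis assms(2)] finite_combinations_def cspan_def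
    by (intro cvec.span_sum cvec.span_scale cvec.span_base) auto
qed

lemma orthogonal_pair_jacobi:
  "orthogonal_pair (parity_space 0) (parity_space 1) (jacobi_op a 0) (jacobi_op a 1)"
  by unfold_locales
    (use subspace_parity_space parity_decomposition self_adjoint_jacobi parity_space_orth in auto)

interpretation J: orthogonal_pair "parity_space 0" "parity_space 1" "jacobi_op a 0" "jacobi_op a 1"
  by (rule orthogonal_pair_jacobi)

text \<open>A finitely supported vector has a finite Laguerre sum as preimage in each parity, and
  every Laguerre function stays square-integrable after multiplication by \<open>t\<close>.\<close>

lemma hamiltonian_in_oper_sum:
  assumes "x \<in> finite_combinations"
  shows "(x, hamiltonian a x) \<in> oper_sum (jacobi_op a 0) (jacobi_op a 1)"
proof -
  have fin: "finite_support x" by (rule finite_support_finite_combinations[OF assms])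
  then obtain N where N: "\<And>k. coord x k \<noteq> 0 \<Longrightarrow> k < N"
    unfolding finite_support_def finite_nat_set_iff_bounded by blast
  \<comment> \<open>\<open>N\<close> bounds coordinate indices, hence also the Laguerre indices,
    since \<open>k div 2 \<le> k\<close>; no coefficient is cut off.\<close>
  define F where "F s = (\<lambda>t. \<Sum>n<N. coord x (2 * n + s) * laguerre_fun (a + real s) n t)" for s :: nat
  have F: "F s \<in> sq_integrable (gamma_measure (a + real s))" for s
    unfolding F_def by (rule sq_orthonormal_basis.psum_sq[OF laguerre_basis])
  have tF: "(\<lambda>t. of_real t * F s t) \<in> sq_integrable (gamma_measure (a + real s))" for s
    unfolding F_def sum_distrib_left mult.left_commute[of "of_real _"]
    by (intro sq_integrable_sum sq_integrable_cmult mult_laguerre_fun_sq shifted_pos)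
  have emb: "coord (laguerre_embed a s (F s)) k = (if k mod 2 = s then coord x k else 0)" if s: "s < 2" for s k
  proof -
    have "coord (laguerre_embed a s (F s)) k = (if k mod 2 = s then
        (if k div 2 \<in> {..<N} then coord x (2 * (k div 2) + s) else 0) else 0)"
      unfolding sq_orthonormal_basis.coord_embed[OF laguerre_basis F s] unfolding F_def
      by (subst sq_orthonormal_basis.coeff_psum[OF laguerre_basis finite_lessThan]) (rule refl)
    moreover have "2 * (k div 2) + s = k" if "k mod 2 = s" using mult_div_mod_eq[of 2 k] that by simp
    moreover have "coord x k = 0" if "\<not> k div 2 < N" using N[of k] that by (metis div_le_dividend le_less_trans)
    ultimately show ?thesis by auto
  qed
  have x: "x = laguerre_embed a 0 (F 0) + laguerre_embed a 1 (F 1)"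
    by (rule ell2_eqI) (use emb[of 0] emb[of 1] in \<open>auto simp del: of_nat_0 of_nat_1\<close>)
  show ?thesis
    unfolding hamiltonian_embed[OF fin x F tF] by (subst (1) x) (intro oper_sumI jacobi_opI F tF; simp)
qed

text \<open>The sum contains the graph on finite combinations and, as its own adjoint, is closed, so
  it contains the closure. Conversely, each component is approximated in the graph norm by
  polynomials, whose embeddings are finite combinations.\<close>

lemma free_hamiltonian_eq: "free_hamiltonian a = oper_sum (jacobi_op a 0) (jacobi_op a 1)"
proof (rule antisym)
  have "closed (oper_sum (jacobi_op a 0) (jacobi_op a 1))"
    using closed_adjoint[OF closed_UNIV] J.adjoint_oper_sum by metis
  then show "free_hamiltonian a \<subseteq> oper_sum (jacobi_op a 0) (jacobi_op a 1)"
    unfolding free_hamiltonian_closure using hamiltonian_in_oper_sum by (intro closure_minimal) auto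
  show "oper_sum (jacobi_op a 0) (jacobi_op a 1) \<subseteq> free_hamiltonian a"
  proof clarify
    fix x y assume xy: "(x, y) \<in> oper_sum (jacobi_op a 0) (jacobi_op a 1)"
    obtain x0 y0 x1 y1 where p: "(x0, y0) \<in> jacobi_op a 0" "(x1, y1) \<in> jacobi_op a 1" "x = x0 + x1" "y = y0 + y1"
      using xy by (rule oper_sumE)
    have approx: "\<exists>Q. (\<forall>n. Q n \<in> poly_functions) \<and> (\<lambda>n. laguerre_embed a s (Q n)) \<longlonglongrightarrow> u
        \<and> (\<lambda>n. laguerre_embed a s (\<lambda>t. of_real t * Q n t)) \<longlonglongrightarrow> v"
      if s: "s < 2" and uv: "(u, v) \<in> jacobi_op a s" for s u v
    proof -
      obtain f where f: "f \<in> sq_integrable (gamma_measure (a + real s))"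
        "(\<lambda>t. of_real t * f t) \<in> sq_integrable (gamma_measure (a + real s))"
        "u = laguerre_embed a s f" "v = laguerre_embed a s (\<lambda>t. of_real t * f t)"
        using s uv by (rule jacobi_opE)
      from poly_graph_dense[OF shifted_pos f(1,2)] obtain Q where Q: "\<forall>n. Q n \<in> poly_functions"
        "(\<lambda>n. sq_dist (gamma_measure (a + real s)) f (Q n)) \<longlonglongrightarrow> 0"
        "(\<lambda>n. sq_dist (gamma_measure (a + real s)) (\<lambda>t. of_real t * f t) (\<lambda>t. of_real t * Q n t)) \<longlonglongrightarrow> 0"
        by (elim exE conjE)
      show ?thesis
        unfolding f(3,4) using Q
        by (intro exI[of _ Q] conjI unitary_model.U_tendsto[OF unitary_laguerre[OF s]] f poly_functions_sq) auto
    qed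
    obtain Q0 where Q0: "\<And>n. Q0 n \<in> poly_functions" "(\<lambda>n. laguerre_embed a 0 (Q0 n)) \<longlonglongrightarrow> x0"
      "(\<lambda>n. laguerre_embed a 0 (\<lambda>t. of_real t * Q0 n t)) \<longlonglongrightarrow> y0" using approx[OF _ p(1)] by auto
    obtain Q1 where Q1: "\<And>n. Q1 n \<in> poly_functions" "(\<lambda>n. laguerre_embed a 1 (Q1 n)) \<longlonglongrightarrow> x1"
      "(\<lambda>n. laguerre_embed a 1 (\<lambda>t. of_real t * Q1 n t)) \<longlonglongrightarrow> y1" using approx[OF _ p(2)] by auto
    define X where "X n = laguerre_embed a 0 (Q0 n) + laguerre_embed a 1 (Q1 n)" for n
    have X: "X n \<in> finite_combinations" for n
      using embed_poly_finite[OF Q0(1)[of n], of 0] embed_poly_finite[OF Q1(1)[of n], of 1]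
      unfolding X_def finite_combinations_def cspan_def by (intro cvec.span_add) auto
    have HX: "hamiltonian a (X n) = laguerre_embed a 0 (\<lambda>t. of_real t * Q0 n t) + laguerre_embed a 1 (\<lambda>t. of_real t * Q1 n t)" for n
      using hamiltonian_embed[where F = "\<lambda>s. if s = 0 then Q0 n else Q1 n", OF finite_support_finite_combinations[OF X[of n]]]
        Q0(1) Q1(1) poly_functions_sq by (simp add: X_def)
    have "(\<lambda>n. (X n, hamiltonian a (X n))) \<longlonglongrightarrow> (x, y)"
      unfolding HX p(3,4) unfolding X_def by (intro tendsto_Pair tendsto_add Q0 Q1)
    then show "(x, y) \<in> free_hamiltonian a"
      unfolding free_hamiltonian_closure closure_sequential using X
      by (intro exI[of _ "\<lambda>n. (X n, hamiltonian a (X n))"]) auto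
  qed
qed

end

section \<open>Spectrum and multiplicity of the free Hamiltonian\<close>

theorem theorem7:
  fixes a :: real
  assumes "a > 0"
  shows "self_adjoint_in UNIV (free_hamiltonian a) \<and>
    spectrum_in UNIV (free_hamiltonian a) = complex_of_real ` {0..} \<and>
    orth_direct_sum V_even V_odd \<and>
    (\<forall>W\<in>{V_even, V_odd}.
       preserves (free_hamiltonian a) W \<and>
       simple_spectrum_in W (restriction (free_hamiltonian a) W) \<and>
       spectrum_in W (restriction (free_hamiltonian a) W) = complex_of_real ` {0..})"
proof -
  interpret J: orthogonal_pair "parity_space 0" "parity_space 1" "jacobi_op a 0" "jacobi_op a 1"
    by (rule orthogonal_pair_jacobi[OF assms])
  interpret J': orthogonal_pair "parity_space 1" "parity_space 0" "jacobi_op a 1" "jacobi_op a 0"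
    by (rule J.swap)
  have sum: "free_hamiltonian a = oper_sum (jacobi_op a 0) (jacobi_op a 1)"
    by (rule free_hamiltonian_eq[OF assms])
  have sum': "free_hamiltonian a = oper_sum (jacobi_op a 1) (jacobi_op a 0)"
    unfolding sum by (rule oper_sum_commute)
  have spec: "spectrum_in (parity_space s) (jacobi_op a s) = complex_of_real ` {0..}" if "s < 2" for s
    by (rule spectrum_jacobi[OF assms that])
  \<comment> \<open>The resolvent set of the sum lies between the intersection of the two parity
    resolvent sets and the even one; both bounds coincide because the parity spectra are
    equal.\<close>
  have "resolvent_set_in UNIV (free_hamiltonian a) = - complex_of_real ` {0..}"
    using J.resolvent_oper_sum_subset J.resolvent_oper_sum_superset spec[of 0] spec[of 1]
    unfolding sum spectrum_in_def by auto
  then have "spectrum_in UNIV (free_hamiltonian a) = complex_of_real ` {0..}"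
    by (simp add: spectrum_in_def)
  moreover have "orth_direct_sum V_even V_odd"
    unfolding orth_direct_sum_def V_even_eq V_odd_eq using J.orth J.decomp by blast
  moreover have "preserves (free_hamiltonian a) V_even"
    unfolding V_even_eq sum by (rule J.preserves_oper_sum)
  moreover have "preserves (free_hamiltonian a) V_odd"
    unfolding V_odd_eq sum' by (rule J'.preserves_oper_sum)
  moreover have "restriction (free_hamiltonian a) V_even = jacobi_op a 0"
    unfolding V_even_eq sum by (rule J.restriction_oper_sum)
  moreover have "restriction (free_hamiltonian a) V_odd = jacobi_op a 1"
    unfolding V_odd_eq sum' by (rule J'.restriction_oper_sum)
  moreover have "self_adjoint_in UNIV (free_hamiltonian a)"
    unfolding sum by (rule J.self_adjoint_oper_sum)
  moreover have "simple_spectrum_in V_even (jacobi_op a 0)" "simple_spectrum_in V_odd (jacobi_op a 1)"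
    unfolding V_even_eq V_odd_eq by (intro simple_spectrum_jacobi assms; simp)+
  moreover have "spectrum_in V_even (jacobi_op a 0) = complex_of_real ` {0..}"
    "spectrum_in V_odd (jacobi_op a 1) = complex_of_real ` {0..}"
    unfolding V_even_eq V_odd_eq by (intro spec; simp)+
  ultimately show ?thesis by simp
qed

end
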